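(* Let $X=X_{\Sigma_A}$ be a smooth projective toric weak Fano variety of dimension $n$ and let $(E,\overline\partial,\theta,h)$ be the harmonic bundle on $S_2^0$ associated to the variation of pure polarized ncHodge structures ${}_0\mathcal{QM}^{loc}_{\widetilde A}$ (see context). Let $U\subset\mathbb C^r$ be a Zariski open neighbourhood of the origin contained in $\overline{S_2^0}$ on which the logarithmic extension $\widetilde{\mathcal R}/\widetilde{\mathcal I}$ is $\mathcal O_{\mathbb C_z\times U}$-coherent (such $U$ exists, and $\widetilde{\mathcal R}/\widetilde{\mathcal I}$ is then $\mathcal O_{\mathbb C_z\times U}$-free). Put $Z=\bigcup_{a=1}^r\{q_a=0\}$ and $\widetilde U=(U\setminus Z)^{an}\subset S_2^{0,an}$. Then the restriction of $(E,\overline\partial,\theta,h)$ to $\widetilde U$ is tame along $Z$.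
   Context: **Notation.** Weak Fano: anticanonical divisor nef. $\underline a_1,\dots,\underline a_m\in\mathbb Z^n$ are the primitive ray generators of the fan of $X$, $\mathbb L=\{\underline l\in\mathbb Z^m:\sum l_i\underline a_i=0\}$, $r=m-n$, $\mathbb L^\vee\cong\mathrm{Pic}(X)$, $\rho\in\mathbb L^\vee$ the anticanonical class; $p_1,\dots,p_r$ is a basis of $\mathbb L^\vee$ of nef classes whose cone contains $\rho$; $p_a^\vee$ the dual basis, $m_{ia}$ the $i$-th coordinate of $p_a^\vee$. $S_2=\mathrm{Spec}\,\mathbb C[\mathbb L]\cong(\mathbb C^* )^r\subset\mathbb C^r$ with coordinates $q_a$. With integers $g_{ia}\ge0$ such that $(g_{ia})_i$ maps to $p_a$ under $\mathbb Z^m\to\mathbb L^\vee$, $S_2^0\subset S_2$ is the Zariski open set of $\underline q$ such that $\sum_i\underline y^{\underline a_i}\prod_aq_a^{g_{ia}}$ is non-degenerate (for each proper face $\sigma$ of $\mathrm{Conv}(\underline0,\underline a_1,\dots,\underline a_m)$ not containing $\underline0$, the sum of terms with $\underline a_i\in\sigma$ has no critical point in $(\mathbb C^* )^n$), and $\overline{S_2^0}$ is the complement in $\mathbb C^r$ of the closure of $S_2\setminus S_2^0$. **Modules.** $\widetilde{\mathcal R}$ is the sheaf of algebras on $\mathbb C_z\times\mathbb C^r$ associated to $\mathbb C[\underline q,z]\langle zq_1\partial_{q_1},\dots,zq_r\partial_{q_r},z^2\partial_z\rangle$, $\widetilde{\mathcal I}$ its left ideal generated by $z^2\partial_z+\sum_a\rho(p_a^\vee)zq_a\partial_{q_a}$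 and, for $\underline l\in\mathbb L$, $$\prod_{p_a(\underline l)>0}q_a^{p_a(\underline l)}\prod_{l_i<0}\prod_{\nu=0}^{-l_i-1}\Big(\sum_am_{ia}zq_a\partial_{q_a}-\nu z\Big)-\prod_{p_a(\underline l)<0}q_a^{-p_a(\underline l)}\prod_{l_i>0}\prod_{\nu=0}^{l_i-1}\Big(\sum_am_{ia}zq_a\partial_{q_a}-\nu z\Big).$$ ${}_0\mathcal{QM}^{loc}_{\widetilde A}$ is the restriction of $\widetilde{\mathcal R}/\widetilde{\mathcal I}$ to $\mathbb C_z\times S_2^0$, a locally free $\mathcal O$-module with connection $\nabla$ given by the action of $zq_a\partial_{q_a}$, $z^2\partial_z$. **ncHodge structure.** $\mathcal H={}_0\mathcal{QM}^{loc}_{\widetilde A}$ underlies a variation of pure polarized ncHodge structures of weight $n$ on $S_2^0$: there are an $\mathbb R$-local system $\mathcal L$ with $\mathcal L\otimes\mathcal O^{an}\cong\mathcal H^{an}_{|\mathbb C_z^*\times S_2^0}$ as flat bundles (induced by the real structure on the perverse cohomology ${}^p\mathcal H^0R(W,q)_*\underline{\mathbb R}$ of the Landau–Ginzburg model $W=\sum_iw_i$, $q(\underline w)=(\prod_iw_i^{m_{ia}})_a$) and a $(-1)^n$-symmetric flat pairing $P:\mathcal L\otimes\iota^*\mathcal L\to i^n\underline{\mathbb R}$ ($\iota(z,q)=(-z,q)$) inducing $\mathcal H\otimes\iota^*\mathcal H\to z^n\mathcal O$, non-degenerate, such that the following holds. With $\gamma(z,q)=(\overline z^{-1},q)$, gluing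 $\mathcal H$ and $\overline{\gamma^*\mathcal H}$ over $\mathbb C_z^*$ by the anti-linear map $c$: $a\mapsto$ parallel transport of $\overline{z^{-n}a}$ gives a bundle $\widehat{\mathcal H}$ on $\mathbb P^1\times S_2^0$ with $\widehat{\mathcal H}=p^*p_*\widehat{\mathcal H}$ ($p$ the projection to $S_2^0$), and $h(s,t)=z^{-n}P(s,c(t))$ is positive definite on $p_*\widehat{\mathcal H}$. **Associated harmonic bundle.** $E=p_*\widehat{\mathcal H}$ with the holomorphic structure $\overline\partial$ from $E\cong\mathcal H/z\mathcal H\otimes_{\mathcal O}\mathcal C^{an}$, Higgs field $\theta=[z\nabla]\in\mathcal End(\mathcal H/z\mathcal H)\otimes\Omega^1_{S_2^0}$ (derivatives in the directions of $S_2^0$), and metric $h$. **Tameness.** Writing $\theta=\sum_{a=1}^r\theta_a\frac{dq_a}{q_a}$ on $\widetilde U$ with $\theta_a\in\mathcal End_{\mathcal O_{\widetilde U}}(\mathcal H/z\mathcal H)$, the harmonic bundle is tame along $Z$ if the coefficients of the characteristic polynomials of all $\theta_a$ extend to holomorphic functions on $U^{an}$. *)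

theory Defs
  imports
    "HOL-Analysis.Analysis"
    "HOL-Library.Poly_Mapping"
    "HOL-Library.Function_Algebras"
    "HOL-Algebra.Module"
    "Jordan_Normal_Form.Char_Poly"
begin

no_notation Matrix.vec_index (infixl "$" 100)

section \<open>Fans and nef classes\<close>

definition rvec :: "int ^ 'n \<Rightarrow> real ^ 'n" where
  "rvec v = (\<chi> j. real_of_int (v $ j))"

definition rational_cone :: "(real ^ 'n::finite) set \<Rightarrow> bool" where
  "rational_cone C \<longleftrightarrow> (\<exists>S. finite S \<and> C = convex_cone hull (rvec ` S))"

definition strongly_convex :: "(real ^ 'n::finite) set \<Rightarrow> bool" where
  "strongly_convex C \<longleftrightarrow> C \<inter> uminus ` C = {0}"

definition fan :: "(real ^ 'n::finite) set set \<Rightarrow> bool" where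
  "fan F \<longleftrightarrow> finite F \<and> F \<noteq> {} \<and>
     (\<forall>C\<in>F. rational_cone C \<and> strongly_convex C) \<and>
     (\<forall>C\<in>F. \<forall>D. D face_of C \<and> D \<noteq> {} \<longrightarrow> D \<in> F) \<and>
     (\<forall>C\<in>F. \<forall>D\<in>F. (C \<inter> D) face_of C \<and> (C \<inter> D) face_of D)"

definition lattice_basis :: "(int ^ 'n::finite) set \<Rightarrow> bool" where
  "lattice_basis B \<longleftrightarrow> finite B \<and>
     (\<forall>v. \<exists>!c. (\<forall>b. b \<notin> B \<longrightarrow> c b = 0) \<and> v = (\<Sum>b\<in>B. c b *s b))"

text \<open>The toric variety of a fan is smooth, complete or projective iff the fan is so in the
  following sense; projectivity is the existence of an ample divisor, i.e. of a strictly
  convex support function.\<close>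

definition smooth_fan :: "(real ^ 'n::finite) set set \<Rightarrow> bool" where
  "smooth_fan F \<longleftrightarrow>
     (\<forall>C\<in>F. \<exists>B S. lattice_basis B \<and> S \<subseteq> B \<and> C = convex_cone hull (rvec ` S))"

definition complete_fan :: "(real ^ 'n::finite) set set \<Rightarrow> bool" where
  "complete_fan F \<longleftrightarrow> \<Union>F = UNIV"

definition support_function :: "(real ^ 'n::finite) set set \<Rightarrow> (real ^ 'n \<Rightarrow> real) \<Rightarrow> bool" where
  "support_function F \<phi> \<longleftrightarrow>
     (\<forall>C\<in>F. \<exists>u. linear u \<and> (\<forall>x\<in>C. \<phi> x = u x)) \<and> (\<forall>v. \<phi> (rvec v) \<in> \<int>)"

definition projective_fan :: "(real ^ 'n::finite) set set \<Rightarrow> bool" where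
  "projective_fan F \<longleftrightarrow> complete_fan F \<and>
     (\<exists>\<phi>. support_function F \<phi> \<and> convex_on UNIV \<phi> \<and>
        (\<forall>C\<in>F. interior C \<noteq> {} \<longrightarrow> (\<exists>u. linear u \<and> {x. \<phi> x = u x} = C)))"

definition primitive :: "int ^ 'n::finite \<Rightarrow> bool" where
  "primitive v \<longleftrightarrow> v \<noteq> 0 \<and> (\<forall>k w. v = k *s w \<longrightarrow> \<bar>k\<bar> = 1)"

definition ray_generators :: "(real ^ 'n::finite) set set \<Rightarrow> ('m::finite \<Rightarrow> int ^ 'n) \<Rightarrow> bool" where
  "ray_generators F a \<longleftrightarrow>
     bij_betw a UNIV {v. primitive v \<and> convex_cone hull {rvec v} \<in> F}"

text \<open>The divisor \<open>\<Sum>i. d i * D\<^sub>i\<close> is nef iff the support function with value \<open>d i\<close>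
  at the \<open>i\<close>-th ray generator is convex.\<close>

definition nef_divisor ::
  "(real ^ 'n::finite) set set \<Rightarrow> ('m::finite \<Rightarrow> int ^ 'n) \<Rightarrow> ('m \<Rightarrow> int) \<Rightarrow> bool" where
  "nef_divisor F a d \<longleftrightarrow>
     (\<exists>\<phi>. support_function F \<phi> \<and> (\<forall>i. \<phi> (rvec (a i)) = real_of_int (d i)) \<and> convex_on UNIV \<phi>)"

definition weak_Fano :: "(real ^ 'n::finite) set set \<Rightarrow> ('m::finite \<Rightarrow> int ^ 'n) \<Rightarrow> bool" where
  "weak_Fano F a \<longleftrightarrow> nef_divisor F a (\<lambda>i. 1)"

definition relation_lattice :: "('m::finite \<Rightarrow> int ^ 'n::finite) \<Rightarrow> (int ^ 'm) set" where
  "relation_lattice a = {l. (\<Sum>i\<in>UNIV. (l $ i) *s a i) = 0}"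

text \<open>Elements of the dual lattice are represented by functions on \<open>int ^ 'm\<close>, of which only
  the restriction to the relation lattice matters.\<close>

definition dual_element :: "('m::finite \<Rightarrow> int ^ 'n::finite) \<Rightarrow> (int ^ 'm \<Rightarrow> int) \<Rightarrow> bool" where
  "dual_element a f \<longleftrightarrow>
     (\<forall>l\<in>relation_lattice a. \<forall>l'\<in>relation_lattice a. f (l + l') = f l + f l')"

definition divisor_class :: "('m::finite \<Rightarrow> int) \<Rightarrow> int ^ 'm \<Rightarrow> int" where
  "divisor_class d l = (\<Sum>i\<in>UNIV. d i * l $ i)"

definition anticanonical :: "int ^ 'm::finite \<Rightarrow> int" where
  "anticanonical = divisor_class (\<lambda>i. 1)"

definition nef_class ::
  "(real ^ 'n::finite) set set \<Rightarrow> ('m::finite \<Rightarrow> int ^ 'n) \<Rightarrow> (int ^ 'm \<Rightarrow> int) \<Rightarrow> bool" where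
  "nef_class F a f \<longleftrightarrow>
     (\<exists>d. nef_divisor F a d \<and> (\<forall>l\<in>relation_lattice a. f l = divisor_class d l))"

definition dual_lattice_basis ::
  "('m::finite \<Rightarrow> int ^ 'n::finite) \<Rightarrow> ('r::finite \<Rightarrow> int ^ 'm \<Rightarrow> int) \<Rightarrow> bool" where
  "dual_lattice_basis a p \<longleftrightarrow> (\<forall>b. dual_element a (p b)) \<and>
     (\<forall>f. dual_element a f \<longrightarrow>
        (\<exists>!c. \<forall>l\<in>relation_lattice a. f l = (\<Sum>b\<in>UNIV. c b * p b l)))"

definition nef_basis ::
  "(real ^ 'n::finite) set set \<Rightarrow> ('m::finite \<Rightarrow> int ^ 'n) \<Rightarrow> ('r::finite \<Rightarrow> int ^ 'm \<Rightarrow> int) \<Rightarrow> bool"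
  where
  "nef_basis F a p \<longleftrightarrow> dual_lattice_basis a p \<and> (\<forall>b. nef_class F a (p b)) \<and>
     (\<exists>c::'r \<Rightarrow> real. (\<forall>b. c b \<ge> 0) \<and>
        (\<forall>l\<in>relation_lattice a.
           real_of_int (anticanonical l) = (\<Sum>b\<in>UNIV. c b * real_of_int (p b l))))"

definition dual_basis ::
  "('m::finite \<Rightarrow> int ^ 'n::finite) \<Rightarrow> ('r::finite \<Rightarrow> int ^ 'm \<Rightarrow> int) \<Rightarrow> ('r \<Rightarrow> int ^ 'm) \<Rightarrow> bool"
  where
  "dual_basis a p pd \<longleftrightarrow> (\<forall>b. pd b \<in> relation_lattice a) \<and>
     (\<forall>b c. p b (pd c) = (if b = c then 1 else 0))"

definition effective_lift ::
  "('m::finite \<Rightarrow> int ^ 'n::finite) \<Rightarrow> ('r::finite \<Rightarrow> int ^ 'm \<Rightarrow> int) \<Rightarrow> ('m \<Rightarrow> 'r \<Rightarrow> nat) \<Rightarrow> bool"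
  where
  "effective_lift a p g \<longleftrightarrow>
     (\<forall>b. \<forall>l\<in>relation_lattice a. p b l = divisor_class (\<lambda>i. int (g i b)) l)"

section \<open>Polynomials, Zariski topology, holomorphic functions\<close>

type_synonym 'k cpoly = "('k \<Rightarrow>\<^sub>0 nat) \<Rightarrow>\<^sub>0 complex"

definition pconst :: "complex \<Rightarrow> 'k cpoly" where
  "pconst c = Poly_Mapping.single 0 c"

definition pvar :: "'k \<Rightarrow> 'k cpoly" where
  "pvar i = Poly_Mapping.single (Poly_Mapping.single i 1) 1"

definition peval :: "'k::finite cpoly \<Rightarrow> complex ^ 'k \<Rightarrow> complex" where
  "peval f x = (\<Sum>m\<in>Poly_Mapping.keys f.
     Poly_Mapping.lookup f m * (\<Prod>i\<in>UNIV. (x $ i) ^ Poly_Mapping.lookup m i))"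

definition ppartial :: "'k \<Rightarrow> 'k cpoly \<Rightarrow> 'k cpoly" where
  "ppartial i f = (\<Sum>m\<in>Poly_Mapping.keys f.
     Poly_Mapping.single (m - Poly_Mapping.single i 1)
       (of_nat (Poly_Mapping.lookup m i) * Poly_Mapping.lookup f m))"

definition zariski_closed :: "(complex ^ 'k::finite) set \<Rightarrow> bool" where
  "zariski_closed X \<longleftrightarrow> (\<exists>T. X = {x. \<forall>f\<in>T. peval f x = 0})"

definition zariski_open :: "(complex ^ 'k::finite) set \<Rightarrow> bool" where
  "zariski_open X \<longleftrightarrow> zariski_closed (- X)"

definition zariski_closure :: "(complex ^ 'k::finite) set \<Rightarrow> (complex ^ 'k) set" where
  "zariski_closure X = \<Inter>{Y. zariski_closed Y \<and> X \<subseteq> Y}"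

definition mv_holomorphic_on ::
  "(complex ^ 'k::finite \<Rightarrow> complex) \<Rightarrow> (complex ^ 'k) set \<Rightarrow> bool" where
  "mv_holomorphic_on f W \<longleftrightarrow> open W \<and>
     (\<forall>x\<in>W. \<exists>D. (f has_derivative D) (at x) \<and> (\<forall>c v. D (c *s v) = c * D v))"

definition partial_at :: "'k \<Rightarrow> (complex ^ 'k::finite \<Rightarrow> complex) \<Rightarrow> complex ^ 'k \<Rightarrow> complex" where
  "partial_at i f x = frechet_derivative f (at x) (axis i 1)"

section \<open>The parameter space of the Landau-Ginzburg model\<close>

definition torus :: "(complex ^ 'k::finite) set" where
  "torus = {x. \<forall>i. x $ i \<noteq> 0}"

definition boundary_divisor :: "(complex ^ 'r::finite) set" where
  "boundary_divisor = (\<Union>b. {q. q $ b = 0})"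

definition face_potential ::
  "('m::finite \<Rightarrow> int ^ 'n::finite) \<Rightarrow> ('m \<Rightarrow> 'r::finite \<Rightarrow> nat) \<Rightarrow> complex ^ 'r \<Rightarrow>
   (real ^ 'n) set \<Rightarrow> complex ^ 'n \<Rightarrow> complex" where
  "face_potential a g q \<sigma> y =
     (\<Sum>i | rvec (a i) \<in> \<sigma>. (\<Prod>j\<in>UNIV. (y $ j) powi (a i $ j)) * (\<Prod>b\<in>UNIV. (q $ b) ^ g i b))"

definition nondegenerate ::
  "('m::finite \<Rightarrow> int ^ 'n::finite) \<Rightarrow> ('m \<Rightarrow> 'r::finite \<Rightarrow> nat) \<Rightarrow> complex ^ 'r \<Rightarrow> bool" where
  "nondegenerate a g q \<longleftrightarrow>
     (let Q = convex hull (insert 0 (range (\<lambda>i. rvec (a i)))) in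
      \<forall>\<sigma>. \<sigma> face_of Q \<and> \<sigma> \<noteq> {} \<and> \<sigma> \<noteq> Q \<and> 0 \<notin> \<sigma> \<longrightarrow>
        \<not> (\<exists>y\<in>torus. (face_potential a g q \<sigma> has_derivative (\<lambda>_. 0)) (at y)))"

definition S20 ::
  "('m::finite \<Rightarrow> int ^ 'n::finite) \<Rightarrow> ('m \<Rightarrow> 'r::finite \<Rightarrow> nat) \<Rightarrow> (complex ^ 'r) set" where
  "S20 a g = {q\<in>torus. nondegenerate a g q}"

definition S20_bar ::
  "('m::finite \<Rightarrow> int ^ 'n::finite) \<Rightarrow> ('m \<Rightarrow> 'r::finite \<Rightarrow> nat) \<Rightarrow> (complex ^ 'r) set" where
  "S20_bar a g = - zariski_closure (torus - S20 a g)"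

section \<open>The algebra of differential operators and the left ideal\<close>

text \<open>The coordinates on \<open>\<complex>\<^sub>z \<times> \<complex>\<^sup>r\<close> are indexed by \<open>'r option\<close>: \<open>None\<close> is \<open>z\<close> and
  \<open>Some b\<close> is \<open>q\<^sub>b\<close>. The Weyl algebra acts faithfully on the polynomial ring, so the algebra
  \<open>\<complex>[q,z]\<langle>zq\<^sub>b\<partial>\<^sub>b, z\<^sup>2\<partial>\<^sub>z\<rangle>\<close> is realised as a subalgebra of the
  linear endomorphisms of \<open>\<complex>[q,z]\<close>, with composition as product.\<close>

type_synonym 'r oper = "'r option cpoly \<Rightarrow> 'r option cpoly"

definition pt :: "complex \<Rightarrow> complex ^ 'r::finite \<Rightarrow> complex ^ 'r option" where
  "pt z q = (\<chi> i. case i of None \<Rightarrow> z | Some b \<Rightarrow> q $ b)"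

definition mulop :: "'r option cpoly \<Rightarrow> 'r oper" where
  "mulop f = (\<lambda>h. f * h)"

definition euler :: "'r \<Rightarrow> 'r oper" where
  "euler b = (\<lambda>h. pvar None * pvar (Some b) * ppartial (Some b) h)"

definition z2dz :: "'r oper" where
  "z2dz = (\<lambda>h. pvar None ^ 2 * ppartial None h)"

inductive_set Rop :: "'r oper set" where
  "mulop f \<in> Rop"
| "euler b \<in> Rop"
| "z2dz \<in> Rop"
| "A \<in> Rop \<Longrightarrow> B \<in> Rop \<Longrightarrow> A + B \<in> Rop"
| "A \<in> Rop \<Longrightarrow> B \<in> Rop \<Longrightarrow> A \<circ> B \<in> Rop"

inductive_set left_ideal :: "'r oper set \<Rightarrow> 'r oper set" for G where
  "0 \<in> left_ideal G"
| "A \<in> G \<Longrightarrow> A \<in> left_ideal G"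
| "A \<in> left_ideal G \<Longrightarrow> B \<in> left_ideal G \<Longrightarrow> A + B \<in> left_ideal G"
| "A \<in> Rop \<Longrightarrow> B \<in> left_ideal G \<Longrightarrow> A \<circ> B \<in> left_ideal G"

definition ray_op :: "('r::finite \<Rightarrow> int ^ 'm::finite) \<Rightarrow> 'm \<Rightarrow> 'r oper" where
  "ray_op pd i = (\<Sum>b\<in>UNIV. mulop (pconst (of_int (pd b $ i))) \<circ> euler b)"

fun falling_op :: "'r oper \<Rightarrow> nat \<Rightarrow> 'r oper" where
  "falling_op D 0 = id"
| "falling_op D (Suc \<nu>) = (D - mulop (of_nat \<nu> * pvar None)) \<circ> falling_op D \<nu>"

text \<open>The factors of the following product commute, so the fold does not depend on an order.\<close>

definition ray_product :: "('r::finite \<Rightarrow> int ^ 'm::finite) \<Rightarrow> 'm set \<Rightarrow> ('m \<Rightarrow> nat) \<Rightarrow> 'r oper" where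
  "ray_product pd J e = Finite_Set.fold (\<lambda>i A. falling_op (ray_op pd i) (e i) \<circ> A) id J"

definition box_op ::
  "('r::finite \<Rightarrow> int ^ 'm::finite \<Rightarrow> int) \<Rightarrow> ('r \<Rightarrow> int ^ 'm) \<Rightarrow> int ^ 'm \<Rightarrow> 'r oper" where
  "box_op p pd l =
     (mulop (\<Prod>b | p b l > 0. pvar (Some b) ^ nat (p b l))
       \<circ> ray_product pd {i. l $ i < 0} (\<lambda>i. nat (- (l $ i))))
     - (mulop (\<Prod>b | p b l < 0. pvar (Some b) ^ nat (- p b l))
       \<circ> ray_product pd {i. l $ i > 0} (\<lambda>i. nat (l $ i)))"

definition homogeneity_op :: "('r::finite \<Rightarrow> int ^ 'm::finite) \<Rightarrow> 'r oper" where
  "homogeneity_op pd =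
     z2dz + (\<Sum>b\<in>UNIV. mulop (pconst (of_int (anticanonical (pd b)))) \<circ> euler b)"

definition QM_ideal ::
  "('m::finite \<Rightarrow> int ^ 'n::finite) \<Rightarrow> ('r::finite \<Rightarrow> int ^ 'm \<Rightarrow> int) \<Rightarrow> ('r \<Rightarrow> int ^ 'm) \<Rightarrow> 'r oper set"
  where
  "QM_ideal a p pd = left_ideal (insert (homogeneity_op pd) (box_op p pd ` relation_lattice a))"

section \<open>The module of a left ideal: coherence, local freeness, fibres\<close>

text \<open>From here on \<open>I\<close> is a left ideal of \<open>Rop\<close> and the quasi-coherent sheaf associated to
  \<open>Rop / I\<close> on \<open>\<complex>\<^sub>z \<times> \<complex>\<^sup>r\<close> is considered. It is coherent (locally free of finite
  rank) near a point iff a localisation at some \<open>f\<close> not vanishing there is finitely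
  generated (free of finite rank) over \<open>\<complex>[q,z]\<^sub>f\<close>.\<close>

definition generates_at :: "'r oper set \<Rightarrow> 'r option cpoly \<Rightarrow> nat \<Rightarrow> (nat \<Rightarrow> 'r oper) \<Rightarrow> bool" where
  "generates_at I f k e \<longleftrightarrow> (\<forall>j<k. e j \<in> Rop) \<and>
     (\<forall>A\<in>Rop. \<exists>N g. (mulop (f ^ N) \<circ> A) - (\<Sum>j<k. mulop (g j) \<circ> e j) \<in> I)"

definition coherent_on :: "'r::finite oper set \<Rightarrow> (complex ^ 'r) set \<Rightarrow> bool" where
  "coherent_on I U \<longleftrightarrow>
     (\<forall>z. \<forall>q\<in>U. \<exists>f k e. peval f (pt z q) \<noteq> 0 \<and> generates_at I f k e)"

definition locally_free_on :: "'r::finite oper set \<Rightarrow> (complex ^ 'r) set \<Rightarrow> bool" where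
  "locally_free_on I U \<longleftrightarrow>
     (\<forall>z. \<forall>q\<in>U. \<exists>f k e. peval f (pt z q) \<noteq> 0 \<and> generates_at I f k e \<and>
        (\<forall>g. (\<Sum>j<k. mulop (g j) \<circ> e j) \<in> I \<longrightarrow> (\<forall>j<k. g j = 0)))"

text \<open>The fibre at \<open>x\<close> is \<open>Rop / (I + \<mm>\<^sub>x Rop)\<close>, with cosets as elements.\<close>

inductive_set fibre_null :: "'r::finite oper set \<Rightarrow> complex ^ 'r option \<Rightarrow> 'r oper set" for I x where
  "A \<in> I \<Longrightarrow> A \<in> fibre_null I x"
| "peval f x = 0 \<Longrightarrow> A \<in> Rop \<Longrightarrow> mulop f \<circ> A \<in> fibre_null I x"
| "A \<in> fibre_null I x \<Longrightarrow> B \<in> fibre_null I x \<Longrightarrow> A + B \<in> fibre_null I x"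

definition cls :: "'r::finite oper set \<Rightarrow> complex ^ 'r option \<Rightarrow> 'r oper \<Rightarrow> 'r oper set" where
  "cls I x A = {B\<in>Rop. B - A \<in> fibre_null I x}"

text \<open>Complex vector spaces are \<open>module\<close> records, whose fields \<open>mult\<close> and \<open>one\<close> play no role.\<close>

definition fibre :: "'r::finite oper set \<Rightarrow> complex ^ 'r option \<Rightarrow> (complex, 'r oper set) module" where
  "fibre I x = \<lparr> carrier = cls I x ` Rop, mult = undefined, one = undefined,
     zero = cls I x 0,
     add = (\<lambda>v w. \<Union>A\<in>v. \<Union>B\<in>w. cls I x (A + B)),
     smult = (\<lambda>c v. \<Union>A\<in>v. cls I x (mulop (pconst c) \<circ> A)) \<rparr>"

definition fibre_action ::
  "'r::finite oper set \<Rightarrow> complex ^ 'r option \<Rightarrow> 'r oper \<Rightarrow> 'r oper set \<Rightarrow> 'r oper set" where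
  "fibre_action I x T v = (\<Union>A\<in>v. cls I x (T \<circ> A))"

section \<open>Linear algebra\<close>

definition lincomb :: "(complex, 'v) module \<Rightarrow> nat \<Rightarrow> (nat \<Rightarrow> complex) \<Rightarrow> (nat \<Rightarrow> 'v) \<Rightarrow> 'v" where
  "lincomb V k c e = finsum V (\<lambda>j. c j \<odot>\<^bsub>V\<^esub> e j) {..<k}"

definition is_basis :: "(complex, 'v) module \<Rightarrow> nat \<Rightarrow> (nat \<Rightarrow> 'v) \<Rightarrow> bool" where
  "is_basis V k e \<longleftrightarrow> (\<forall>j<k. e j \<in> carrier V) \<and>
     (\<forall>v\<in>carrier V. \<exists>!c. (\<forall>j\<ge>k. c j = 0) \<and> v = lincomb V k c e)"

definition endo_char_poly :: "(complex, 'v) module \<Rightarrow> ('v \<Rightarrow> 'v) \<Rightarrow> complex poly" where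
  "endo_char_poly V T = (THE f. \<exists>k e M. is_basis V k e \<and> M \<in> carrier_mat k k \<and>
     (\<forall>j<k. T (e j) = lincomb V k (\<lambda>i. M $$ (i, j)) e) \<and> f = char_poly M)"

definition linear_form :: "(complex, 'v) module \<Rightarrow> ('v \<Rightarrow> complex) \<Rightarrow> bool" where
  "linear_form V f \<longleftrightarrow>
     (\<forall>u\<in>carrier V. \<forall>v\<in>carrier V. f (u \<oplus>\<^bsub>V\<^esub> v) = f u + f v) \<and>
     (\<forall>c. \<forall>v\<in>carrier V. f (c \<odot>\<^bsub>V\<^esub> v) = c * f v)"

section \<open>Analytic sections, flat sections, parallel transport\<close>

definition Cstar_times :: "(complex ^ 'r::finite) set \<Rightarrow> (complex ^ 'r option) set" where
  "Cstar_times S = {pt z q |z q. z \<noteq> 0 \<and> q \<in> S}"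

text \<open>Holomorphic sections of the restriction to \<open>\<complex>\<^sub>z \<times> {q}\<close>, defined on all of \<open>\<complex>\<^sub>z\<close>.\<close>

definition slice_section ::
  "'r::finite oper set \<Rightarrow> complex ^ 'r \<Rightarrow> (complex \<Rightarrow> 'r oper set) \<Rightarrow> bool" where
  "slice_section I q s \<longleftrightarrow>
     (\<forall>z0. \<exists>D k f A. open D \<and> z0 \<in> D \<and>
        (\<forall>j<k. f j holomorphic_on D \<and> A j \<in> Rop) \<and>
        (\<forall>z\<in>D. s z = lincomb (fibre I (pt z q)) k (\<lambda>j. f j z) (\<lambda>j. cls I (pt z q) (A j))))"

text \<open>Holomorphic sections over \<open>W\<close> of the quotient by \<open>z\<close>, i.e. of the restriction to \<open>{0} \<times> W\<close>.\<close>

definition zero_section ::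
  "'r::finite oper set \<Rightarrow> (complex ^ 'r) set \<Rightarrow> (complex ^ 'r \<Rightarrow> 'r oper set) \<Rightarrow> bool" where
  "zero_section I W s \<longleftrightarrow> open W \<and>
     (\<forall>q0\<in>W. \<exists>D k f A. open D \<and> q0 \<in> D \<and> D \<subseteq> W \<and>
        (\<forall>j<k. mv_holomorphic_on (f j) D \<and> A j \<in> Rop) \<and>
        (\<forall>q\<in>D. s q = lincomb (fibre I (pt 0 q)) k (\<lambda>j. f j q) (\<lambda>j. cls I (pt 0 q) (A j))))"

text \<open>A section is locally \<open>\<Sum>j. f\<^sub>j [A\<^sub>j]\<close> with \<open>f\<^sub>j\<close> holomorphic; it is flat iff
  \<open>zq\<^sub>b\<partial>\<^sub>b\<close> and \<open>z\<^sup>2\<partial>\<^sub>z\<close>, acting by the Leibniz rule, annihilate it.\<close>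

definition flat_section ::
  "'r::finite oper set \<Rightarrow> (complex ^ 'r) set \<Rightarrow> (complex ^ 'r option) set \<Rightarrow>
   (complex ^ 'r option \<Rightarrow> 'r oper set) \<Rightarrow> bool" where
  "flat_section I S W s \<longleftrightarrow> open W \<and> W \<subseteq> Cstar_times S \<and>
     (\<forall>x\<in>W. \<exists>D k f A. open D \<and> x \<in> D \<and> D \<subseteq> W \<and>
        (\<forall>j<k. mv_holomorphic_on (f j) D \<and> A j \<in> Rop) \<and>
        (\<forall>y\<in>D. s y = lincomb (fibre I y) k (\<lambda>j. f j y) (\<lambda>j. cls I y (A j)) \<and>
           (\<forall>b. lincomb (fibre I y) k (\<lambda>j. y $ None * y $ Some b * partial_at (Some b) (f j) y)
                    (\<lambda>j. cls I y (A j))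
                  \<oplus>\<^bsub>fibre I y\<^esub>
                lincomb (fibre I y) k (\<lambda>j. f j y) (\<lambda>j. cls I y (euler b \<circ> A j))
                  = \<zero>\<^bsub>fibre I y\<^esub>) \<and>
           lincomb (fibre I y) k (\<lambda>j. (y $ None)\<^sup>2 * partial_at None (f j) y)
               (\<lambda>j. cls I y (A j))
             \<oplus>\<^bsub>fibre I y\<^esub>
           lincomb (fibre I y) k (\<lambda>j. f j y) (\<lambda>j. cls I y (z2dz \<circ> A j))
             = \<zero>\<^bsub>fibre I y\<^esub>))"

text \<open>Parallel transport in the direction of \<open>z\<close> along the segment from \<open>z\<close> to \<open>w\<close>.\<close>

definition transport ::
  "'r::finite oper set \<Rightarrow> (complex ^ 'r) set \<Rightarrow> complex ^ 'r \<Rightarrow> complex \<Rightarrow> complex \<Rightarrow>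
   'r oper set \<Rightarrow> 'r oper set" where
  "transport I S q z w v = (THE v'. \<exists>W s. flat_section I S W s \<and>
     (\<lambda>t. pt t q) ` closed_segment z w \<subseteq> W \<and> s (pt z q) = v \<and> s (pt w q) = v')"

section \<open>Variations of pure polarized ncHodge structures\<close>

text \<open>In the following \<open>I\<close> is the left ideal, \<open>S\<close> the base, \<open>w\<close> the weight, \<open>L x\<close> the fibre at
  \<open>x \<in> \<complex>\<^sup>* \<times> S\<close> of the real local system, as a subset of the fibre of the bundle, and
  \<open>P x\<close> the complexified pairing between the fibres at \<open>x\<close> and \<open>\<iota> x\<close>.\<close>

definition iota :: "complex ^ 'r::finite option \<Rightarrow> complex ^ 'r option" where
  "iota x = (\<chi> i. case i of None \<Rightarrow> - (x $ None) | Some b \<Rightarrow> x $ Some b)"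

definition real_local_system ::
  "'r::finite oper set \<Rightarrow> (complex ^ 'r) set \<Rightarrow> (complex ^ 'r option \<Rightarrow> 'r oper set set) \<Rightarrow> bool" where
  "real_local_system I S L \<longleftrightarrow>
     (\<forall>x\<in>Cstar_times S. \<exists>W k s. x \<in> W \<and> (\<forall>j<k. flat_section I S W (s j)) \<and>
        open W \<and> W \<subseteq> Cstar_times S \<and>
        (\<forall>y\<in>W. is_basis (fibre I y) k (\<lambda>j. s j y) \<and>
           L y = {lincomb (fibre I y) k (\<lambda>j. complex_of_real (c j)) (\<lambda>j. s j y) |c. True}))"

definition flat_pairing ::
  "'r::finite oper set \<Rightarrow> (complex ^ 'r) set \<Rightarrow> nat \<Rightarrow> (complex ^ 'r option \<Rightarrow> 'r oper set set) \<Rightarrow>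
   (complex ^ 'r option \<Rightarrow> 'r oper set \<Rightarrow> 'r oper set \<Rightarrow> complex) \<Rightarrow> bool" where
  "flat_pairing I S w L P \<longleftrightarrow>
     (\<forall>x\<in>Cstar_times S.
        (\<forall>u\<in>carrier (fibre I x). linear_form (fibre I (iota x)) (P x u)) \<and>
        (\<forall>v\<in>carrier (fibre I (iota x)). linear_form (fibre I x) (\<lambda>u. P x u v)) \<and>
        (\<forall>u\<in>L x. \<forall>v\<in>L (iota x). \<exists>t::real. P x u v = \<i> ^ w * complex_of_real t) \<and>
        (\<forall>u\<in>carrier (fibre I x). \<forall>v\<in>carrier (fibre I (iota x)).
           P x u v = (-1) ^ w * P (iota x) v u)) \<and>
     (\<forall>W s t. connected W \<and> flat_section I S W s \<and> flat_section I S (iota ` W) t \<longrightarrow>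
        (\<lambda>y. P y (s y) (t (iota y))) constant_on W)"

text \<open>The pairing takes values in \<open>z\<^sup>w \<O>\<close> on sections over \<open>\<complex>\<^sub>z \<times> S\<close> and is non-degenerate
  there, also at \<open>z = 0\<close>; \<open>F A B\<close> is the function \<open>z\<^sup>-\<^sup>w P([A], \<iota>\<^sup>*[B])\<close>.\<close>

definition nondegenerate_extension ::
  "'r::finite oper set \<Rightarrow> (complex ^ 'r) set \<Rightarrow> nat \<Rightarrow>
   (complex ^ 'r option \<Rightarrow> 'r oper set \<Rightarrow> 'r oper set \<Rightarrow> complex) \<Rightarrow> bool" where
  "nondegenerate_extension I S w P \<longleftrightarrow>
     (\<exists>F. \<forall>A\<in>Rop.
        (\<forall>B\<in>Rop. mv_holomorphic_on (F A B) {pt z q |z q. q \<in> S} \<and>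
           (\<forall>x\<in>Cstar_times S.
              P x (cls I x A) (cls I (iota x) B) = (x $ None) ^ w * F A B x)) \<and>
        (\<forall>z. \<forall>q\<in>S.
           ((\<forall>B\<in>Rop. F A B (pt z q) = 0) \<longrightarrow> A \<in> fibre_null I (pt z q)) \<and>
           ((\<forall>B\<in>Rop. F B A (pt z q) = 0) \<longrightarrow> A \<in> fibre_null I (pt (- z) q))))"

definition conjugation ::
  "'r::finite oper set \<Rightarrow> (complex ^ 'r option \<Rightarrow> 'r oper set set) \<Rightarrow> complex ^ 'r option \<Rightarrow>
   'r oper set \<Rightarrow> 'r oper set" where
  "conjugation I L x v = (let V = fibre I x in
     THE v'. \<exists>a\<in>L x. \<exists>b\<in>L x. v = a \<oplus>\<^bsub>V\<^esub> \<i> \<odot>\<^bsub>V\<^esub> b \<and> v' = a \<oplus>\<^bsub>V\<^esub> (- \<i>) \<odot>\<^bsub>V\<^esub> b)"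

definition glue ::
  "'r::finite oper set \<Rightarrow> (complex ^ 'r) set \<Rightarrow> nat \<Rightarrow> (complex ^ 'r option \<Rightarrow> 'r oper set set) \<Rightarrow>
   complex ^ 'r \<Rightarrow> complex \<Rightarrow> 'r oper set \<Rightarrow> 'r oper set" where
  "glue I S w L q z v =
     transport I S q z (1 / cnj z)
       (conjugation I L (pt z q) ((1 / z ^ w) \<odot>\<^bsub>fibre I (pt z q)\<^esub> v))"

text \<open>A section over \<open>\<P>\<^sup>1 \<times> {q}\<close> of the glued bundle is a pair \<open>(s, u)\<close> of sections over
  \<open>\<complex>\<^sub>z \<times> {q}\<close>, the second one viewed as a section of the conjugate bundle near infinity via
  \<open>z \<mapsto> 1 / cnj z\<close>; \<open>u\<close> is determined by \<open>s\<close>, and its value at \<open>0\<close> is the value of the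
  glued section at infinity.\<close>

definition glues_to ::
  "'r::finite oper set \<Rightarrow> (complex ^ 'r) set \<Rightarrow> nat \<Rightarrow> (complex ^ 'r option \<Rightarrow> 'r oper set set) \<Rightarrow>
   complex ^ 'r \<Rightarrow> (complex \<Rightarrow> 'r oper set) \<Rightarrow> (complex \<Rightarrow> 'r oper set) \<Rightarrow> bool" where
  "glues_to I S w L q s u \<longleftrightarrow> slice_section I q u \<and>
     (\<forall>z. z \<noteq> 0 \<longrightarrow> u (1 / cnj z) = glue I S w L q z (s z))"

definition global_sections ::
  "'r::finite oper set \<Rightarrow> (complex ^ 'r) set \<Rightarrow> nat \<Rightarrow> (complex ^ 'r option \<Rightarrow> 'r oper set set) \<Rightarrow>
   complex ^ 'r \<Rightarrow> (complex, complex \<Rightarrow> 'r oper set) module" where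
  "global_sections I S w L q =
     \<lparr> carrier = {s. slice_section I q s \<and> (\<exists>u. glues_to I S w L q s u)},
       mult = undefined, one = undefined,
       zero = (\<lambda>z. \<zero>\<^bsub>fibre I (pt z q)\<^esub>),
       add = (\<lambda>s t z. s z \<oplus>\<^bsub>fibre I (pt z q)\<^esub> t z),
       smult = (\<lambda>c s z. c \<odot>\<^bsub>fibre I (pt z q)\<^esub> s z) \<rparr>"

definition section_conjugate ::
  "'r::finite oper set \<Rightarrow> (complex ^ 'r) set \<Rightarrow> nat \<Rightarrow> (complex ^ 'r option \<Rightarrow> 'r oper set set) \<Rightarrow>
   complex ^ 'r \<Rightarrow> (complex \<Rightarrow> 'r oper set) \<Rightarrow> (complex \<Rightarrow> 'r oper set)" where
  "section_conjugate I S w L q s = (THE u. glues_to I S w L q s u)"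

text \<open>\<open>h(s, t) = z\<^sup>-\<^sup>w P(s, c(t))\<close>, which is constant in \<open>z\<close> for global sections.\<close>

definition twistor_metric ::
  "'r::finite oper set \<Rightarrow> (complex ^ 'r) set \<Rightarrow> nat \<Rightarrow> (complex ^ 'r option \<Rightarrow> 'r oper set set) \<Rightarrow>
   (complex ^ 'r option \<Rightarrow> 'r oper set \<Rightarrow> 'r oper set \<Rightarrow> complex) \<Rightarrow>
   complex ^ 'r \<Rightarrow> (complex \<Rightarrow> 'r oper set) \<Rightarrow> (complex \<Rightarrow> 'r oper set) \<Rightarrow> complex" where
  "twistor_metric I S w L P q s t =
     (THE c. \<forall>z. z \<noteq> 0 \<longrightarrow>
        P (pt z q) (s z) (section_conjugate I S w L q t (- z)) = z ^ w * c)"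

definition pure_polarized_ncHodge_variation ::
  "'r::finite oper set \<Rightarrow> (complex ^ 'r) set \<Rightarrow> nat \<Rightarrow> (complex ^ 'r option \<Rightarrow> 'r oper set set) \<Rightarrow>
   (complex ^ 'r option \<Rightarrow> 'r oper set \<Rightarrow> 'r oper set \<Rightarrow> complex) \<Rightarrow> bool" where
  "pure_polarized_ncHodge_variation I S w L P \<longleftrightarrow>
     locally_free_on I S \<and> real_local_system I S L \<and>
     flat_pairing I S w L P \<and> nondegenerate_extension I S w P \<and>
     (\<forall>q\<in>S. let E = global_sections I S w L q in
        (\<forall>z. bij_betw (\<lambda>s. s z) (carrier E) (carrier (fibre I (pt z q)))) \<and>
        bij_betw (\<lambda>s. section_conjugate I S w L q s 0) (carrier E) (carrier (fibre I (pt 0 q))) \<and>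
        (\<forall>s\<in>carrier E. s \<noteq> \<zero>\<^bsub>E\<^esub> \<longrightarrow>
           (\<exists>c::real. c > 0 \<and> twistor_metric I S w L P q s s = complex_of_real c)))"

section \<open>Harmonic bundles and tameness\<close>

text \<open>The holomorphic structure is given by the predicate recognising holomorphic sections over open
  sets, the Higgs field \<open>\<theta> = \<Sum>b. \<theta>\<^sub>b dq\<^sub>b / q\<^sub>b\<close> by its components.\<close>

record ('r, 'v) harmonic_bundle =
  base :: "(complex ^ 'r) set"
  space_at :: "complex ^ 'r \<Rightarrow> (complex, 'v) module"
  holomorphic_section :: "(complex ^ 'r) set \<Rightarrow> (complex ^ 'r \<Rightarrow> 'v) \<Rightarrow> bool"
  higgs :: "'r \<Rightarrow> complex ^ 'r \<Rightarrow> 'v \<Rightarrow> 'v"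
  metric :: "complex ^ 'r \<Rightarrow> 'v \<Rightarrow> 'v \<Rightarrow> complex"

definition associated_harmonic_bundle ::
  "'r::finite oper set \<Rightarrow> (complex ^ 'r) set \<Rightarrow> nat \<Rightarrow> (complex ^ 'r option \<Rightarrow> 'r oper set set) \<Rightarrow>
   (complex ^ 'r option \<Rightarrow> 'r oper set \<Rightarrow> 'r oper set \<Rightarrow> complex) \<Rightarrow>
   ('r, complex \<Rightarrow> 'r oper set) harmonic_bundle" where
  "associated_harmonic_bundle I S w L P =
     \<lparr> base = S,
       space_at = global_sections I S w L,
       holomorphic_section = (\<lambda>W \<sigma>. W \<subseteq> S \<and>
          (\<forall>q\<in>W. \<sigma> q \<in> carrier (global_sections I S w L q)) \<and> zero_section I W (\<lambda>q. \<sigma> q 0)),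
       higgs = (\<lambda>b q s. THE t. t \<in> carrier (global_sections I S w L q) \<and>
          t 0 = fibre_action I (pt 0 q) (euler b) (s 0)),
       metric = twistor_metric I S w L P \<rparr>"

definition restrict_bundle ::
  "('r::finite, 'v) harmonic_bundle \<Rightarrow> (complex ^ 'r) set \<Rightarrow> ('r, 'v) harmonic_bundle" where
  "restrict_bundle H W = H\<lparr> base := base H \<inter> W,
     holomorphic_section := (\<lambda>W' \<sigma>. W' \<subseteq> W \<and> holomorphic_section H W' \<sigma>) \<rparr>"

definition tame_along ::
  "('r::finite, 'v) harmonic_bundle \<Rightarrow> (complex ^ 'r) set \<Rightarrow> (complex ^ 'r) set \<Rightarrow> bool" where
  "tame_along H U Z \<longleftrightarrow> base H = U - Z \<and>
     (\<forall>b k. \<exists>F. mv_holomorphic_on F U \<and>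
        (\<forall>q\<in>U - Z. F q = coeff (endo_char_poly (space_at H q) (higgs H b q)) k))"

end

theory Submission
  imports Defs "HOL-Complex_Analysis.Conformal_Mappings"
begin

text \<open>
  Modulo \<open>z\<close> the operators \<open>zq\<^sub>b\<partial>\<^sub>b\<close> act linearly over functions on the module, so coherence over
  \<open>U\<close> bounds the eigenvalues of the Higgs field locally near every point of \<open>U\<close> by the column sums of
  a matrix of regular functions. Off the boundary divisor the
  module is locally free, so the coefficients of the characteristic polynomials are holomorphic there.
  Being locally bounded, they extend by Riemann's theorem, applied to one coordinate hyperplane at
  a time.

  The fibres of the harmonic bundle are spaces of global sections of the glued bundle, identified with
  the fibres at \<open>z = 0\<close> by evaluation. That these are vector spaces rests on parallel transport being
  well defined and linear: flat sections are determined by their values because the pairing is flat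
  and non-degenerate, and they exist along segments because local flat frames can be continued.
\<close>

section \<open>Polynomials and operators\<close>

text \<open>The commutator of \<open>zq\<^sub>b\<partial>\<^sub>b\<close> with a function f is
  \<open>zq\<^sub>b\<partial>\<^sub>bf\<close>; it carries a factor z, which is why the Higgs field
  acts on single fibres at z = 0. The obstacle is the divisor. Coherence gives generators that span
  the nearby fibres but may satisfy relations there, so the matrix of the action on them is larger
  than the Higgs field and has another characteristic polynomial. What survives is that every
  eigenvalue of the Higgs field is an eigenvalue of this matrix. Hence bounds, rather than the
  coefficients themselves, are carried over from the generators. The second obstacle is formal:
  \<open>endo_char_poly\<close>, \<open>transport\<close>, \<open>conjugation\<close> and
  \<open>higgs\<close> are definite descriptions, and each must be shown to have exactly one
  candidate before it can be computed. For \<open>transport\<close>, uniqueness comes from the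
  numbers \<open>P y (s y) (t (iota y))\<close>, which are locally constant for flat s and t and
  determine s when t runs through a frame.\<close>

lemma sum_fun_apply: "(\<Sum>j\<in>J. F j) x = (\<Sum>j\<in>J. F j x)"
  by (induction J rule: infinite_finite_induct) auto

text \<open>An update at a fresh key is the addition of a monomial, so an identity that is additive
  in the polynomial only has to be checked on monomials.\<close>

lemma cpoly_induct [case_names zero add]:
  fixes f :: "'k cpoly"
  assumes "Q 0" and "\<And>m c g. Q g \<Longrightarrow> Q (Poly_Mapping.single m c + g)"
  shows "Q f"
proof (induction f rule: update_induct)
  case (update g m c)
  have "Poly_Mapping.update m c g = Poly_Mapping.single m c + g"
    using update(1) by (intro poly_mapping_eqI)
      (auto simp: lookup_update lookup_add lookup_single when_def in_keys_iff)
  with update(3) show ?case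
    by (simp add: assms(2))
qed (rule assms(1))

text \<open>Zero coefficients contribute nothing, so the sums over the different supports of f, g
  and f + g can all be taken over one common finite set.\<close>

lemma peval_eq_sum_superset:
  assumes "finite M" "Poly_Mapping.keys f \<subseteq> M"
  shows "peval f x = (\<Sum>m\<in>M. Poly_Mapping.lookup f m * (\<Prod>i\<in>UNIV. (x $ i) ^ Poly_Mapping.lookup m i))"
  unfolding peval_def
  by (rule sum.mono_neutral_left) (use assms in \<open>auto simp: in_keys_iff\<close>)

lemma peval_add: "peval (f + g) x = peval f x + peval g x"
proof -
  let ?M = "Poly_Mapping.keys f \<union> Poly_Mapping.keys g"
  show ?thesis
    using keys_add[of f g]
    by (simp add: peval_eq_sum_superset[of ?M] lookup_add sum.distrib distrib_right)
qed

lemma peval_zero [simp]: "peval 0 x = 0"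
  by (simp add: peval_def)

lemma peval_single:
  "peval (Poly_Mapping.single m c) x = c * (\<Prod>i\<in>UNIV. (x $ i) ^ Poly_Mapping.lookup m i)"
  by (simp add: peval_def)

lemma peval_mult_single: "peval (Poly_Mapping.single m c * g) x = peval (Poly_Mapping.single m c) x * peval g x"
proof (induction g rule: cpoly_induct)
  case (add n d g)
  then show ?case
    by (simp add: distrib_left peval_add mult_single peval_single lookup_add power_add prod.distrib)
qed simp

lemma peval_mult: "peval (f * g) x = peval f x * peval g x"
  by (induction f rule: cpoly_induct) (simp_all add: distrib_right peval_add peval_mult_single)

lemma peval_const [simp]: "peval (pconst c) x = c"
  by (simp add: pconst_def peval_single)

lemma peval_var [simp]: "peval (pvar i) x = x $ i"
proof -
  have "(\<Prod>j\<in>UNIV. (x $ j) ^ Poly_Mapping.lookup (Poly_Mapping.single i 1) j) =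
        (\<Prod>j\<in>UNIV. if j = i then x $ j else 1)"
    by (intro prod.cong) (auto simp: lookup_single when_def)
  then show ?thesis
    by (simp add: pvar_def peval_single)
qed

lemma pconst_one: "pconst 1 = 1"
  by (simp add: pconst_def)

lemma peval_one [simp]: "peval 1 x = 1"
  using peval_const[of 1 x] by (simp add: pconst_one)

lemma peval_power: "peval (f ^ N) x = peval f x ^ N"
  by (induction N) (auto simp: peval_mult)

lemma peval_minus: "peval (- f) x = - peval f x"
  using peval_add[of f "- f" x] by (simp add: eq_neg_iff_add_eq_0 add.commute)

lemma peval_diff: "peval (f - g) x = peval f x - peval g x"
  using peval_add[of f "- g" x] by (simp add: peval_minus)

lemma pconst_add: "pconst (c + d) = pconst c + pconst d"
  by (simp add: pconst_def single_add)

lemma pconst_mult: "pconst (c * d) = pconst c * pconst d"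
  by (simp add: pconst_def mult_single)

section \<open>Formal partial derivatives and the Leibniz rule\<close>

lemma ppartial_eq_sum_superset:
  assumes "finite M" "Poly_Mapping.keys f \<subseteq> M"
  shows "ppartial i f = (\<Sum>m\<in>M. Poly_Mapping.single (m - Poly_Mapping.single i 1)
       (of_nat (Poly_Mapping.lookup m i) * Poly_Mapping.lookup f m))"
  unfolding ppartial_def
  by (rule sum.mono_neutral_left) (use assms in \<open>auto simp: in_keys_iff\<close>)

lemma ppartial_add: "ppartial i (f + g) = ppartial i f + ppartial i g"
proof -
  let ?M = "Poly_Mapping.keys f \<union> Poly_Mapping.keys g"
  show ?thesis
    using keys_add[of f g]
    by (simp add: ppartial_eq_sum_superset[of ?M] lookup_add single_add sum.distrib distrib_left)
qed

lemma ppartial_zero [simp]: "ppartial i 0 = 0"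
  by (simp add: ppartial_def)

lemma ppartial_single:
  "ppartial i (Poly_Mapping.single m c) =
     Poly_Mapping.single (m - Poly_Mapping.single i 1) (of_nat (Poly_Mapping.lookup m i) * c)"
  by (simp add: ppartial_def)

text \<open>Subtraction of exponents is truncated at 0, so it commutes with adding n only if the
  variable i occurs in m. In the excluded case the coefficient in the derivative is 0, so the
  exponent does not matter in the Leibniz rule below.\<close>

lemma monomial_diff_var:
  fixes m n :: "'k \<Rightarrow>\<^sub>0 nat"
  assumes "Poly_Mapping.lookup m i \<noteq> 0"
  shows "m + n - Poly_Mapping.single i 1 = (m - Poly_Mapping.single i 1) + n"
  by (rule poly_mapping_eqI) (use assms in \<open>auto simp: lookup_add lookup_minus lookup_single when_def\<close>)

lemma ppartial_mult_monomials:
  "ppartial i (Poly_Mapping.single m c * Poly_Mapping.single n d) =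
     Poly_Mapping.single m c * ppartial i (Poly_Mapping.single n d) +
     ppartial i (Poly_Mapping.single m c) * Poly_Mapping.single n d"
proof -
  let ?e = "Poly_Mapping.single i (1::nat)"
  have m: "Poly_Mapping.single (m + n - ?e) (of_nat (Poly_Mapping.lookup m i) * x)
      = Poly_Mapping.single ((m - ?e) + n) (of_nat (Poly_Mapping.lookup m i) * x)" for x :: complex
    using monomial_diff_var[of m i n] by (cases "Poly_Mapping.lookup m i = 0") auto
  have n: "Poly_Mapping.single (m + n - ?e) (of_nat (Poly_Mapping.lookup n i) * x)
      = Poly_Mapping.single (m + (n - ?e)) (of_nat (Poly_Mapping.lookup n i) * x)" for x :: complex
    using monomial_diff_var[of n i m] by (cases "Poly_Mapping.lookup n i = 0") (auto simp: add.commute)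
  have "Poly_Mapping.single (m + n - ?e) (of_nat (Poly_Mapping.lookup (m + n) i) * (c * d)) =
     Poly_Mapping.single (m + n - ?e) (of_nat (Poly_Mapping.lookup n i) * (c * d)) +
     Poly_Mapping.single (m + n - ?e) (of_nat (Poly_Mapping.lookup m i) * (c * d))"
    by (simp add: lookup_add algebra_simps flip: single_add)
  also have "\<dots> = Poly_Mapping.single (m + (n - ?e)) (of_nat (Poly_Mapping.lookup n i) * (c * d)) +
     Poly_Mapping.single ((m - ?e) + n) (of_nat (Poly_Mapping.lookup m i) * (c * d))"
    by (simp only: m n)
  finally show ?thesis
    by (simp only: mult_single ppartial_single) (simp add: ac_simps)
qed

lemma ppartial_mult: "ppartial i (f * g) = f * ppartial i g + ppartial i f * g"
proof (induction f rule: cpoly_induct)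
  case (add m c f)
  have "ppartial i (Poly_Mapping.single m c * g) =
    Poly_Mapping.single m c * ppartial i g + ppartial i (Poly_Mapping.single m c) * g"
  proof (induction g rule: cpoly_induct)
    case (add n d g)
    then show ?case
      by (simp add: distrib_left distrib_right ppartial_add ppartial_mult_monomials algebra_simps)
  qed simp
  with add show ?case
    by (simp add: distrib_left distrib_right ppartial_add algebra_simps)
qed simp

section \<open>Operators as a left module over the polynomials\<close>

abbreviation smul :: "'r option cpoly \<Rightarrow> 'r oper \<Rightarrow> 'r oper" where
  "smul f A \<equiv> mulop f \<circ> A"

lemma smul_smul: "smul f (smul g A) = smul (f * g) A"
  by (rule ext) (simp add: mulop_def ac_simps)

lemma smul_add_right: "smul f (A + B) = smul f A + smul f B"
  by (rule ext) (simp add: mulop_def distrib_left)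

lemma smul_diff_right: "smul f (A - B) = smul f A - smul f B"
  by (rule ext) (simp add: mulop_def right_diff_distrib)

lemma smul_add_left: "smul (f + g) A = smul f A + smul g A"
  by (rule ext) (simp add: mulop_def distrib_right)

lemma smul_diff_left: "smul (f - g) A = smul f A - smul g A"
  by (rule ext) (simp add: mulop_def left_diff_distrib)

lemma smul_one [simp]: "smul 1 A = A"
  by (rule ext) (simp add: mulop_def)

lemma smul_zero_left [simp]: "smul 0 A = 0"
  by (rule ext) (simp add: mulop_def)

lemma smul_minus_one: "smul (- 1) A = - A"
  by (rule ext) (simp add: mulop_def)

lemma smul_sum_right: "smul f (\<Sum>j\<in>J. F j) = (\<Sum>j\<in>J. smul f (F j))"
  by (rule ext) (simp add: mulop_def sum_fun_apply sum_distrib_left)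

lemma euler_add: "euler b \<circ> (A + B) = (euler b \<circ> A) + (euler b \<circ> B)"
  by (rule ext) (simp add: euler_def ppartial_add distrib_left)

text \<open>Leibniz rule. The correction term has the factor \<open>pvar None\<close>, that is z,
  and therefore disappears in the fibres at z = 0.\<close>

lemma euler_smul:
  "euler b \<circ> smul f A = smul f (euler b \<circ> A)
     + smul (pvar None * pvar (Some b) * ppartial (Some b) f) A"
  by (rule ext) (simp add: euler_def mulop_def ppartial_mult algebra_simps)

lemma Rop_smul: "A \<in> Rop \<Longrightarrow> smul f A \<in> Rop"
  by (intro Rop.intros)

lemma Rop_zero: "0 \<in> Rop"
  using Rop_smul[OF Rop.intros(2), of 0] by simp

lemma Rop_minus: "A \<in> Rop \<Longrightarrow> - A \<in> Rop"
  using Rop_smul[of A "- 1"] by (simp add: smul_minus_one)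

lemma Rop_diff: "A \<in> Rop \<Longrightarrow> B \<in> Rop \<Longrightarrow> A - B \<in> Rop"
  using Rop.intros(4)[OF _ Rop_minus, of A B] by simp

lemma Rop_sum: "(\<And>j. j \<in> J \<Longrightarrow> F j \<in> Rop) \<Longrightarrow> (\<Sum>j\<in>J. F j) \<in> Rop"
  by (induction J rule: infinite_finite_induct) (auto intro: Rop_zero Rop.intros)

section \<open>Fibres of the quotient by a left ideal\<close>

locale op_ideal =
  fixes I :: "'r::finite oper set"
  assumes zero_mem: "0 \<in> I"
    and add_mem: "A \<in> I \<Longrightarrow> B \<in> I \<Longrightarrow> A + B \<in> I"
    and comp_mem: "A \<in> Rop \<Longrightarrow> B \<in> I \<Longrightarrow> A \<circ> B \<in> I"
begin

lemma smul_mem: "B \<in> I \<Longrightarrow> smul f B \<in> I"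
  by (intro comp_mem Rop.intros)

lemma null_zero: "0 \<in> fibre_null I x"
  by (intro fibre_null.intros zero_mem)

text \<open>\<open>fibre_null\<close> is generated by sums alone. Functions commute with each other,
  so both kinds of generators are stable under left multiplication by functions; negatives are the
  special case of the factor -1.\<close>

lemma null_smul: "A \<in> fibre_null I x \<Longrightarrow> smul f A \<in> fibre_null I x"
proof (induction rule: fibre_null.induct)
  case (1 A)
  then show ?case by (intro fibre_null.intros smul_mem)
next
  case (2 g A)
  then show ?case
    unfolding smul_smul by (intro fibre_null.intros) (simp_all add: peval_mult)
next
  case (3 A B)
  then show ?case
    using fibre_null.intros(3) by (simp only: smul_add_right)
qed

lemma null_minus: "A \<in> fibre_null I x \<Longrightarrow> - A \<in> fibre_null I x"
  using null_smul[of A x "- 1"] by (simp add: smul_minus_one)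

lemma null_diff: "A \<in> fibre_null I x \<Longrightarrow> B \<in> fibre_null I x \<Longrightarrow> A - B \<in> fibre_null I x"
  using fibre_null.intros(3)[OF _ null_minus, of A x B] by simp

lemma null_sum: "(\<And>j. j \<in> J \<Longrightarrow> F j \<in> fibre_null I x) \<Longrightarrow> (\<Sum>j\<in>J. F j) \<in> fibre_null I x"
  by (induction J rule: infinite_finite_induct) (auto intro: null_zero fibre_null.intros)

text \<open>Modulo \<open>z\<close> the operators \<open>zq\<^sub>b\<partial>\<^sub>b\<close> commute with multiplication by functions.\<close>

lemma null_euler:
  assumes "A \<in> fibre_null I x" and "x $ None = 0"
  shows "euler b \<circ> A \<in> fibre_null I x"
  using assms(1)
proof (induction rule: fibre_null.induct)
  case (1 A)
  then show ?case by (intro fibre_null.intros comp_mem Rop.intros)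
next
  case (2 g A)
  then show ?case
    \<comment> \<open>The derivative of g need not vanish at x, but in the commutator it is
      multiplied by z, which does.\<close>
    unfolding euler_smul
    by (intro fibre_null.intros Rop.intros) (simp_all add: peval_mult assms(2))
next
  case (3 A B)
  then show ?case
    using fibre_null.intros(3) by (simp only: euler_add)
qed

text \<open>The function f minus its value at x vanishes at x. Thus f acts on the fibre at x as the
  scalar \<open>peval f x\<close>.\<close>

lemma smul_eval_null: "A \<in> Rop \<Longrightarrow> smul f A - smul (pconst (peval f x)) A \<in> fibre_null I x"
  using fibre_null.intros(2)[of "f - pconst (peval f x)" x A I]
  by (simp only: smul_diff_left peval_diff peval_const) simp

lemma cls_eq_iff:
  assumes "A \<in> Rop" "B \<in> Rop"
  shows "cls I x A = cls I x B \<longleftrightarrow> A - B \<in> fibre_null I x"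
proof
  assume "cls I x A = cls I x B"
  moreover have "A \<in> cls I x A"
    using assms null_zero by (simp add: cls_def)
  ultimately show "A - B \<in> fibre_null I x"
    by (simp add: cls_def)
next
  assume *: "A - B \<in> fibre_null I x"
  have "C - B \<in> fibre_null I x" if "C - A \<in> fibre_null I x" for C
    using fibre_null.intros(3)[OF that *] by simp
  moreover have "C - A \<in> fibre_null I x" if "C - B \<in> fibre_null I x" for C
    using null_diff[OF that *] by simp
  ultimately show "cls I x A = cls I x B"
    by (auto simp: cls_def)
qed

lemma cls_self: "A \<in> Rop \<Longrightarrow> A \<in> cls I x A"
  using null_zero by (simp add: cls_def)

lemma carrier_fibre: "carrier (fibre I x) = cls I x ` Rop"
  by (simp add: fibre_def)

lemma cls_in_carrier: "A \<in> Rop \<Longrightarrow> cls I x A \<in> carrier (fibre I x)"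
  by (simp add: fibre_def)

lemma zero_fibre: "\<zero>\<^bsub>fibre I x\<^esub> = cls I x 0"
  by (simp add: fibre_def)

text \<open>The operations of \<open>fibre\<close> are unions over all representatives. Such a union
  is a single class because every choice of representatives gives the same class and there is at
  least one choice.\<close>

lemma add_cls:
  assumes "A \<in> Rop" "B \<in> Rop"
  shows "cls I x A \<oplus>\<^bsub>fibre I x\<^esub> cls I x B = cls I x (A + B)"
proof -
  have "cls I x (A' + B') = cls I x (A + B)" if "A' \<in> cls I x A" "B' \<in> cls I x B" for A' B'
  proof -
    have "A' - A \<in> fibre_null I x" "B' - B \<in> fibre_null I x" "A' \<in> Rop" "B' \<in> Rop"
      using that by (auto simp: cls_def)
    then have "(A' - A) + (B' - B) \<in> fibre_null I x" and "A' + B' \<in> Rop" "A + B \<in> Rop"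
      using assms by (blast intro: fibre_null.intros(3) Rop.intros(4))+
    then show ?thesis
      by (simp add: cls_eq_iff add_diff_add)
  qed
  then have "(\<Union>A'\<in>cls I x A. \<Union>B'\<in>cls I x B. cls I x (A' + B')) = cls I x (A + B)"
    using cls_self[OF assms(1), of x] cls_self[OF assms(2), of x] by blast
  then show ?thesis
    by (simp add: fibre_def)
qed

lemma smult_cls:
  assumes "A \<in> Rop"
  shows "c \<odot>\<^bsub>fibre I x\<^esub> cls I x A = cls I x (smul (pconst c) A)"
proof -
  have "cls I x (smul (pconst c) A') = cls I x (smul (pconst c) A)" if "A' \<in> cls I x A" for A'
  proof -
    have "A' - A \<in> fibre_null I x" "A' \<in> Rop"
      using that by (auto simp: cls_def)
    then show ?thesis
      using null_smul[OF \<open>A' - A \<in> fibre_null I x\<close>, of "pconst c"] assms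
      by (intro iffD2[OF cls_eq_iff]) (simp_all only: smul_diff_right Rop_smul)
  qed
  then have "(\<Union>A'\<in>cls I x A. cls I x (smul (pconst c) A')) = cls I x (smul (pconst c) A)"
    using cls_self[OF assms(1), of x] by blast
  then show ?thesis
    by (simp add: fibre_def)
qed

lemma fibre_action_cls:
  assumes "A \<in> Rop" "x $ None = 0"
  shows "fibre_action I x (euler b) (cls I x A) = cls I x (euler b \<circ> A)"
proof -
  have "cls I x (euler b \<circ> A') = cls I x (euler b \<circ> A)" if "A' \<in> cls I x A" for A'
  proof -
    have "A' - A \<in> fibre_null I x" "A' \<in> Rop"
      using that by (auto simp: cls_def)
    moreover have "(euler b \<circ> A') - (euler b \<circ> A) = euler b \<circ> (A' - A)"
      using euler_add[of b "A' - A" A] by simp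
    ultimately show ?thesis
      using null_euler[OF \<open>A' - A \<in> fibre_null I x\<close> assms(2), of b] assms(1)
      by (intro iffD2[OF cls_eq_iff] Rop.intros(5)[OF Rop.intros(2)]) (simp_all only:)
  qed
  then show ?thesis
    using cls_self[OF assms(1), of x] unfolding fibre_action_def by blast
qed

end

lemma op_ideal_left_ideal: "op_ideal (left_ideal G)"
  by unfold_locales (auto intro: left_ideal.intros)

section \<open>Linear algebra\<close>

text \<open>The chosen coefficients are stored with the row index first, so that they can be used
  directly as the entries of a matrix with columns j.\<close>

lemma choose_columns:
  assumes "\<And>j. j < k \<Longrightarrow> \<exists>c. R j c"
  shows "\<exists>q. \<forall>j<k. R j (\<lambda>i. q i j)"
proof (intro exI allI impI)
  fix j assume "j < k"
  show "R j (\<lambda>i. (SOME c. R j c) i)"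
    using someI_ex[OF assms[OF \<open>j < k\<close>]] by simp
qed

text \<open>The scalars are the type \<open>complex\<close> and not a ring with a carrier, so the
  vector space axioms are put directly on top of \<open>abelian_group\<close>, which supplies
  \<open>finsum\<close>.\<close>

locale cspace = abelian_group V for V :: "(complex, 'v) module" (structure) +
  assumes smult_closed: "v \<in> carrier V \<Longrightarrow> c \<odot> v \<in> carrier V"
    and smult_add_left: "v \<in> carrier V \<Longrightarrow> (c + d) \<odot> v = c \<odot> v \<oplus> d \<odot> v"
    and smult_add_right: "v \<in> carrier V \<Longrightarrow> w \<in> carrier V \<Longrightarrow> c \<odot> (v \<oplus> w) = c \<odot> v \<oplus> c \<odot> w"
    and smult_smult: "v \<in> carrier V \<Longrightarrow> c \<odot> (d \<odot> v) = (c * d) \<odot> v"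
    and smult_one: "v \<in> carrier V \<Longrightarrow> 1 \<odot> v = v"
begin

lemma smult_zero_left: "v \<in> carrier V \<Longrightarrow> 0 \<odot> v = \<zero>"
  using smult_add_left[of v 0 0] smult_closed[of v 0]
  by (metis add.l_cancel_one add.right_cancel add_0 l_zero zero_closed)

lemma smult_zero_right: "c \<odot> \<zero> = \<zero>"
  using smult_smult[of \<zero> c 0] smult_zero_left[OF zero_closed] by simp

lemma smult_minus_one: "v \<in> carrier V \<Longrightarrow> (- 1) \<odot> v = \<ominus> v"
proof -
  assume v: "v \<in> carrier V"
  have "(- 1) \<odot> v \<oplus> v = (- 1 + 1) \<odot> v"
    using v by (simp only: smult_add_left smult_one)
  then show ?thesis
    using v by (intro minus_equality[symmetric]) (simp_all add: smult_zero_left smult_closed)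
qed

lemma lincomb_0 [simp]: "lincomb V 0 c e = \<zero>"
  by (simp add: lincomb_def)

lemma lincomb_closed: "(\<And>j. j < k \<Longrightarrow> e j \<in> carrier V) \<Longrightarrow> lincomb V k c e \<in> carrier V"
  unfolding lincomb_def by (intro finsum_closed) (auto intro: smult_closed)

lemma lincomb_Suc:
  assumes "\<And>j. j < Suc k \<Longrightarrow> e j \<in> carrier V"
  shows "lincomb V (Suc k) c e = lincomb V k c e \<oplus> c k \<odot> e k"
proof -
  have "lincomb V (Suc k) c e = c k \<odot> e k \<oplus> lincomb V k c e"
    unfolding lincomb_def lessThan_Suc
    by (rule finsum_insert) (use assms in \<open>auto intro: smult_closed\<close>)
  also have "\<dots> = lincomb V k c e \<oplus> c k \<odot> e k"
    by (rule a_comm) (use assms in \<open>auto intro!: smult_closed lincomb_closed\<close>)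
  finally show ?thesis .
qed

lemma lincomb_cong:
  assumes "\<And>j. j < k \<Longrightarrow> c j = d j" "\<And>j. j < k \<Longrightarrow> e j = f j" "\<And>j. j < k \<Longrightarrow> f j \<in> carrier V"
  shows "lincomb V k c e = lincomb V k d f"
  unfolding lincomb_def
  by (rule finsum_cong') (use assms in \<open>auto intro: smult_closed\<close>)

lemma lincomb_add:
  assumes "\<And>j. j < k \<Longrightarrow> e j \<in> carrier V"
  shows "lincomb V k (\<lambda>j. c j + d j) e = lincomb V k c e \<oplus> lincomb V k d e"
  using assms
proof (induction k)
  case (Suc k)
  have [simp]: "lincomb V k x e \<in> carrier V" "x k \<odot> e k \<in> carrier V" for x
    using Suc.prems by (auto intro!: smult_closed lincomb_closed)
  show ?case
    using Suc by (simp add: lincomb_Suc smult_add_left a_ac)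
qed simp

lemma lincomb_smult:
  assumes "\<And>j. j < k \<Longrightarrow> e j \<in> carrier V"
  shows "lincomb V k (\<lambda>j. a * c j) e = a \<odot> lincomb V k c e"
  using assms
proof (induction k)
  case (Suc k)
  have [simp]: "lincomb V k x e \<in> carrier V" "x k \<odot> e k \<in> carrier V" for x
    using Suc.prems by (auto intro!: smult_closed lincomb_closed)
  show ?case
    using Suc by (simp add: lincomb_Suc smult_add_right smult_smult)
qed (simp add: smult_zero_right)

lemma lincomb_zero:
  assumes "\<And>j. j < k \<Longrightarrow> e j \<in> carrier V"
  shows "lincomb V k (\<lambda>j. 0) e = \<zero>"
  using lincomb_smult[of k e 0 "\<lambda>j. 0"] lincomb_closed[of k e "\<lambda>j. 0"] assms
  by (simp add: smult_zero_left)

text \<open>Serves to add two sections whose local presentations use different families of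
  operators: the families are concatenated.\<close>

lemma lincomb_append:
  assumes "\<And>j. j < k \<Longrightarrow> e j \<in> carrier V" "\<And>j. j < n \<Longrightarrow> f j \<in> carrier V"
    and "\<And>j. j < k \<Longrightarrow> g j = e j \<and> a j = c j" "\<And>j. j < n \<Longrightarrow> g (k + j) = f j \<and> a (k + j) = d j"
  shows "lincomb V (k + n) a g = lincomb V k c e \<oplus> lincomb V n d f"
  using assms(2,4)
proof (induction n)
  case 0
  have "lincomb V k a g = lincomb V k c e"
    by (rule lincomb_cong) (use assms in auto)
  then show ?case
    using lincomb_closed[of k e c, OF assms(1)] by simp
next
  case (Suc n)
  have [simp]: "lincomb V k c e \<in> carrier V" "lincomb V n d f \<in> carrier V" "d n \<odot> f n \<in> carrier V"
    using Suc.prems assms(1) by (auto intro!: smult_closed lincomb_closed)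
  have g: "g j \<in> carrier V" if "j < Suc (k + n)" for j
  proof (cases "j < k")
    case False
    then show ?thesis
      using Suc.prems(2)[of "j - k"] Suc.prems(1)[of "j - k"] that by simp
  qed (use assms(1,3) in simp)
  show ?case
    using Suc lincomb_Suc[of "k + n" g a, OF g] by (simp add: lincomb_Suc a_assoc)
qed

lemma lincomb_lincomb:
  assumes "\<And>i. i < n \<Longrightarrow> e i \<in> carrier V"
  shows "lincomb V k c (\<lambda>j. lincomb V n (\<lambda>i. m i j) e) = lincomb V n (\<lambda>i. \<Sum>j<k. m i j * c j) e"
proof (induction k)
  case 0
  then show ?case using lincomb_zero[OF assms] by simp
next
  case (Suc k)
  have "lincomb V (Suc k) c (\<lambda>j. lincomb V n (\<lambda>i. m i j) e)
    = lincomb V n (\<lambda>i. \<Sum>j<k. m i j * c j) e \<oplus> c k \<odot> lincomb V n (\<lambda>i. m i k) e"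
    using Suc assms by (subst lincomb_Suc) (auto intro: lincomb_closed)
  also have "\<dots> = lincomb V n (\<lambda>i. (\<Sum>j<k. m i j * c j) + c k * m i k) e"
    using assms by (simp add: lincomb_add lincomb_smult)
  finally show ?case by (simp add: mult.commute)
qed

lemma lincomb_unit:
  assumes "\<And>i. i < n \<Longrightarrow> e i \<in> carrier V" "j < n"
  shows "lincomb V n (\<lambda>i. if i = j then 1 else 0) e = e j"
  using assms
proof (induction n)
  case (Suc n)
  show ?case
  proof (cases "j = n")
    case True
    have "lincomb V n (\<lambda>i. if i = j then 1 else 0) e = lincomb V n (\<lambda>i. 0) e"
      using Suc.prems True by (intro lincomb_cong) auto
    then show ?thesis
      using Suc.prems True by (simp add: lincomb_Suc lincomb_zero smult_one)
  next
    case False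
    then show ?thesis
      using Suc by (simp add: lincomb_Suc smult_zero_left)
  qed
qed simp

lemma is_basis_carrier: "is_basis V k e \<Longrightarrow> j < k \<Longrightarrow> e j \<in> carrier V"
  by (simp add: is_basis_def)

lemma is_basis_span:
  assumes "is_basis V k e" "v \<in> carrier V"
  obtains c where "v = lincomb V k c e"
  using assms unfolding is_basis_def by blast

lemma is_basis_eqD:
  assumes "is_basis V k e" "lincomb V k c e = lincomb V k d e" "j < k"
  shows "c j = d j"
proof -
  \<comment> \<open>\<open>is_basis\<close> claims uniqueness only among coefficient functions that
    vanish from index k on, so c and d are truncated first.\<close>
  let ?t = "\<lambda>c j. if j < k then c j else (0::complex)"
  have e: "\<And>j. j < k \<Longrightarrow> e j \<in> carrier V"
    using assms(1) by (simp add: is_basis_def)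
  have t: "lincomb V k (?t c) e = lincomb V k c e" "lincomb V k (?t d) e = lincomb V k d e"
    using e by (auto intro!: lincomb_cong)
  from assms(1) have "\<exists>!c'. (\<forall>j\<ge>k. c' j = 0) \<and> lincomb V k c e = lincomb V k c' e"
    using lincomb_closed[of k e c, OF e] by (simp add: is_basis_def)
  then obtain c0 where c0: "\<And>y. (\<forall>j\<ge>k. y j = 0) \<and> lincomb V k c e = lincomb V k y e \<Longrightarrow> y = c0"
    by (elim ex1E) (use that in blast)
  have "?t c = c0" "?t d = c0"
    by (rule c0; use assms(2) t in simp)+
  then have "?t c = ?t d"
    by simp
  from fun_cong[OF this, of j] show ?thesis
    using assms(3) by simp
qed

lemma is_basisI:
  assumes "\<And>j. j < k \<Longrightarrow> e j \<in> carrier V"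
    and "\<And>v. v \<in> carrier V \<Longrightarrow> \<exists>c. v = lincomb V k c e"
    and "\<And>c j. lincomb V k c e = \<zero> \<Longrightarrow> j < k \<Longrightarrow> c j = 0"
  shows "is_basis V k e"
  unfolding is_basis_def
proof (intro conjI ballI allI impI)
  fix v assume v: "v \<in> carrier V"
  obtain c where c: "v = lincomb V k c e" using assms(2)[OF v] ..
  show "\<exists>!c. (\<forall>j\<ge>k. c j = 0) \<and> v = lincomb V k c e"
  proof (rule ex1I)
    show "(\<forall>j\<ge>k. (if j < k then c j else 0) = 0) \<and> v = lincomb V k (\<lambda>j. if j < k then c j else 0) e"
      using c assms(1) by (auto intro!: lincomb_cong)
    fix d assume d: "(\<forall>j\<ge>k. d j = 0) \<and> v = lincomb V k d e"
    have "lincomb V k (\<lambda>j. c j + (- 1) * d j) e = lincomb V k c e \<oplus> (- 1) \<odot> lincomb V k d e"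
      by (simp only: lincomb_add[OF assms(1)] lincomb_smult[OF assms(1)])
    also have "\<dots> = \<zero>"
      using v c d by (simp add: smult_minus_one r_neg)
    finally have "c j + (- 1) * d j = 0" if "j < k" for j
      using assms(3)[of "\<lambda>j. c j + (- 1) * d j" j] that by blast
    then show "d = (\<lambda>j. if j < k then c j else 0)"
      using d by (auto simp: fun_eq_iff not_less)
  qed
qed (use assms in auto)

end

section \<open>Linear maps, characteristic polynomials and eigenvalue bounds\<close>

definition clinear_map :: "(complex, 'v) module \<Rightarrow> (complex, 'w) module \<Rightarrow> ('v \<Rightarrow> 'w) \<Rightarrow> bool" where
  "clinear_map V W T \<longleftrightarrow> (\<forall>v\<in>carrier V. T v \<in> carrier W) \<and>
     (\<forall>v\<in>carrier V. \<forall>w\<in>carrier V. T (v \<oplus>\<^bsub>V\<^esub> w) = T v \<oplus>\<^bsub>W\<^esub> T w) \<and>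
     (\<forall>c. \<forall>v\<in>carrier V. T (c \<odot>\<^bsub>V\<^esub> v) = c \<odot>\<^bsub>W\<^esub> T v)"

lemma clinear_map_lincomb:
  assumes "cspace V" "cspace W" "clinear_map V W T" "\<And>j. j < k \<Longrightarrow> e j \<in> carrier V"
  shows "T (lincomb V k c e) = lincomb W k c (\<lambda>j. T (e j))"
  using assms(4)
proof (induction k)
  case 0
  interpret V: cspace V by fact
  interpret W: cspace W by fact
  have "T (0 \<odot>\<^bsub>V\<^esub> \<zero>\<^bsub>V\<^esub>) = 0 \<odot>\<^bsub>W\<^esub> T \<zero>\<^bsub>V\<^esub>"
    using assms(3) by (simp add: clinear_map_def)
  then show ?case
    using assms(3) V.zero_closed unfolding clinear_map_def
    by (simp add: V.smult_zero_left W.smult_zero_left)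
next
  case (Suc k)
  interpret V: cspace V by fact
  interpret W: cspace W by fact
  show ?case
    using Suc assms(3)
    by (simp add: V.lincomb_Suc W.lincomb_Suc clinear_map_def V.lincomb_closed V.smult_closed)
qed

lemma linear_form_lincomb:
  assumes "cspace V" "linear_form V \<phi>" "\<And>j. j < k \<Longrightarrow> e j \<in> carrier V"
  shows "\<phi> (lincomb V k c e) = (\<Sum>j<k. c j * \<phi> (e j))"
  using assms(3)
proof (induction k)
  case 0
  interpret V: cspace V by fact
  have "\<phi> (0 \<odot>\<^bsub>V\<^esub> \<zero>\<^bsub>V\<^esub>) = 0 * \<phi> \<zero>\<^bsub>V\<^esub>"
    using assms(2) unfolding linear_form_def by blast
  then show ?case
    by (simp add: V.smult_zero_left)
next
  case (Suc k)
  interpret V: cspace V by fact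
  show ?case
    using Suc assms(2)
    by (simp add: V.lincomb_Suc linear_form_def V.lincomb_closed V.smult_closed)
qed

lemma mult_mat_index:
  assumes "i < n" "j < l"
  shows "(Matrix.mat n m F * Matrix.mat m l G) $$ (i, j) = (\<Sum>h<m. F (i, h) * G (h, j))"
  using assms by (simp add: scalar_prod_def lessThan_atLeast0)

text \<open>This is the condition under the definite description in
  \<open>endo_char_poly\<close>.\<close>

definition matrix_wrt ::
  "(complex, 'v) module \<Rightarrow> ('v \<Rightarrow> 'v) \<Rightarrow> nat \<Rightarrow> (nat \<Rightarrow> 'v) \<Rightarrow> complex mat \<Rightarrow> bool" where
  "matrix_wrt V T k e M \<longleftrightarrow> is_basis V k e \<and> M \<in> carrier_mat k k \<and>
     (\<forall>j<k. T (e j) = lincomb V k (\<lambda>i. M $$ (i, j)) e)"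

text \<open>The transition matrices Q and R between the bases are inverse to each other and satisfy
  M Q = Q M', so M and M' are similar. The sizes k and k' may differ a priori, and similarity only
  makes sense once they are known to agree.\<close>

lemma matrix_wrt_char_poly_unique:
  assumes V: "cspace V" and T: "clinear_map V V T"
    and M: "matrix_wrt V T k e M" and M': "matrix_wrt V T k' e' M'"
  shows "char_poly M = char_poly M'"
proof -
  interpret cspace V by fact
  have b: "is_basis V k e" and b': "is_basis V k' e'"
    using M M' by (auto simp: matrix_wrt_def)
  have e: "\<And>j. j < k \<Longrightarrow> e j \<in> carrier V" and e': "\<And>j. j < k' \<Longrightarrow> e' j \<in> carrier V"
    using b b' by (auto simp: is_basis_def)
  have "\<exists>c. e' j = lincomb V k c e" if "j < k'" for j
    using is_basis_span[OF b e'[OF that]] by blast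
  then have "\<exists>q. \<forall>j<k'. e' j = lincomb V k (\<lambda>i. q i j) e"
    by (rule choose_columns)
  then obtain q where q: "\<And>j. j < k' \<Longrightarrow> e' j = lincomb V k (\<lambda>i. q i j) e"
    by blast
  have "\<exists>c. e j = lincomb V k' c e'" if "j < k" for j
    using is_basis_span[OF b' e[OF that]] by blast
  then have "\<exists>r. \<forall>j<k. e j = lincomb V k' (\<lambda>i. r i j) e'"
    by (rule choose_columns)
  then obtain r where r: "\<And>j. j < k \<Longrightarrow> e j = lincomb V k' (\<lambda>i. r i j) e'"
    by blast
  have qr: "(\<Sum>h<k'. q i h * r h j) = (if i = j then 1 else 0)" if "i < k" "j < k" for i j
  proof -
    have "lincomb V k (\<lambda>i. if i = j then 1 else 0) e = e j"
      using e that by (simp add: lincomb_unit)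
    also have "e j = lincomb V k' (\<lambda>i. r i j) (\<lambda>h. lincomb V k (\<lambda>i. q i h) e)"
      using r[OF that(2)] q e by (auto intro!: lincomb_cong lincomb_closed)
    also have "\<dots> = lincomb V k (\<lambda>i. \<Sum>h<k'. q i h * r h j) e"
      using e by (simp add: lincomb_lincomb)
    finally show ?thesis
      using is_basis_eqD[OF b _ that(1)] by (metis (mono_tags, lifting))
  qed
  have rq: "(\<Sum>h<k. r i h * q h j) = (if i = j then 1 else 0)" if "i < k'" "j < k'" for i j
  proof -
    have "lincomb V k' (\<lambda>i. if i = j then 1 else 0) e' = e' j"
      using e' that by (simp add: lincomb_unit)
    also have "e' j = lincomb V k (\<lambda>i. q i j) (\<lambda>h. lincomb V k' (\<lambda>i. r i h) e')"
      using q[OF that(2)] r e' by (auto intro!: lincomb_cong lincomb_closed)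
    also have "\<dots> = lincomb V k' (\<lambda>i. \<Sum>h<k. r i h * q h j) e'"
      using e' by (simp add: lincomb_lincomb)
    finally show ?thesis
      using is_basis_eqD[OF b' _ that(1)] by (metis (mono_tags, lifting))
  qed
  \<comment> \<open>Equality of dimensions, by comparing the traces of the two products.\<close>
  have "of_nat k = (\<Sum>i<k. \<Sum>h<k'. q i h * r h i)"
    by (simp add: qr)
  also have "\<dots> = (\<Sum>h<k'. \<Sum>i<k. r h i * q i h)"
    by (subst sum.swap) (simp add: mult.commute)
  also have "\<dots> = of_nat k'"
    by (simp add: rq)
  finally have [simp]: "k' = k"
    by simp
  have MQ: "(\<Sum>h<k. M $$ (i, h) * q h j) = (\<Sum>h<k. q i h * M' $$ (h, j))" if "i < k" "j < k" for i j
  proof -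
    have "lincomb V k (\<lambda>i. \<Sum>h<k. M $$ (i, h) * q h j) e
        = lincomb V k (\<lambda>h. q h j) (\<lambda>h. lincomb V k (\<lambda>i. M $$ (i, h)) e)"
      using e by (simp add: lincomb_lincomb)
    also have "\<dots> = lincomb V k (\<lambda>h. q h j) (\<lambda>h. T (e h))"
      using M e by (intro lincomb_cong) (auto simp: matrix_wrt_def intro!: lincomb_closed)
    also have "\<dots> = T (e' j)"
      using clinear_map_lincomb[OF V V T e] q that by simp
    also have "\<dots> = lincomb V k (\<lambda>h. M' $$ (h, j)) e'"
      using M' that by (simp add: matrix_wrt_def)
    also have "\<dots> = lincomb V k (\<lambda>h. M' $$ (h, j)) (\<lambda>h. lincomb V k (\<lambda>i. q i h) e)"
      using q e by (auto intro!: lincomb_cong lincomb_closed)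
    also have "\<dots> = lincomb V k (\<lambda>i. \<Sum>h<k. q i h * M' $$ (h, j)) e"
      using e by (simp add: lincomb_lincomb)
    finally show ?thesis
      using is_basis_eqD[OF b _ that(1)] by (metis (mono_tags, lifting))
  qed
  let ?Q = "Matrix.mat k k (\<lambda>(i, j). q i j)" and ?R = "Matrix.mat k k (\<lambda>(i, j). r i j)"
  have carr: "M \<in> carrier_mat k k" "M' \<in> carrier_mat k k"
    using M M' by (auto simp: matrix_wrt_def)
  have Mm: "Matrix.mat k k (\<lambda>ij. M $$ ij) = M" "Matrix.mat k k (\<lambda>ij. M' $$ ij) = M'"
    using carr by auto
  have 1: "?Q * ?R = 1\<^sub>m k" and 2: "?R * ?Q = 1\<^sub>m k"
    using qr rq by (auto intro!: eq_matI simp: mult_mat_index simp del: index_mult_mat(1))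
  have "Matrix.mat k k (\<lambda>ij. M $$ ij) * ?Q = ?Q * Matrix.mat k k (\<lambda>ij. M' $$ ij)"
    using MQ by (intro eq_matI) (auto simp: mult_mat_index simp del: index_mult_mat(1))
  then have "M * ?Q = ?Q * M'"
    by (simp only: Mm)
  then have "M * ?Q * ?R = ?Q * M' * ?R"
    by simp
  then have "M = ?Q * M' * ?R"
    using carr 1 by (simp add: assoc_mult_mat[of _ k k _ k _ k])
  then have "similar_mat_wit M M' ?Q ?R"
    using carr 1 2 by (intro similar_mat_witI[of _ _ k]) auto
  then show ?thesis
    by (intro char_poly_similar) (auto simp: similar_mat_def)
qed

lemma endo_char_poly_eq:
  assumes "cspace V" "clinear_map V V T" "matrix_wrt V T k e M"
  shows "endo_char_poly V T = char_poly M"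
  unfolding endo_char_poly_def
proof (rule the_equality)
  show "\<exists>k e M'. is_basis V k e \<and> M' \<in> carrier_mat k k \<and>
     (\<forall>j<k. T (e j) = lincomb V k (\<lambda>i. M' $$ (i, j)) e) \<and> char_poly M = char_poly M'"
    using assms(3) unfolding matrix_wrt_def by blast
next
  fix f assume "\<exists>k e M. is_basis V k e \<and> M \<in> carrier_mat k k \<and>
     (\<forall>j<k. T (e j) = lincomb V k (\<lambda>i. M $$ (i, j)) e) \<and> f = char_poly M"
  then obtain k' e' M' where "matrix_wrt V T k' e' M'" "f = char_poly M'"
    unfolding matrix_wrt_def by blast
  then show "f = char_poly M"
    using matrix_wrt_char_poly_unique[OF assms(1,2)] assms(3) by blast
qed

text \<open>If n < d, both matrices can be padded with zeros to size d. The padded C is then a left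
  inverse of the padded D, hence also a right inverse, but row n of the padded D is zero, so the
  diagonal entry of D C at n cannot be 1.\<close>

lemma card_basis_le_card_spanning:
  fixes C D :: "nat \<Rightarrow> nat \<Rightarrow> complex"
  assumes "\<And>i j. i < d \<Longrightarrow> j < d \<Longrightarrow> (\<Sum>h<n. C i h * D h j) = (if i = j then 1 else 0)"
  shows "d \<le> n"
proof (rule ccontr)
  assume "\<not> d \<le> n"
  let ?C = "Matrix.mat d d (\<lambda>(i, j). if j < n then C i j else 0)"
  let ?D = "Matrix.mat d d (\<lambda>(i, j). if i < n then D i j else 0)"
  have "(\<Sum>h<d. (if h < n then C i h else 0) * (if h < n then D h j else 0)) = (\<Sum>h<n. C i h * D h j)" for i j
    using \<open>\<not> d \<le> n\<close> by (intro sum.mono_neutral_cong_right) auto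
  then have "?C * ?D = 1\<^sub>m d"
    using assms by (auto intro!: eq_matI simp: mult_mat_index simp del: index_mult_mat(1))
  then have "?D * ?C = 1\<^sub>m d"
    by (rule mat_mult_left_right_inverse[rotated 2]) auto
  then have "(?D * ?C) $$ (n, n) = 1"
    using \<open>\<not> d \<le> n\<close> by simp
  then show False
    using \<open>\<not> d \<le> n\<close> by (simp add: mult_mat_index del: index_mult_mat(1))
qed

text \<open>A left eigenvector of \<open>T\<close> is a linear form \<open>\<phi>\<close> with \<open>\<phi> \<circ> T = \<lambda> \<phi>\<close>; the values of \<open>\<phi>\<close> on
  the spanning family form a left eigenvector of \<open>m\<close>, whose entry of largest modulus bounds \<open>\<lambda>\<close>.\<close>

lemma eigenvalue_bound_spanning:
  assumes V: "cspace V" and T: "clinear_map V V T" and M: "matrix_wrt V T d b M"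
    and f: "\<And>j. j < n \<Longrightarrow> f j \<in> carrier V"
    and span: "\<And>v. v \<in> carrier V \<Longrightarrow> \<exists>c. v = lincomb V n c f"
    and m: "\<And>j. j < n \<Longrightarrow> T (f j) = lincomb V n (\<lambda>i. m i j) f"
    and K: "\<And>j. j < n \<Longrightarrow> (\<Sum>i<n. norm (m i j)) \<le> K"
  shows "d \<le> n" and "\<And>x. poly (char_poly M) x = 0 \<Longrightarrow> norm x \<le> K"
proof -
  interpret cspace V by fact
  have bas: "is_basis V d b" and Mc: "M \<in> carrier_mat d d"
    and Tb: "\<And>j. j < d \<Longrightarrow> T (b j) = lincomb V d (\<lambda>i. M $$ (i, j)) b"
    using M by (auto simp: matrix_wrt_def)
  have b: "\<And>j. j < d \<Longrightarrow> b j \<in> carrier V"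
    using bas by (auto simp: is_basis_def)
  have "\<exists>c. f j = lincomb V d c b" if "j < n" for j
    using is_basis_span[OF bas f[OF that]] by blast
  then have "\<exists>C. \<forall>j<n. f j = lincomb V d (\<lambda>i. C i j) b"
    by (rule choose_columns)
  then obtain C where C: "\<And>j. j < n \<Longrightarrow> f j = lincomb V d (\<lambda>i. C i j) b"
    by blast
  have "\<exists>c. b j = lincomb V n c f" if "j < d" for j
    using span[OF b[OF that]] .
  then have "\<exists>D. \<forall>j<d. b j = lincomb V n (\<lambda>i. D i j) f"
    by (rule choose_columns)
  then obtain D where D: "\<And>j. j < d \<Longrightarrow> b j = lincomb V n (\<lambda>i. D i j) f"
    by blast
  have CD: "(\<Sum>h<n. C i h * D h j) = (if i = j then 1 else 0)" if "i < d" "j < d" for i j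
  proof -
    have "lincomb V d (\<lambda>i. if i = j then 1 else 0) b = b j"
      using b that by (simp add: lincomb_unit)
    also have "b j = lincomb V n (\<lambda>i. D i j) (\<lambda>h. lincomb V d (\<lambda>i. C i h) b)"
      using D[OF that(2)] C b by (auto intro!: lincomb_cong lincomb_closed)
    also have "\<dots> = lincomb V d (\<lambda>i. \<Sum>h<n. C i h * D h j) b"
      using b by (simp add: lincomb_lincomb)
    finally show ?thesis
      using is_basis_eqD[OF bas _ that(1)] by (metis (mono_tags, lifting))
  qed
  show "d \<le> n"
    using card_basis_le_card_spanning[OF CD] .
  \<comment> \<open>Computing T (f j) in two ways gives M C = C m. The matrix m need not be
    determined by T, because the f j may be dependent, but this intertwining relation is all that is
    used of it.\<close>
  have MC: "(\<Sum>h<d. M $$ (i, h) * C h j) = (\<Sum>h<n. C i h * m h j)" if "i < d" "j < n" for i j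
  proof -
    have "lincomb V d (\<lambda>i. \<Sum>h<d. M $$ (i, h) * C h j) b
        = lincomb V d (\<lambda>h. C h j) (\<lambda>h. lincomb V d (\<lambda>i. M $$ (i, h)) b)"
      using b by (simp add: lincomb_lincomb)
    also have "\<dots> = lincomb V d (\<lambda>h. C h j) (\<lambda>h. T (b h))"
      using Tb b by (intro lincomb_cong) (auto intro!: lincomb_closed)
    also have "\<dots> = T (f j)"
      using clinear_map_lincomb[OF V V T b] C that by simp
    also have "\<dots> = lincomb V n (\<lambda>h. m h j) (\<lambda>h. lincomb V d (\<lambda>i. C i h) b)"
      using m[OF that(2)] C b by (auto intro!: lincomb_cong lincomb_closed)
    also have "\<dots> = lincomb V d (\<lambda>i. \<Sum>h<n. C i h * m h j) b"
      using b by (simp add: lincomb_lincomb)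
    finally show ?thesis
      using is_basis_eqD[OF bas _ that(1)] by (metis (mono_tags, lifting))
  qed
  \<comment> \<open>Right eigenvectors of the transpose are the left eigenvectors of M.\<close>
  fix x assume "poly (char_poly M) x = 0"
  then have "poly (char_poly (transpose_mat M)) x = 0"
    using Mc by (simp add: char_poly_transpose_mat)
  then obtain w where w: "eigenvector (transpose_mat M) w x"
    using eigenvalue_root_char_poly[of "transpose_mat M" d x] Mc by (auto simp: eigenvalue_def)
  define u where "u = vec_index w"
  have wc: "w \<in> carrier_vec d" and w0: "w \<noteq> 0\<^sub>v d" and wx: "transpose_mat M *\<^sub>v w = x \<cdot>\<^sub>v w"
    using w Mc by (auto simp: eigenvector_def)
  have uM: "(\<Sum>i<d. u i * M $$ (i, j)) = x * u j" if "j < d" for j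
  proof -
    have "vec_index (transpose_mat M *\<^sub>v w) j = (\<Sum>i<d. u i * M $$ (i, j))"
      using that Mc wc
      by (simp add: scalar_prod_def u_def lessThan_atLeast0 mult.commute)
    then show ?thesis
      unfolding wx using that wc by (simp add: u_def)
  qed
  obtain i0 where i0: "i0 < d" "u i0 \<noteq> 0"
    using w0 wc unfolding u_def by (metis carrier_vecD eq_vecI index_zero_vec)
  define y where "y j = (\<Sum>i<d. u i * C i j)" for j
  have ym: "(\<Sum>i<n. y i * m i j) = x * y j" if "j < n" for j
  proof -
    have "(\<Sum>i<n. y i * m i j) = (\<Sum>l<d. u l * (\<Sum>i<n. C l i * m i j))"
      unfolding y_def sum_distrib_left sum_distrib_right by (subst sum.swap) (simp add: mult.assoc)
    also have "\<dots> = (\<Sum>l<d. u l * (\<Sum>i<d. M $$ (l, i) * C i j))"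
      using MC that by simp
    also have "\<dots> = (\<Sum>i<d. (\<Sum>l<d. u l * M $$ (l, i)) * C i j)"
      unfolding sum_distrib_left sum_distrib_right by (subst sum.swap) (simp add: mult.assoc)
    also have "\<dots> = x * y j"
      unfolding y_def sum_distrib_left by (simp add: uM mult.assoc)
    finally show ?thesis .
  qed
  \<comment> \<open>With C D = 1 the row vector y = u C satisfies y D = u, so y is nonzero because u
    is.\<close>
  have "(\<Sum>j<n. y j * D j i0) = (\<Sum>l<d. u l * (\<Sum>j<n. C l j * D j i0))"
    unfolding y_def sum_distrib_left sum_distrib_right by (subst sum.swap) (simp add: mult.assoc)
  also have "\<dots> = (\<Sum>l<d. u l * (if l = i0 then 1 else 0))"
    using CD i0 by simp
  also have "\<dots> = (\<Sum>l<d. if l = i0 then u l else 0)"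
    by (intro sum.cong) auto
  also have "\<dots> = u i0"
    using i0 by simp
  finally have "\<exists>j<n. y j \<noteq> 0"
    using i0(2) by (metis (no_types, lifting) lessThan_iff mult_eq_0_iff sum.neutral)
  then obtain j1 where j1: "j1 < n" "y j1 \<noteq> 0" by blast
  define Y where "Y = Max ((\<lambda>j. norm (y j)) ` {..<n})"
  have Y: "norm (y j) \<le> Y" if "j < n" for j
    unfolding Y_def using that by (intro Max_ge) auto
  have "Y \<in> (\<lambda>j. norm (y j)) ` {..<n}"
    unfolding Y_def using j1 by (intro Max_in) auto
  then obtain j where j: "j < n" "norm (y j) = Y" by auto
  have "Y > 0"
    using Y[OF j1(1)] j1(2) by (smt (verit) zero_less_norm_iff)
  have "norm x * Y = norm (\<Sum>i<n. y i * m i j)"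
    using ym[OF j(1)] j(2) by (simp add: norm_mult)
  also have "\<dots> \<le> (\<Sum>i<n. Y * norm (m i j))"
    by (intro sum_norm_le) (use Y in \<open>auto simp: norm_mult intro!: mult_right_mono\<close>)
  also have "\<dots> \<le> Y * K"
    using K[OF j(1)] \<open>Y > 0\<close> by (simp flip: sum_distrib_left)
  finally show "norm x \<le> K"
    using \<open>Y > 0\<close> by (simp add: mult.commute)
qed

text \<open>A further factor X - x turns each coefficient into its predecessor minus x times itself,
  so the bound grows by the factor 1 + K.\<close>

lemma coeff_prod_linear_bound:
  fixes xs :: "complex list"
  assumes "\<And>x. x \<in> set xs \<Longrightarrow> norm x \<le> K" and "K \<ge> 0"
  shows "norm (coeff (\<Prod>x\<leftarrow>xs. [:- x, 1:]) i) \<le> (1 + K) ^ length xs"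
  using assms(1)
proof (induction xs arbitrary: i)
  case Nil
  then show ?case by (cases i) auto
next
  case (Cons x xs)
  let ?p = "\<Prod>x\<leftarrow>xs. [:- x, 1:]"
  have IH: "norm (coeff ?p i) \<le> (1 + K) ^ length xs" for i
    using Cons by auto
  have "coeff (\<Prod>x\<leftarrow>x # xs. [:- x, 1:]) i = - x * coeff ?p i + (case i of 0 \<Rightarrow> 0 | Suc j \<Rightarrow> coeff ?p j)"
    by (simp add: coeff_pCons split: nat.split)
  also have "norm \<dots> \<le> K * (1 + K) ^ length xs + (1 + K) ^ length xs"
  proof (rule norm_triangle_le[OF add_mono])
    show "norm (- x * coeff ?p i) \<le> K * (1 + K) ^ length xs"
      using IH[of i] Cons.prems[of x] assms(2) by (auto simp: norm_mult intro!: mult_mono)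
    show "norm (case i of 0 \<Rightarrow> 0 | Suc j \<Rightarrow> coeff ?p j) \<le> (1 + K) ^ length xs"
      using IH assms(2) by (auto split: nat.split)
  qed
  finally show ?case
    by (simp add: algebra_simps)
qed

text \<open>The exponent is the size n of a spanning family rather than the dimension d, which makes
  the bound the same for all fibres spanned by n vectors. Enlarging the exponent is allowed since 1
  + K is at least 1.\<close>

lemma char_poly_coeff_bound:
  fixes M :: "complex mat"
  assumes "M \<in> carrier_mat d d" "d \<le> n" "K \<ge> 0"
    and "\<And>x. poly (char_poly M) x = 0 \<Longrightarrow> norm x \<le> K"
  shows "norm (coeff (char_poly M) i) \<le> (1 + K) ^ n"
proof -
  obtain xs where xs: "char_poly M = (\<Prod>x\<leftarrow>xs. [:- x, 1:])" "length xs = d"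
    using char_poly_factorized[OF assms(1)] by blast
  have "norm x \<le> K" if "x \<in> set xs" for x
  proof (rule assms(4))
    show "poly (char_poly M) x = 0"
      using that unfolding xs(1) by (induction xs) auto
  qed
  then have "norm (coeff (char_poly M) i) \<le> (1 + K) ^ length xs"
    unfolding xs(1) using assms(3) by (intro coeff_prod_linear_bound) auto
  also have "\<dots> \<le> (1 + K) ^ n"
    using assms xs by (intro power_increasing) auto
  finally show ?thesis .
qed

text \<open>\<open>T'\<close> is only known through its image under \<phi>, which is how
  \<open>higgs\<close> is defined; injectivity of \<phi> makes it linear and gives it the same
  matrix in the pulled back basis. It will be applied with \<phi> the evaluation of global sections
  at z = 0.\<close>

lemma matrix_wrt_transfer:
  assumes E: "cspace E" and V: "cspace V" and \<phi>: "clinear_map E V \<phi>" "bij_betw \<phi> (carrier E) (carrier V)"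
    and T: "clinear_map V V T" and T': "\<And>s. s \<in> carrier E \<Longrightarrow> T' s \<in> carrier E \<and> \<phi> (T' s) = T (\<phi> s)"
    and M: "matrix_wrt V T k e M"
  shows "clinear_map E E T'" and "matrix_wrt E T' k (\<lambda>j. inv_into (carrier E) \<phi> (e j)) M"
proof -
  interpret E: cspace E by fact
  interpret V: cspace V by fact
  have inj: "s = t" if "s \<in> carrier E" "t \<in> carrier E" "\<phi> s = \<phi> t" for s t
    using \<phi>(2) that by (meson bij_betw_imp_inj_on inj_onD)
  have \<phi>_lin: "\<And>s. s \<in> carrier E \<Longrightarrow> \<phi> s \<in> carrier V"
    "\<And>s t. s \<in> carrier E \<Longrightarrow> t \<in> carrier E \<Longrightarrow> \<phi> (s \<oplus>\<^bsub>E\<^esub> t) = \<phi> s \<oplus>\<^bsub>V\<^esub> \<phi> t"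
    "\<And>c s. s \<in> carrier E \<Longrightarrow> \<phi> (c \<odot>\<^bsub>E\<^esub> s) = c \<odot>\<^bsub>V\<^esub> \<phi> s"
    using \<phi>(1) by (auto simp: clinear_map_def)
  have T_lin: "\<And>s t. s \<in> carrier V \<Longrightarrow> t \<in> carrier V \<Longrightarrow> T (s \<oplus>\<^bsub>V\<^esub> t) = T s \<oplus>\<^bsub>V\<^esub> T t"
    "\<And>c s. s \<in> carrier V \<Longrightarrow> T (c \<odot>\<^bsub>V\<^esub> s) = c \<odot>\<^bsub>V\<^esub> T s"
    using T by (auto simp: clinear_map_def)
  show "clinear_map E E T'"
    unfolding clinear_map_def
  proof (intro conjI ballI allI)
    fix s assume s: "s \<in> carrier E"
    then show "T' s \<in> carrier E" using T' by blast
    show "T' (c \<odot>\<^bsub>E\<^esub> s) = c \<odot>\<^bsub>E\<^esub> T' s" for c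
      by (rule inj) (simp_all add: s T' E.smult_closed \<phi>_lin T_lin)
    fix t assume t: "t \<in> carrier E"
    show "T' (s \<oplus>\<^bsub>E\<^esub> t) = T' s \<oplus>\<^bsub>E\<^esub> T' t"
      by (rule inj) (simp_all add: s t T' \<phi>_lin T_lin)
  qed
  let ?e = "\<lambda>j. inv_into (carrier E) \<phi> (e j)"
  have b: "is_basis V k e" and Te: "\<And>j. j < k \<Longrightarrow> T (e j) = lincomb V k (\<lambda>i. M $$ (i, j)) e"
    using M by (auto simp: matrix_wrt_def)
  have im: "\<phi> ` carrier E = carrier V"
    using \<phi>(2) by (rule bij_betw_imp_surj_on)
  have e: "?e j \<in> carrier E" "\<phi> (?e j) = e j" if "j < k" for j
    using V.is_basis_carrier[OF b that] im by (auto intro: inv_into_into f_inv_into_f)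
  have \<phi>_lincomb: "\<phi> (lincomb E k c ?e) = lincomb V k c e" for c
    using clinear_map_lincomb[OF E V \<phi>(1), of k ?e c] e V.is_basis_carrier[OF b]
      V.lincomb_cong[of k c c "\<lambda>j. \<phi> (?e j)" e] by simp
  have "is_basis E k ?e"
  proof (rule E.is_basisI)
    fix s assume s: "s \<in> carrier E"
    obtain c where "\<phi> s = lincomb V k c e"
      using V.is_basis_span[OF b \<phi>_lin(1)[OF s]] .
    then have "s = lincomb E k c ?e"
      by (intro inj) (simp_all add: s \<phi>_lincomb E.lincomb_closed e)
    then show "\<exists>c. s = lincomb E k c ?e"
      by (intro exI[of _ c])
  next
    fix c j assume c: "lincomb E k c ?e = \<zero>\<^bsub>E\<^esub>" and j: "j < k"
    have "lincomb V k c e = \<phi> (lincomb E k c ?e)"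
      by (simp only: \<phi>_lincomb)
    also have "\<dots> = \<phi> (lincomb E k (\<lambda>j. 0) ?e)"
      using c E.lincomb_zero[of k ?e] e by simp
    also have "\<dots> = lincomb V k (\<lambda>j. 0) e"
      by (simp only: \<phi>_lincomb)
    finally show "c j = 0"
      using V.is_basis_eqD[OF b _ j] by blast
  qed (rule e)
  moreover have "T' (?e j) = lincomb E k (\<lambda>i. M $$ (i, j)) ?e" if "j < k" for j
    by (rule inj) (simp_all add: T' e that \<phi>_lincomb Te E.lincomb_closed)
  ultimately show "matrix_wrt E T' k ?e M"
    using M by (simp add: matrix_wrt_def)
qed

section \<open>Fibres as complex vector spaces\<close>

context op_ideal
begin

lemma cspace_fibre: "cspace (fibre I x)"
proof -
  have R: "smul f A \<in> Rop" "A + B \<in> Rop" "- A \<in> Rop" "0 \<in> Rop" if "A \<in> Rop" "B \<in> Rop" for f A B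
    using that by (blast intro: Rop_smul Rop.intros(4) Rop_minus Rop_zero)+
  interpret abelian_group "fibre I x"
  proof (rule abelian_groupI)
    fix u assume "u \<in> carrier (fibre I x)"
    then obtain A where A: "A \<in> Rop" "u = cls I x A" by (auto simp: carrier_fibre)
    have "cls I x (- A) \<oplus>\<^bsub>fibre I x\<^esub> u = \<zero>\<^bsub>fibre I x\<^esub>"
      unfolding A(2) zero_fibre using A(1) by (subst add_cls) (auto intro: Rop_minus)
    then show "\<exists>v\<in>carrier (fibre I x). v \<oplus>\<^bsub>fibre I x\<^esub> u = \<zero>\<^bsub>fibre I x\<^esub>"
      using A(1) by (auto intro!: bexI[of _ "cls I x (- A)"] cls_in_carrier Rop_minus)
  qed (auto simp: carrier_fibre zero_fibre add_cls R Rop_zero ac_simps)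
  show ?thesis
  proof
    fix c d v assume "v \<in> carrier (fibre I x)"
    then obtain A where A: "A \<in> Rop" "v = cls I x A" by (auto simp: carrier_fibre)
    show "c \<odot>\<^bsub>fibre I x\<^esub> v \<in> carrier (fibre I x)"
      unfolding A(2) using A(1) by (simp only: smult_cls) (intro cls_in_carrier Rop_smul)
    show "(c + d) \<odot>\<^bsub>fibre I x\<^esub> v = c \<odot>\<^bsub>fibre I x\<^esub> v \<oplus>\<^bsub>fibre I x\<^esub> d \<odot>\<^bsub>fibre I x\<^esub> v"
      unfolding A(2) using A(1)
      by (simp only: smult_cls add_cls Rop_smul pconst_add smul_add_left)
    show "c \<odot>\<^bsub>fibre I x\<^esub> (d \<odot>\<^bsub>fibre I x\<^esub> v) = (c * d) \<odot>\<^bsub>fibre I x\<^esub> v"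
      unfolding A(2) using A(1)
      by (simp only: smult_cls Rop_smul pconst_mult smul_smul)
    show "1 \<odot>\<^bsub>fibre I x\<^esub> v = v"
      unfolding A(2) using A(1) by (simp only: smult_cls pconst_one smul_one)
    fix w assume "w \<in> carrier (fibre I x)"
    then obtain B where B: "B \<in> Rop" "w = cls I x B" by (auto simp: carrier_fibre)
    show "c \<odot>\<^bsub>fibre I x\<^esub> (v \<oplus>\<^bsub>fibre I x\<^esub> w) = c \<odot>\<^bsub>fibre I x\<^esub> v \<oplus>\<^bsub>fibre I x\<^esub> c \<odot>\<^bsub>fibre I x\<^esub> w"
      unfolding A(2) B(2) using A(1) B(1)
      by (simp only: smult_cls add_cls Rop_smul smul_add_right Rop.intros(4))
  qed
qed

lemma lincomb_cls:
  assumes "\<And>j. j < k \<Longrightarrow> A j \<in> Rop"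
  shows "lincomb (fibre I x) k c (\<lambda>j. cls I x (A j)) = cls I x (\<Sum>j<k. smul (pconst (c j)) (A j))"
  using assms
proof (induction k)
  interpret V: cspace "fibre I x" by (rule cspace_fibre)
  case 0
  then show ?case by (simp only: V.lincomb_0 zero_fibre lessThan_0 sum.empty)
next
  interpret V: cspace "fibre I x" by (rule cspace_fibre)
  case (Suc k)
  have 1: "(\<Sum>j<k. smul (pconst (c j)) (A j)) \<in> Rop"
    by (rule Rop_sum, rule Rop_smul, rule Suc.prems, simp)
  have 2: "smul (pconst (c k)) (A k) \<in> Rop"
    by (rule Rop_smul, rule Suc.prems, simp)
  have IH: "lincomb (fibre I x) k c (\<lambda>j. cls I x (A j)) = cls I x (\<Sum>j<k. smul (pconst (c j)) (A j))"
    by (rule Suc.IH, rule Suc.prems, simp)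
  have "lincomb (fibre I x) (Suc k) c (\<lambda>j. cls I x (A j))
    = lincomb (fibre I x) k c (\<lambda>j. cls I x (A j)) \<oplus>\<^bsub>fibre I x\<^esub> c k \<odot>\<^bsub>fibre I x\<^esub> cls I x (A k)"
    by (rule V.lincomb_Suc) (rule cls_in_carrier, rule Suc.prems)
  then show ?case
    using 1 2 by (simp only: IH smult_cls Suc.prems lessI add_cls sum.lessThan_Suc)
qed

end

section \<open>Holomorphic functions of several variables\<close>

text \<open>The pointwise part of \<open>mv_holomorphic_on\<close>, separated so that functions can
  be combined at a point without tracking open domains.\<close>

definition cdiff_at :: "(complex ^ 'k::finite \<Rightarrow> complex) \<Rightarrow> complex ^ 'k \<Rightarrow> bool" where
  "cdiff_at f x \<longleftrightarrow> (\<exists>D. (f has_derivative D) (at x) \<and> (\<forall>c v. D (c *s v) = c * D v))"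

lemma mv_holomorphic_on_iff: "mv_holomorphic_on f W \<longleftrightarrow> open W \<and> (\<forall>x\<in>W. cdiff_at f x)"
  by (simp add: mv_holomorphic_on_def cdiff_at_def)

lemma mv_holomorphic_on_subset: "mv_holomorphic_on f W \<Longrightarrow> open V \<Longrightarrow> V \<subseteq> W \<Longrightarrow> mv_holomorphic_on f V"
  by (auto simp: mv_holomorphic_on_iff)

lemma cdiff_at_const [intro]: "cdiff_at (\<lambda>x. c) x"
  unfolding cdiff_at_def by (intro exI[of _ "\<lambda>v. 0"]) auto

lemma cdiff_at_nth [intro]: "cdiff_at (\<lambda>x. x $ i) x"
  unfolding cdiff_at_def
  by (intro exI[of _ "\<lambda>v. v $ i"]) (auto intro!: bounded_linear_imp_has_derivative bounded_linear_vec_nth)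

lemma cdiff_at_add [intro]:
  assumes "cdiff_at f x" "cdiff_at g x"
  shows "cdiff_at (\<lambda>x. f x + g x) x"
proof -
  obtain D E where "(f has_derivative D) (at x)" "\<forall>c v. D (c *s v) = c * D v"
    "(g has_derivative E) (at x)" "\<forall>c v. E (c *s v) = c * E v"
    using assms unfolding cdiff_at_def by blast
  then show ?thesis
    unfolding cdiff_at_def
    by (intro exI[of _ "\<lambda>v. D v + E v"]) (auto intro!: derivative_eq_intros simp: distrib_left)
qed

lemma cdiff_at_mult [intro]:
  assumes "cdiff_at f x" "cdiff_at g x"
  shows "cdiff_at (\<lambda>x. f x * g x) x"
proof -
  obtain D E where "(f has_derivative D) (at x)" "\<forall>c v. D (c *s v) = c * D v"
    "(g has_derivative E) (at x)" "\<forall>c v. E (c *s v) = c * E v"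
    using assms unfolding cdiff_at_def by blast
  then show ?thesis
    unfolding cdiff_at_def
    by (intro exI[of _ "\<lambda>v. f x * E v + D v * g x"]) (auto intro!: derivative_eq_intros simp: algebra_simps)
qed

lemma cdiff_at_inverse [intro]:
  assumes "cdiff_at f x" "f x \<noteq> 0"
  shows "cdiff_at (\<lambda>x. inverse (f x)) x"
proof -
  obtain D where "(f has_derivative D) (at x)" "\<forall>c v. D (c *s v) = c * D v"
    using assms unfolding cdiff_at_def by blast
  then show ?thesis
    unfolding cdiff_at_def using Deriv.has_derivative_inverse[of f x D UNIV] assms(2)
    by (intro exI[of _ "\<lambda>v. - (inverse (f x) * D v * inverse (f x))"]) simp
qed

lemma cdiff_at_divide [intro]:
  "cdiff_at f x \<Longrightarrow> cdiff_at g x \<Longrightarrow> g x \<noteq> 0 \<Longrightarrow> cdiff_at (\<lambda>x. f x / g x) x"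
  unfolding divide_inverse by (intro cdiff_at_mult cdiff_at_inverse)

lemma cdiff_at_power [intro]: "cdiff_at f x \<Longrightarrow> cdiff_at (\<lambda>x. f x ^ n) x"
  by (induction n) auto

lemma cdiff_at_sum [intro]: "(\<And>j. j \<in> J \<Longrightarrow> cdiff_at (f j) x) \<Longrightarrow> cdiff_at (\<lambda>x. \<Sum>j\<in>J. f j x) x"
  by (induction J rule: infinite_finite_induct) auto

lemma cdiff_at_prod [intro]: "(\<And>j. j \<in> J \<Longrightarrow> cdiff_at (f j) x) \<Longrightarrow> cdiff_at (\<lambda>x. \<Prod>j\<in>J. f j x) x"
  by (induction J rule: infinite_finite_induct) auto

lemma cdiff_at_transform:
  assumes "cdiff_at f x" "open N" "x \<in> N" "\<And>y. y \<in> N \<Longrightarrow> g y = f y"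
  shows "cdiff_at g x"
  using assms unfolding cdiff_at_def by (metis (no_types, lifting) has_derivative_transform_within_open)

lemma cdiff_at_imp_continuous: "cdiff_at f x \<Longrightarrow> isCont f x"
  unfolding cdiff_at_def using has_derivative_continuous by blast

lemma vec_axis_expansion: "(v :: complex ^ 'k::finite) = (\<Sum>i\<in>UNIV. v $ i *s axis i 1)"
  by (simp add: Finite_Cartesian_Product.vec_eq_iff axis_def if_distrib cong: if_cong)

text \<open>Complex homogeneity determines the derivative from its values on the coordinate axes. In
  this explicit form its continuity in parameters reduces to that of the partial
  derivatives.\<close>

lemma cdiff_at_has_derivative:
  assumes "cdiff_at f x"
  shows "(f has_derivative (\<lambda>v. \<Sum>i\<in>UNIV. v $ i * partial_at i f x)) (at x)"
proof -
  obtain D where D: "(f has_derivative D) (at x)" "\<And>c v. D (c *s v) = c * D v"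
    using assms unfolding cdiff_at_def by blast
  have "D = frechet_derivative f (at x)"
    using D(1) by (rule frechet_derivative_at)
  then have p: "partial_at i f x = D (axis i 1)" for i
    by (simp add: partial_at_def)
  interpret D: linear D
    using D(1) by (rule has_derivative_linear)
  have "D v = (\<Sum>i\<in>UNIV. v $ i * partial_at i f x)" for v
  proof -
    have "D v = D (\<Sum>i\<in>UNIV. v $ i *s axis i 1)"
      using vec_axis_expansion[of v] by simp
    also have "\<dots> = (\<Sum>i\<in>UNIV. D (v $ i *s axis i 1))"
      by (rule D.sum)
    finally show ?thesis by (simp only: D(2) p)
  qed
  then have "D = (\<lambda>v. \<Sum>i\<in>UNIV. v $ i * partial_at i f x)" by blast
  with D(1) show ?thesis by simp
qed

lemma norm_scale_axis: "norm (c *s (axis i 1 :: complex ^ 'k::finite)) = norm c"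
proof -
  have "norm ((c *s (axis i 1 :: complex ^ 'k)) $ j) = (if j = i then norm c else 0)" for j
    by (simp add: axis_def)
  then have "norm (c *s (axis i 1 :: complex ^ 'k)) = L2_set (\<lambda>j. if j = i then norm c else 0) UNIV"
    by (simp only: norm_vec_def)
  then show ?thesis
    by (simp add: L2_set_def if_distrib[of "\<lambda>u. u\<^sup>2"] cong: if_cong)
qed

lemma bounded_linear_scale_axis: "bounded_linear (\<lambda>c. c *s (axis i 1 :: complex ^ 'k::finite))"
  by (rule bounded_linear_intro[of _ 1])
    (simp_all add: norm_scale_axis Finite_Cartesian_Product.vec_eq_iff algebra_simps)

lemma slice_has_field_derivative:
  assumes "cdiff_at f (x + c *s axis i 1)"
  shows "((\<lambda>c. f (x + c *s axis i 1)) has_field_derivative partial_at i f (x + c *s axis i 1)) (at c)"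
proof -
  let ?y = "x + c *s axis i 1"
  have 1: "((\<lambda>c. x + c *s axis i 1) has_derivative (\<lambda>h. h *s axis i 1)) (at c)"
    by (auto intro!: derivative_eq_intros bounded_linear_imp_has_derivative bounded_linear_scale_axis)
  have 2: "(\<Sum>j\<in>UNIV. (h *s axis i 1) $ j * partial_at j f ?y) = partial_at i f ?y * h" for h
  proof -
    have "(\<Sum>j\<in>UNIV. (h *s axis i 1) $ j * partial_at j f ?y) =
      (\<Sum>j\<in>UNIV. if j = i then h * partial_at j f ?y else 0)"
      by (intro sum.cong) (auto simp: axis_def)
    then show ?thesis by simp
  qed
  have "((\<lambda>c. f (x + c *s axis i 1)) has_derivative
      (\<lambda>h. \<Sum>j\<in>UNIV. (h *s axis i 1) $ j * partial_at j f ?y)) (at c)"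
    by (rule has_derivative_compose[OF 1 cdiff_at_has_derivative[OF assms]])
  then show ?thesis
    unfolding has_field_derivative_def 2 .
qed

text \<open>As an integral over a fixed interval the contour integral can be treated by the theorems
  on continuity and differentiation under the integral sign.\<close>

lemma contour_integral_circlepath_0:
  "contour_integral (circlepath 0 r) g =
     integral {0..1} (\<lambda>t. g (circlepath 0 r t) * (2 * pi * \<i> * circlepath 0 r t))"
  unfolding contour_integral_integral
proof (rule integral_cong)
  fix t
  have "vector_derivative (circlepath 0 r) (at t) = 2 * pi * \<i> * circlepath 0 r t"
    unfolding vector_derivative_circlepath by (simp add: circlepath)
  then show "g (circlepath 0 r t) * vector_derivative (circlepath 0 r) (at t) =
      g (circlepath 0 r t) * (2 * pi * \<i> * circlepath 0 r t)"
    by simp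
qed

lemma continuous_on_circlepath [continuous_intros]:
  "continuous_on S g \<Longrightarrow> continuous_on S (\<lambda>x. circlepath z r (g x))"
  unfolding circlepath by (intro continuous_intros)

lemma norm_circlepath_0: "r > 0 \<Longrightarrow> norm (circlepath 0 r t) = r"
  by (simp add: circlepath norm_mult norm_exp_eq_Re)

lemma mv_holomorphic_imp_continuous_on: "mv_holomorphic_on f W \<Longrightarrow> continuous_on W f"
  by (auto simp: mv_holomorphic_on_iff intro!: continuous_at_imp_continuous_on cdiff_at_imp_continuous)

text \<open>Holomorphy is defined by differentiability at each point, so continuity of the
  derivative has to be proved: Cauchy's formula on the slice in direction i writes the partial
  derivative as an integral of a function that is jointly continuous in the point and the
  parameter.\<close>

lemma mv_holomorphic_continuous_partial:
  assumes "mv_holomorphic_on f W"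
  shows "continuous_on W (partial_at i f)"
proof -
  have W: "open W" and cd: "\<And>x. x \<in> W \<Longrightarrow> cdiff_at f x"
    using assms by (auto simp: mv_holomorphic_on_iff)
  have "isCont (partial_at i f) x0" if x0: "x0 \<in> W" for x0
  proof -
    obtain e where e: "e > 0" "ball x0 e \<subseteq> W"
      by (rule openE[OF W x0])
    \<comment> \<open>Slices are used up to radius 2r, so that the closed disc of radius r lies
      inside the domain of holomorphy. A base point within r of x0 then stays within 3r < e of
      x0.\<close>
    define r where "r = e / 4"
    have r: "r > 0" using e by (simp add: r_def)
    have inW: "x + c *s axis i 1 \<in> W" if "x \<in> ball x0 r" "norm c \<le> 2 * r" for x c
    proof -
      have "dist (x + c *s axis i 1) x \<le> 2 * r"
        using that by (simp add: dist_norm norm_scale_axis)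
      with that have "dist x0 (x + c *s axis i 1) < e"
        unfolding r_def mem_ball by metric
      with e show ?thesis by auto
    qed
    have eq: "partial_at i f x = 1 / (2 * of_real pi * \<i>) * integral (cbox 0 1)
        (\<lambda>t. f (x + circlepath 0 r t *s axis i 1) / (circlepath 0 r t)\<^sup>2 * (2 * pi * \<i> * circlepath 0 r t))"
      if x: "x \<in> ball x0 r" for x
    proof -
      let ?g = "\<lambda>c. f (x + c *s axis i 1)"
      have d: "(?g has_field_derivative partial_at i f (x + c *s axis i 1)) (at c)" if "norm c \<le> 2 * r" for c
        by (rule slice_has_field_derivative) (rule cd[OF inW[OF x that]])
      have hol: "?g holomorphic_on ball 0 (2 * r)"
        unfolding holomorphic_on_def field_differentiable_def
      proof
        fix c :: complex assume "c \<in> ball 0 (2 * r)"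
        then have "(?g has_field_derivative partial_at i f (x + c *s axis i 1)) (at c)"
          by (intro d) simp
        then show "\<exists>f'. (?g has_field_derivative f') (at c within ball 0 (2 * r))"
          by (blast intro: has_field_derivative_at_within)
      qed
      have 1: "(?g has_field_derivative (1 / (2 * of_real pi * \<i>) *
          contour_integral (circlepath 0 r) (\<lambda>u. ?g u / (u - 0)^2))) (at 0)"
        by (rule Cauchy_derivative_integral_circlepath)
          (use r in \<open>auto intro!: holomorphic_on_imp_continuous_on holomorphic_on_subset[OF hol]\<close>)
      have "partial_at i f (x + 0 *s axis i 1) = 1 / (2 * of_real pi * \<i>) *
          contour_integral (circlepath 0 r) (\<lambda>u. ?g u / (u - 0)^2)"
        by (intro DERIV_unique[OF d 1]) (use r in simp)
      then show ?thesis
        by (simp only: contour_integral_circlepath_0 diff_zero vector_smult_lzero add_0_right cbox_interval)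
    qed
    have "continuous_on (ball x0 r) (\<lambda>x. 1 / (2 * of_real pi * \<i>) * integral (cbox 0 1)
        (\<lambda>t. f (x + circlepath 0 r t *s axis i 1) / (circlepath 0 r t)\<^sup>2 * (2 * pi * \<i> * circlepath 0 r t)))"
    proof (intro continuous_intros integral_continuous_on_param)
      have m: "continuous_on (ball x0 r \<times> cbox 0 1) (\<lambda>p. fst p + circlepath 0 r (snd p) *s axis i 1)"
        by (intro continuous_intros bounded_linear.continuous_on[OF bounded_linear_scale_axis])
      have "continuous_on (ball x0 r \<times> cbox 0 1) (\<lambda>p. f (fst p + circlepath 0 r (snd p) *s axis i 1))"
        by (rule continuous_on_compose2[OF mv_holomorphic_imp_continuous_on[OF assms] m])
          (use inW r norm_circlepath_0[of r] in auto)
      then have "continuous_on (ball x0 r \<times> cbox 0 1) (\<lambda>p. f (fst p + circlepath 0 r (snd p) *s axis i 1)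
          / (circlepath 0 r (snd p))\<^sup>2 * (2 * pi * \<i> * circlepath 0 r (snd p)))"
        using norm_circlepath_0[OF r] r by (intro continuous_intros) (auto, metis less_irrefl norm_zero)
      then show "continuous_on (ball x0 r \<times> cbox 0 1) (\<lambda>(x, t). f (x + circlepath 0 r t *s axis i 1)
          / (circlepath 0 r t)\<^sup>2 * (2 * pi * \<i> * circlepath 0 r t))"
        by (simp add: case_prod_beta)
    qed
    then have "continuous_on (ball x0 r) (partial_at i f)"
      by (rule continuous_on_eq) (simp add: eq)
    then show ?thesis
      using r by (simp add: continuous_on_eq_continuous_at)
  qed
  then show ?thesis
    by (simp add: continuous_at_imp_continuous_on)
qed

section \<open>Extension of bounded holomorphic functions across coordinate hyperplanes\<close>

definition set_coord :: "'k \<Rightarrow> complex \<Rightarrow> complex ^ 'k::finite \<Rightarrow> complex ^ 'k" where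
  "set_coord b c q = (q - (q $ b) *s axis b 1) + c *s axis b 1"

lemma set_coord_nth: "set_coord b c q $ i = (if i = b then c else q $ i)"
  by (simp add: set_coord_def axis_def)

lemma set_coord_self: "set_coord b (q $ b) q = q"
  by (simp add: Finite_Cartesian_Product.vec_eq_iff set_coord_nth)

lemma dist_set_coord: "dist (set_coord b c q) q = norm (c - q $ b)"
proof -
  have "set_coord b c q - q = (c - q $ b) *s axis b 1"
    by (simp add: Finite_Cartesian_Product.vec_eq_iff set_coord_nth axis_def)
  then show ?thesis
    by (simp only: dist_norm norm_scale_axis)
qed

text \<open>\<open>set_coord\<close> is written as an affine map rather than by cases, so that its
  derivative, which drops the component b, can be read off.\<close>

lemma set_coord_has_derivative:
  "(set_coord b c has_derivative (\<lambda>v. v - (v $ b) *s axis b 1)) (at q within N)"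
proof -
  have "((\<lambda>q. (q $ b) *s axis b (1::complex)) has_derivative (\<lambda>v. (v $ b) *s axis b 1)) (at q within N)"
    using bounded_linear_compose[OF bounded_linear_scale_axis bounded_linear_vec_nth]
    by (rule bounded_linear_imp_has_derivative)
  then show ?thesis
    unfolding set_coord_def[abs_def] by (auto intro!: derivative_eq_intros)
qed

text \<open>The extension is given by Cauchy's formula in the coordinate \<open>b\<close>.\<close>

lemma riemann_extension_local:
  fixes f :: "complex ^ 'k::finite \<Rightarrow> complex"
  assumes hol: "mv_holomorphic_on f (W - {x. x $ b = 0})" and e: "e > 0" "ball x0 e \<subseteq> W"
    and K: "\<And>y. y \<in> ball x0 e \<Longrightarrow> y $ b \<noteq> 0 \<Longrightarrow> norm (f y) \<le> K" and x0: "x0 $ b = 0"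
  obtains d G where "d > 0" "mv_holomorphic_on G (ball x0 d)"
    "\<And>y. y \<in> ball x0 d \<Longrightarrow> y $ b \<noteq> 0 \<Longrightarrow> G y = f y"
proof -
  \<comment> \<open>The circle of integration has radius r = e/2, the new domain radius d = e/8.
    Slices are considered on the larger disc of radius 5e/8: replacing a coordinate of modulus below
    e/8 by one below 5e/8 moves a point by less than 6e/8, so it stays within 7e/8 of x0.\<close>
  define r where "r = e / 2"
  define d where "d = e / 8"
  have rd: "r > 0" "d > 0" "d < r"
    using e by (auto simp: r_def d_def)
  define \<gamma> where "\<gamma> = circlepath 0 r"
  have \<gamma>: "norm (\<gamma> t) = r" "\<gamma> t \<noteq> 0" for t
    using norm_circlepath_0[of r t] rd by (auto simp: \<gamma>_def)
  have \<gamma>_cont [continuous_intros]: "continuous_on S g \<Longrightarrow> continuous_on S (\<lambda>x. \<gamma> (g x))"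
    for S :: "'z::topological_space set" and g
    unfolding \<gamma>_def by (rule continuous_on_circlepath)
  let ?W = "W - {x. x $ b = 0}"
  have qb: "norm (q $ b) < d" if "q \<in> ball x0 d" for q
  proof -
    have "norm (q $ b) \<le> norm (q - x0)"
      using x0 Finite_Cartesian_Product.norm_nth_le[of "q - x0" b] by simp
    then show ?thesis
      using that by (simp add: dist_norm norm_minus_commute)
  qed
  have in_ball: "set_coord b c q \<in> ball x0 e" if "q \<in> ball x0 d" "norm c < 5 / 8 * e" for c q
  proof -
    have "norm (c - q $ b) \<le> norm c + norm (q $ b)"
      by (rule norm_triangle_ineq4)
    then have "dist (set_coord b c q) q < 6 / 8 * e"
      using that qb[OF that(1)] by (simp add: dist_set_coord d_def)
    moreover have "dist x0 q < e / 8"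
      using that(1) by (simp add: d_def)
    ultimately show ?thesis
      using e(1) unfolding mem_ball by metric
  qed
  have in_W: "set_coord b c q \<in> ?W" if "q \<in> ball x0 d" "norm c < 5 / 8 * e" "c \<noteq> 0" for c q
    using in_ball[OF that(1,2)] that(3) e(2) by (auto simp: set_coord_nth)
  have \<gamma>W: "set_coord b (\<gamma> t) q \<in> ?W" if "q \<in> ball x0 d" for t q
    using that e by (intro in_W) (auto simp: \<gamma> r_def)
  have \<gamma>q: "\<gamma> t - q $ b \<noteq> 0" if "q \<in> ball x0 d" for t q
    using qb[OF that] \<gamma>(1)[of t] rd by auto
  have cd: "\<And>x. x \<in> ?W \<Longrightarrow> cdiff_at f x"
    using hol by (auto simp: mv_holomorphic_on_iff)
  \<comment> \<open>This is the integrand of Cauchy's formula after parametrisation: dc = 2 pi i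
    \<gamma> dt cancels the constant 1/(2 pi i) and leaves the factor \<gamma> t.\<close>
  define h where "h q t = f (set_coord b (\<gamma> t) q) * (\<gamma> t / (\<gamma> t - q $ b))" for q t
  define G where "G q = integral (cbox 0 1) (h q)" for q
  \<comment> \<open>The derivative in q by the product rule: the first summand differentiates the
    kernel, the second the values of f, where direction b contributes nothing because the circle has
    replaced that coordinate.\<close>
  define h' where "h' q t v =
      f (set_coord b (\<gamma> t) q) * (\<gamma> t / (\<gamma> t - q $ b)\<^sup>2 * v $ b)
      + (\<Sum>i\<in>UNIV. (v - (v $ b) *s axis b 1) $ i * partial_at i f (set_coord b (\<gamma> t) q))
        * (\<gamma> t / (\<gamma> t - q $ b))" for q t v
  have deriv: "((\<lambda>q. h q t) has_derivative h' q t) (at q within ball x0 d)" if "q \<in> ball x0 d" for q t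
  proof -
    have 1: "((\<lambda>q. f (set_coord b (\<gamma> t) q)) has_derivative
      (\<lambda>v. \<Sum>i\<in>UNIV. (v - (v $ b) *s axis b 1) $ i * partial_at i f (set_coord b (\<gamma> t) q))) (at q within ball x0 d)"
      by (rule has_derivative_compose[OF set_coord_has_derivative cdiff_at_has_derivative])
        (rule cd[OF \<gamma>W[OF that]])
    have nth: "((\<lambda>q. q $ b) has_derivative (\<lambda>v. v $ b)) (at q within ball x0 d)"
      by (intro bounded_linear_imp_has_derivative bounded_linear_vec_nth)
    have 2: "((\<lambda>q. \<gamma> t / (\<gamma> t - q $ b)) has_derivative (\<lambda>v. \<gamma> t / (\<gamma> t - q $ b)\<^sup>2 * v $ b)) (at q within ball x0 d)"
      using \<gamma>q[OF that, of t]
      by (auto intro!: derivative_eq_intros nth simp: power2_eq_square divide_simps)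
    show ?thesis
      unfolding h_def[abs_def] h'_def[abs_def]
      by (rule has_derivative_mult[OF 1 2])
  qed
  have bl: "bounded_linear (h' q t)" if "q \<in> ball x0 d" for q t
    using deriv[OF that] by (rule has_derivative_bounded_linear)
  have mcont: "continuous_on (ball x0 d \<times> cbox 0 1) (\<lambda>p. set_coord b (\<gamma> (snd p)) (fst p))"
    unfolding set_coord_def
    by (intro continuous_intros bounded_linear.continuous_on[OF bounded_linear_scale_axis]
        bounded_linear.continuous_on[OF bounded_linear_vec_nth])
  have fcont: "continuous_on (ball x0 d \<times> cbox 0 1) (\<lambda>p. f (set_coord b (\<gamma> (snd p)) (fst p)))"
    by (rule continuous_on_compose2[OF mv_holomorphic_imp_continuous_on[OF hol] mcont]) (use \<gamma>W in auto)
  have pcont: "continuous_on (ball x0 d \<times> cbox 0 1) (\<lambda>p. partial_at i f (set_coord b (\<gamma> (snd p)) (fst p)))" for i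
    by (rule continuous_on_compose2[OF mv_holomorphic_continuous_partial[OF hol] mcont]) (use \<gamma>W in auto)
  have h'cont: "continuous_on (ball x0 d \<times> cbox 0 1) (\<lambda>p. h' (fst p) (snd p) v)" for v
    unfolding h'_def
    by (intro continuous_intros fcont pcont bounded_linear.continuous_on[OF bounded_linear_vec_nth])
      (use \<gamma>q in auto)
  have hcont: "continuous_on (ball x0 d \<times> cbox 0 1) (\<lambda>p. h (fst p) (snd p))"
    unfolding h_def
    by (intro continuous_intros fcont bounded_linear.continuous_on[OF bounded_linear_vec_nth])
      (use \<gamma>q in auto)
  have slice: "continuous_on (cbox 0 1) (\<lambda>t. F q t)"
    if "q \<in> ball x0 d" "continuous_on (ball x0 d \<times> cbox 0 1) (\<lambda>p. F (fst p) (snd p))"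
    for q and F :: "complex ^ 'k \<Rightarrow> real \<Rightarrow> complex"
  proof -
    have "continuous_on (cbox 0 1) (\<lambda>t. F (fst (q, t)) (snd (q, t)))"
      by (rule continuous_on_compose2[OF that(2)]) (use that(1) in \<open>auto intro!: continuous_intros\<close>)
    then show ?thesis by simp
  qed
  \<comment> \<open>The Leibniz rule for parameter integrals takes the derivative as a continuous
    family of bounded linear functions.\<close>
  define B where "B q t = Blinfun (h' q t)" for q t
  have B: "blinfun_apply (B q t) = h' q t" if "q \<in> ball x0 d" for q t
    unfolding B_def by (rule bounded_linear_Blinfun_apply[OF bl[OF that]])
  have Bcont: "continuous_on (ball x0 d \<times> cbox 0 1) (\<lambda>(q, t). B q t)"
  proof (rule continuous_on_blinfun_componentwise)
    fix v :: "complex ^ 'k"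
    show "continuous_on (ball x0 d \<times> cbox 0 1) (\<lambda>p. blinfun_apply (case p of (q, t) \<Rightarrow> B q t) v)"
      using h'cont[of v] by (rule continuous_on_eq) (auto simp: B)
  qed
  have "cdiff_at G q" if q: "q \<in> ball x0 d" for q
  proof -
    have Bint: "B q integrable_on cbox 0 1"
    proof (rule integrable_continuous)
      have "continuous_on (cbox 0 1) (\<lambda>t. (\<lambda>(q, t). B q t) (q, t))"
        by (rule continuous_on_compose2[OF Bcont]) (use q in \<open>auto intro!: continuous_intros\<close>)
      then show "continuous_on (cbox 0 1) (B q)" by simp
    qed
    have "(G has_derivative blinfun_apply (integral (cbox 0 1) (B q))) (at q within ball x0 d)"
      unfolding G_def[abs_def]
    proof (rule leibniz_rule)
      show "((\<lambda>x. h x t) has_derivative blinfun_apply (B x t)) (at x within ball x0 d)"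
        if "x \<in> ball x0 d" for x t
        using deriv[OF that] by (simp add: B[OF that])
      show "h x integrable_on cbox 0 1" if "x \<in> ball x0 d" for x
        by (rule integrable_continuous) (rule slice[OF that hcont])
    qed (use q Bcont in simp_all)
    then have "(G has_derivative blinfun_apply (integral (cbox 0 1) (B q))) (at q)"
      by (simp only: at_within_open[OF q open_ball])
    moreover have "blinfun_apply (integral (cbox 0 1) (B q)) (c *s v) = c * blinfun_apply (integral (cbox 0 1) (B q)) v"
      for c v
    proof -
      have "h' q t (c *s v) = c * h' q t v" for t
        by (simp add: h'_def algebra_simps sum_distrib_left)
      then have "integral (cbox 0 1) (\<lambda>t. h' q t (c *s v)) = c * integral (cbox 0 1) (\<lambda>t. h' q t v)"
        by simp
      then show ?thesis
        by (simp only: blinfun_apply_integral[OF Bint] B[OF q])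
    qed
    ultimately show ?thesis
      unfolding cdiff_at_def by blast
  qed
  then have "mv_holomorphic_on G (ball x0 d)"
    by (simp add: mv_holomorphic_on_iff)
  \<comment> \<open>For fixed q the slice meets the hyperplane only at c = 0, and f is bounded on
    the punctured disc. The classical Riemann theorem gives a holomorphic g on the whole disc; it
    agrees with f on the circle, so its Cauchy formula is G q.\<close>
  moreover have "G q = f q" if q: "q \<in> ball x0 d" "q $ b \<noteq> 0" for q
  proof -
    let ?g = "\<lambda>c. f (set_coord b c q)"
    have d: "(?g has_field_derivative partial_at b f (set_coord b c q)) (at c)"
      if "norm c < 5 / 8 * e" "c \<noteq> 0" for c
      using slice_has_field_derivative[of f "q - (q $ b) *s axis b 1" c b] cd[OF in_W[OF q(1) that]]
      by (simp add: set_coord_def)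
    have "?g holomorphic_on ball 0 (5 / 8 * e) - {0}"
      unfolding holomorphic_on_def field_differentiable_def
    proof
      fix c :: complex assume "c \<in> ball 0 (5 / 8 * e) - {0}"
      then have "(?g has_field_derivative partial_at b f (set_coord b c q)) (at c)"
        by (intro d) auto
      then show "\<exists>f'. (?g has_field_derivative f') (at c within ball 0 (5 / 8 * e) - {0})"
        by (blast intro: has_field_derivative_at_within)
    qed
    moreover have "eventually (\<lambda>c. norm (?g c) \<le> K) (at 0)"
    proof -
      have "eventually (\<lambda>c. c \<in> ball 0 (5 / 8 * e) - {0}) (at (0::complex))"
        using e(1) by (intro eventually_at_in_open) auto
      then show ?thesis
        by eventually_elim (use in_ball[OF q(1)] in \<open>auto intro!: K simp: set_coord_nth\<close>)
    qed
    ultimately obtain g where g: "g holomorphic_on ball 0 (5 / 8 * e)"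
      "\<And>c. c \<in> ball 0 (5 / 8 * e) - {0} \<Longrightarrow> g c = ?g c"
      using holomorphic_on_extend_bounded[of ?g "ball 0 (5 / 8 * e)" 0] e(1) by auto
    have sub: "cball 0 r \<subseteq> ball (0::complex) (5 / 8 * e)"
      using e(1) by (auto simp: r_def)
    have "((\<lambda>u. g u / (u - q $ b)) has_contour_integral (2 * of_real pi * \<i> * g (q $ b))) (circlepath 0 r)"
    proof (rule Cauchy_integral_circlepath)
      show "continuous_on (cball 0 r) g"
        by (rule holomorphic_on_imp_continuous_on[OF holomorphic_on_subset[OF g(1) sub]])
      show "g holomorphic_on ball 0 r"
        by (rule holomorphic_on_subset[OF g(1)]) (use sub ball_subset_cball in blast)
      show "norm (q $ b - 0) < r"
        using qb[OF q(1)] rd by simp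
    qed
    then have "2 * of_real pi * \<i> * g (q $ b) = contour_integral (circlepath 0 r) (\<lambda>u. g u / (u - q $ b))"
      by (simp add: contour_integral_unique)
    also have "\<dots> = integral {0..1} (\<lambda>t. (2 * pi * \<i>) * h q t)"
      unfolding contour_integral_circlepath_0 unfolding \<gamma>_def[symmetric]
    proof (rule integral_cong)
      fix t
      have "g (\<gamma> t) = ?g (\<gamma> t)"
        using e(1) by (intro g(2)) (auto simp: \<gamma> r_def)
      then show "g (\<gamma> t) / (\<gamma> t - q $ b) * (complex_of_real (2 * pi) * \<i> * \<gamma> t) = (2 * pi * \<i>) * h q t"
        by (simp add: h_def)
    qed
    also have "\<dots> = (2 * pi * \<i>) * G q"
      unfolding G_def cbox_interval by (rule integral_mult_right)
    finally have "g (q $ b) = G q"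
      by simp
    moreover have "g (q $ b) = f q"
      using qb[OF q(1)] q(2) e(1) by (subst g(2)) (auto simp: set_coord_self d_def)
    ultimately show ?thesis by simp
  qed
  ultimately show thesis
    using that rd(2) by blast
qed

text \<open>Makes limits along the complement of the hyperplane unique, also at points on the
  hyperplane.\<close>

lemma hyperplane_complement_accumulates:
  fixes x :: "complex ^ 'k::finite"
  shows "at x within {y. y $ b \<noteq> 0} \<noteq> bot"
  unfolding trivial_limit_within not_not
proof (subst islimpt_approachable, intro allI impI)
  fix e :: real assume e: "e > 0"
  \<comment> \<open>The shift by e/2 is replaced by e/3 in the one case where it would land on
    0.\<close>
  define c where "c = x $ b + (if x $ b = - of_real (e / 2) then of_real (e / 3) else of_real (e / 2))"
  have "c \<noteq> x $ b"
    using e by (simp add: c_def)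
  moreover have "c \<noteq> 0"
  proof (cases "x $ b = - of_real (e / 2)")
    case True
    then have "c = of_real (e / 3 - e / 2)"
      by (simp add: c_def)
    also have "\<dots> \<noteq> 0"
      using e by (subst of_real_eq_0_iff) simp
    finally show ?thesis .
  qed (simp add: c_def eq_neg_iff_add_eq_0)
  moreover have "norm (c - x $ b) < e"
    using e by (simp add: c_def norm_divide)
  ultimately show "\<exists>x'\<in>{y. y $ b \<noteq> 0}. x' \<noteq> x \<and> dist x' x < e"
    by (intro bexI[of _ "set_coord b c x"]) (auto simp: dist_set_coord set_coord_nth Finite_Cartesian_Product.vec_eq_iff)
qed

text \<open>On the hyperplane the extension is defined as a limit of f. This fixes one global
  function, so the local extensions by Cauchy integrals agree with it automatically and need not be
  glued.\<close>

lemma riemann_extension_hyperplane: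
  fixes f :: "complex ^ 'k::finite \<Rightarrow> complex"
  assumes W: "open W" and hol: "mv_holomorphic_on f (W - {x. x $ b = 0})"
    and bd: "\<And>x. x \<in> W \<Longrightarrow> \<exists>e>0. \<exists>K. \<forall>y\<in>ball x e. y \<in> W \<and> y $ b \<noteq> 0 \<longrightarrow> norm (f y) \<le> K"
  shows "\<exists>F. mv_holomorphic_on F W \<and> (\<forall>x\<in>W - {x. x $ b = 0}. F x = f x)"
proof -
  let ?H = "{x. x $ b = 0}"
  define F where "F x = (if x $ b = 0 then Lim (at x within {y. y $ b \<noteq> 0}) f else f x)" for x
  have "cdiff_at F x" if x: "x \<in> W" for x
  proof (cases "x $ b = 0")
    case False
    then have "cdiff_at f x" and "open (W - ?H)"
      using hol x by (auto simp: mv_holomorphic_on_iff)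
    then show ?thesis
      by (rule cdiff_at_transform) (use x False in \<open>auto simp: F_def\<close>)
  next
    case True
    obtain e1 K where e1: "e1 > 0" "\<And>y. y \<in> ball x e1 \<Longrightarrow> y \<in> W \<Longrightarrow> y $ b \<noteq> 0 \<Longrightarrow> norm (f y) \<le> K"
      using bd[OF x] by blast
    obtain e2 where e2: "e2 > 0" "ball x e2 \<subseteq> W"
      by (rule openE[OF W x])
    obtain d G where G: "d > 0" "mv_holomorphic_on G (ball x d)"
      "\<And>y. y \<in> ball x d \<Longrightarrow> y $ b \<noteq> 0 \<Longrightarrow> G y = f y"
      by (rule riemann_extension_local[OF hol, of "min e1 e2" x K]) (use e1 e2 True in auto)
    have "F y = G y" if y: "y \<in> ball x d" for y
    proof (cases "y $ b = 0")
      case True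
      have "(G \<longlongrightarrow> G y) (at y within {y. y $ b \<noteq> 0})"
      proof -
        have "isCont G y"
          using G(2) y by (auto simp: mv_holomorphic_on_iff intro: cdiff_at_imp_continuous)
        then show ?thesis
          by (auto simp: isCont_def intro: tendsto_within_subset)
      qed
      moreover have "eventually (\<lambda>u. G u = f u) (at y within {y. y $ b \<noteq> 0})"
        using eventually_at_in_open'[of "ball x d" y] y
        unfolding eventually_at_filter by (auto elim!: eventually_mono simp: G(3))
      ultimately have "(f \<longlongrightarrow> G y) (at y within {y. y $ b \<noteq> 0})"
        by (rule Lim_transform_eventually)
      then have "Lim (at y within {y. y $ b \<noteq> 0}) f = G y"
        by (rule tendsto_Lim[OF hyperplane_complement_accumulates])
      then show ?thesis
        using True by (simp add: F_def)
    qed (use G(3) y in \<open>simp add: F_def\<close>)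
    moreover have "cdiff_at G x"
      using G(1,2) by (simp add: mv_holomorphic_on_iff)
    ultimately show ?thesis
      using G(1) by (intro cdiff_at_transform[of G x "ball x d" F]) auto
  qed
  then show ?thesis
    using W by (intro exI[of _ F]) (auto simp: mv_holomorphic_on_iff F_def)
qed

lemma closed_hyperplane_coord: "closed {x :: complex ^ 'k::finite. x $ b = 0}"
  by (intro closed_Collect_eq continuous_intros)

text \<open>With the other hyperplanes still removed, f extends across the hyperplane b. The local
  bounds are required at every point of U, including the crossings, and they pass to the extension
  by continuity, so the induction hypothesis applies to it.\<close>

lemma riemann_extension_hyperplanes:
  fixes f :: "complex ^ 'k::finite \<Rightarrow> complex"
  assumes "finite B" "open U"
    and "mv_holomorphic_on f (U - (\<Union>b\<in>B. {x. x $ b = 0}))"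
    and "\<And>x. x \<in> U \<Longrightarrow> \<exists>e>0. \<exists>K. \<forall>y\<in>ball x e. y \<in> U - (\<Union>b\<in>B. {x. x $ b = 0}) \<longrightarrow> norm (f y) \<le> K"
  shows "\<exists>F. mv_holomorphic_on F U \<and> (\<forall>x\<in>U - (\<Union>b\<in>B. {x. x $ b = 0}). F x = f x)"
  using assms(1,3,4)
proof (induction B arbitrary: f)
  case empty
  then show ?case by auto
next
  case (insert b B f)
  define W where "W = U - (\<Union>b\<in>B. {x. x $ b = 0})"
  have W: "open W"
    unfolding W_def using assms(2) insert.hyps(1)
    by (intro open_Diff closed_UN ballI closed_hyperplane_coord)
  have split: "U - (\<Union>b\<in>insert b B. {x. x $ b = 0}) = W - {x. x $ b = 0}"
    by (auto simp: W_def)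
  have bd: "\<exists>e>0. \<exists>K. \<forall>y\<in>ball x e. y \<in> W \<and> y $ b \<noteq> 0 \<longrightarrow> norm (f y) \<le> K" if "x \<in> U" for x
    using insert.prems(2)[OF that] unfolding split by auto
  have "\<exists>F. mv_holomorphic_on F W \<and> (\<forall>x\<in>W - {x. x $ b = 0}. F x = f x)"
    by (rule riemann_extension_hyperplane[OF W])
      (use insert.prems(1) bd in \<open>auto simp only: split\<close>, simp add: W_def bd)
  then obtain F where F: "mv_holomorphic_on F W" "\<And>x. x \<in> W \<Longrightarrow> x $ b \<noteq> 0 \<Longrightarrow> F x = f x"
    by auto
  have "\<exists>F'. mv_holomorphic_on F' U \<and> (\<forall>x\<in>U - (\<Union>b\<in>B. {x. x $ b = 0}). F' x = F x)"
  proof (rule insert.IH)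
    show "mv_holomorphic_on F (U - (\<Union>b\<in>B. {x. x $ b = 0}))"
      using F(1) by (simp add: W_def)
    fix x assume "x \<in> U"
    then obtain e K where e: "e > 0" "\<And>y. y \<in> ball x e \<Longrightarrow> y \<in> W \<Longrightarrow> y $ b \<noteq> 0 \<Longrightarrow> norm (f y) \<le> K"
      using bd by blast
    \<comment> \<open>At points of the hyperplane the bound is the limit of the bounds on its dense
      complement.\<close>
    have "norm (F y) \<le> K" if y: "y \<in> ball x e" "y \<in> W" for y
    proof (rule tendsto_upperbound)
      have "isCont F y"
        using F(1) y by (auto simp: mv_holomorphic_on_iff intro: cdiff_at_imp_continuous)
      then show "((\<lambda>u. norm (F u)) \<longlongrightarrow> norm (F y)) (at y within {u. u $ b \<noteq> 0})"
        by (intro tendsto_norm) (auto simp: isCont_def intro: tendsto_within_subset)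
      have "eventually (\<lambda>u. u \<in> ball x e \<inter> W) (nhds y)"
        using y W by (intro eventually_nhds_in_open) auto
      then show "eventually (\<lambda>u. norm (F u) \<le> K) (at y within {u. u $ b \<noteq> 0})"
        unfolding eventually_at_filter by eventually_elim (use e F(2) in auto)
      show "at y within {u. u $ b \<noteq> 0} \<noteq> bot"
        by (rule hyperplane_complement_accumulates)
    qed
    then show "\<exists>e>0. \<exists>K. \<forall>y\<in>ball x e. y \<in> U - (\<Union>b\<in>B. {x. x $ b = 0}) \<longrightarrow> norm (F y) \<le> K"
      using e(1) unfolding W_def by blast
  qed
  then obtain F' where "mv_holomorphic_on F' U" "\<And>x. x \<in> W \<Longrightarrow> F' x = F x"
    unfolding W_def by blast
  then show ?case
    unfolding split using F(2) by (intro exI[of _ F']) auto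
qed

section \<open>Flat sections and parallel transport\<close>

lemma partial_at_eqI: "(f has_derivative D) (at x) \<Longrightarrow> partial_at i f x = D (axis i 1)"
  unfolding partial_at_def by (simp flip: frechet_derivative_at)

lemma partial_at_cmult:
  assumes "cdiff_at f x"
  shows "partial_at i (\<lambda>x. c * f x) x = c * partial_at i f x"
proof -
  obtain D where D: "(f has_derivative D) (at x)"
    using assms unfolding cdiff_at_def by blast
  have "((\<lambda>x. c * f x) has_derivative (\<lambda>v. c * D v)) (at x)"
    using D by (auto intro!: derivative_eq_intros)
  then show ?thesis
    using D by (simp add: partial_at_eqI)
qed

section \<open>Coordinates, the involution \<open>iota\<close> and segments in the z-plane\<close>

lemma pt_nth [simp]: "pt z q $ None = z" "pt z q $ Some b = q $ b"
  by (simp_all add: pt_def)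

lemma iota_nth [simp]: "iota x $ None = - (x $ None)" "iota x $ Some b = x $ Some b"
  by (simp_all add: iota_def)

lemma vec_option_eqI: "x $ None = y $ None \<Longrightarrow> (\<And>b. x $ Some b = y $ Some b) \<Longrightarrow> x = y"
  unfolding Finite_Cartesian_Product.vec_eq_iff by (metis option.exhaust)

lemma iota_iota [simp]: "iota (iota x) = x"
  by (rule vec_option_eqI) simp_all

lemma iota_pt: "iota (pt z q) = pt (- z) q"
  by (rule vec_option_eqI) simp_all

lemma continuous_iota: "continuous_on UNIV iota"
  unfolding iota_def
proof (rule continuous_on_vec_lambda)
  fix i :: "'a option"
  show "continuous_on UNIV (\<lambda>x. case i of None \<Rightarrow> - (x $ None) | Some b \<Rightarrow> (x $ Some b :: complex))"
    by (cases i) (auto intro!: continuous_intros)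
qed

lemma iota_image: "iota ` W = iota -` W"
  by (auto simp: image_iff) (metis iota_iota)

lemma open_iota_image: "open W \<Longrightarrow> open (iota ` W)"
  unfolding iota_image by (rule open_vimage[OF _ continuous_iota])

lemma iota_Cstar_times: "x \<in> Cstar_times S \<Longrightarrow> iota x \<in> Cstar_times S"
  unfolding Cstar_times_def by (force simp: iota_pt)

lemma pt_segment: "(\<lambda>t. pt t q) ` closed_segment z w = closed_segment (pt z q) (pt w q)"
proof -
  have "pt ((1 - u) *\<^sub>R z + u *\<^sub>R w) q = (1 - u) *\<^sub>R pt z q + u *\<^sub>R pt w q" for u
    by (rule vec_option_eqI) (simp_all add: algebra_simps)
  then show ?thesis
    by (simp only: closed_segment_image_interval image_image)
qed

text \<open>The inverted point 1/cnj z is z divided by the square of its modulus, a positive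
  multiple of z. The segment thus lies on a ray from the origin without reaching it, and transport
  along it stays where the connection has no pole.\<close>

lemma closed_segment_inversion_nonzero:
  assumes "z \<noteq> 0" "t \<in> closed_segment z (1 / cnj z)"
  shows "t \<noteq> 0"
proof -
  obtain u where u: "0 \<le> u" "u \<le> 1" "t = (1 - u) *\<^sub>R z + u *\<^sub>R (1 / cnj z)"
    using assms(2) by (auto simp: closed_segment_def)
  have "1 / cnj z = (1 / (norm z)\<^sup>2) *\<^sub>R z"
    using assms(1) complex_norm_square[of z]
    by (simp add: scaleR_conv_of_real divide_simps)
  then have "t = ((1 - u) + u / (norm z)\<^sup>2) *\<^sub>R z"
    by (simp add: u(3) algebra_simps)
  moreover have "(1 - u) + u / (norm z)\<^sup>2 > 0"
    using u(1,2) assms(1) by (cases "u = 1") (auto intro!: add_pos_nonneg)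
  ultimately show ?thesis
    using assms(1) by simp
qed

text \<open>The condition that \<open>flat_section\<close> imposes at one point of a chart, for a
  fixed presentation by functions f and operators A; v is the value of the section there.\<close>

definition flat_at ::
  "'r::finite oper set \<Rightarrow> nat \<Rightarrow> (nat \<Rightarrow> complex ^ 'r option \<Rightarrow> complex) \<Rightarrow> (nat \<Rightarrow> 'r oper) \<Rightarrow>
   complex ^ 'r option \<Rightarrow> 'r oper set \<Rightarrow> bool" where
  "flat_at I k f A y v \<longleftrightarrow>
     v = lincomb (fibre I y) k (\<lambda>j. f j y) (\<lambda>j. cls I y (A j)) \<and>
     (\<forall>b. lincomb (fibre I y) k (\<lambda>j. y $ None * y $ Some b * partial_at (Some b) (f j) y) (\<lambda>j. cls I y (A j))
            \<oplus>\<^bsub>fibre I y\<^esub>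
          lincomb (fibre I y) k (\<lambda>j. f j y) (\<lambda>j. cls I y (euler b \<circ> A j)) = \<zero>\<^bsub>fibre I y\<^esub>) \<and>
     lincomb (fibre I y) k (\<lambda>j. (y $ None)\<^sup>2 * partial_at None (f j) y) (\<lambda>j. cls I y (A j))
       \<oplus>\<^bsub>fibre I y\<^esub>
     lincomb (fibre I y) k (\<lambda>j. f j y) (\<lambda>j. cls I y (z2dz \<circ> A j)) = \<zero>\<^bsub>fibre I y\<^esub>"

lemma flat_section_iff:
  "flat_section I S W s \<longleftrightarrow> open W \<and> W \<subseteq> Cstar_times S \<and>
     (\<forall>x\<in>W. \<exists>D k f A. open D \<and> x \<in> D \<and> D \<subseteq> W \<and>
        (\<forall>j<k. mv_holomorphic_on (f j) D \<and> A j \<in> Rop) \<and> (\<forall>y\<in>D. flat_at I k f A y (s y)))"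
  unfolding flat_section_def flat_at_def ..

lemma flat_section_open: "flat_section I S W s \<Longrightarrow> open W"
  and flat_section_subset_base: "flat_section I S W s \<Longrightarrow> W \<subseteq> Cstar_times S"
  by (simp_all add: flat_section_iff)

lemma flat_section_charts:
  assumes "flat_section I S W s" "x \<in> W"
  shows "\<exists>D k f A. open D \<and> x \<in> D \<and> D \<subseteq> W \<and>
        (\<forall>j<k. mv_holomorphic_on (f j) D \<and> A j \<in> Rop) \<and> (\<forall>y\<in>D. flat_at I k f A y (s y))"
  using assms by (simp add: flat_section_iff)

lemma flat_sectionI:
  assumes "open W" "W \<subseteq> Cstar_times S"
    and "\<And>x. x \<in> W \<Longrightarrow> \<exists>D k f A. open D \<and> x \<in> D \<and> D \<subseteq> W \<and>
        (\<forall>j<k. mv_holomorphic_on (f j) D \<and> A j \<in> Rop) \<and> (\<forall>y\<in>D. flat_at I k f A y (s y))"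
  shows "flat_section I S W s"
  using assms by (simp add: flat_section_iff)

text \<open>The new section only has to agree with the old one on the smaller set, which makes the
  lemma applicable to sections defined by cases.\<close>

lemma flat_section_restrict:
  assumes "flat_section I S W s" "open W'" "W' \<subseteq> W" "\<And>y. y \<in> W' \<Longrightarrow> t y = s y"
  shows "flat_section I S W' t"
proof (rule flat_sectionI)
  fix x assume x: "x \<in> W'"
  obtain D k f A where "open D" "x \<in> D" "D \<subseteq> W"
    "\<forall>j<k. mv_holomorphic_on (f j) D \<and> A j \<in> Rop" "\<forall>y\<in>D. flat_at I k f A y (s y)"
    using flat_section_charts[OF assms(1) subsetD[OF assms(3) x]] by blast
  then show "\<exists>D k f A. open D \<and> x \<in> D \<and> D \<subseteq> W' \<and>
        (\<forall>j<k. mv_holomorphic_on (f j) D \<and> A j \<in> Rop) \<and> (\<forall>y\<in>D. flat_at I k f A y (t y))"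
    using assms(2,4) x
    by (intro exI[of _ "D \<inter> W'"] exI[of _ k] exI[of _ f] exI[of _ A])
      (auto intro: mv_holomorphic_on_subset)
qed (use assms in \<open>auto simp: flat_section_iff\<close>)

lemma flat_section_union:
  assumes "flat_section I S W s" "flat_section I S W' s"
  shows "flat_section I S (W \<union> W') s"
proof (rule flat_sectionI)
  fix x assume "x \<in> W \<union> W'"
  then obtain W0 where W0: "x \<in> W0" "W0 \<subseteq> W \<union> W'" "flat_section I S W0 s"
    using assms by auto
  obtain D k f A where "open D" "x \<in> D" "D \<subseteq> W0"
    "\<forall>j<k. mv_holomorphic_on (f j) D \<and> A j \<in> Rop" "\<forall>y\<in>D. flat_at I k f A y (s y)"
    using flat_section_charts[OF W0(3,1)] by blast
  then show "\<exists>D k f A. open D \<and> x \<in> D \<and> D \<subseteq> W \<union> W' \<and>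
        (\<forall>j<k. mv_holomorphic_on (f j) D \<and> A j \<in> Rop) \<and> (\<forall>y\<in>D. flat_at I k f A y (s y))"
    using W0(2)
    by (intro exI[of _ D] exI[of _ k] exI[of _ f] exI[of _ A]) auto
qed (use assms in \<open>auto simp: flat_section_iff\<close>)

section \<open>Linear combinations of flat sections\<close>

context op_ideal
begin

interpretation fib: cspace "fibre I x" for x
  by (rule cspace_fibre)

lemma cls_carriers:
  assumes "A \<in> Rop"
  shows "cls I y A \<in> carrier (fibre I y)" "cls I y (euler b \<circ> A) \<in> carrier (fibre I y)"
    "cls I y (z2dz \<circ> A) \<in> carrier (fibre I y)"
  by (intro cls_in_carrier Rop.intros(5) Rop.intros(2,3) assms)+

lemma flat_at_carrier: "flat_at I k f A y v \<Longrightarrow> (\<And>j. j < k \<Longrightarrow> A j \<in> Rop) \<Longrightarrow> v \<in> carrier (fibre I y)"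
  unfolding flat_at_def by (auto intro!: fib.lincomb_closed cls_in_carrier)

lemma flat_section_carrier: "flat_section I S W s \<Longrightarrow> y \<in> W \<Longrightarrow> s y \<in> carrier (fibre I y)"
  using flat_section_charts[of I S W s y] flat_at_carrier by blast

text \<open>The two presentations may use different operators, so they are concatenated; entries
  from \<open>k1\<close> on belong to the second one, with index shifted by
  \<open>k1\<close>.\<close>

lemma flat_at_add:
  fixes f1 f2 A1 A2 k1
  defines "f \<equiv> \<lambda>j. if j < k1 then f1 j else f2 (j - k1)"
    and "A \<equiv> \<lambda>j. if j < k1 then A1 j else A2 (j - k1)"
  assumes "flat_at I k1 f1 A1 y u" "flat_at I k2 f2 A2 y v"
    and A1: "\<And>j. j < k1 \<Longrightarrow> A1 j \<in> Rop" and A2: "\<And>j. j < k2 \<Longrightarrow> A2 j \<in> Rop"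
  shows "flat_at I (k1 + k2) f A y (u \<oplus>\<^bsub>fibre I y\<^esub> v)"
proof -
  have app: "lincomb (fibre I y) (k1 + k2) (\<lambda>j. C (f j)) (\<lambda>j. cls I y (T (A j))) =
      lincomb (fibre I y) k1 (\<lambda>j. C (f1 j)) (\<lambda>j. cls I y (T (A1 j))) \<oplus>\<^bsub>fibre I y\<^esub>
      lincomb (fibre I y) k2 (\<lambda>j. C (f2 j)) (\<lambda>j. cls I y (T (A2 j)))"
    if "\<And>A. A \<in> Rop \<Longrightarrow> cls I y (T A) \<in> carrier (fibre I y)" for C T
    by (rule fib.lincomb_append) (use that A1 A2 in \<open>auto simp: f_def A_def\<close>)
  have cl: "lincomb (fibre I y) k1 c (\<lambda>j. cls I y (A1 j)) \<in> carrier (fibre I y)"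
    "lincomb (fibre I y) k2 c (\<lambda>j. cls I y (A2 j)) \<in> carrier (fibre I y)"
    "lincomb (fibre I y) k1 c (\<lambda>j. cls I y (euler b \<circ> A1 j)) \<in> carrier (fibre I y)"
    "lincomb (fibre I y) k2 c (\<lambda>j. cls I y (euler b \<circ> A2 j)) \<in> carrier (fibre I y)"
    "lincomb (fibre I y) k1 c (\<lambda>j. cls I y (z2dz \<circ> A1 j)) \<in> carrier (fibre I y)"
    "lincomb (fibre I y) k2 c (\<lambda>j. cls I y (z2dz \<circ> A2 j)) \<in> carrier (fibre I y)" for c b
    by (intro fib.lincomb_closed cls_carriers A1 A2; assumption)+
  \<comment> \<open>Here p, q are the parts in which the coefficients of the two sections are
    differentiated and p', q' those in which the operator acts. The cancellation takes place within
    each section.\<close>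
  have four: "(p \<oplus>\<^bsub>fibre I y\<^esub> q) \<oplus>\<^bsub>fibre I y\<^esub> (p' \<oplus>\<^bsub>fibre I y\<^esub> q') = \<zero>\<^bsub>fibre I y\<^esub>"
    if "p \<oplus>\<^bsub>fibre I y\<^esub> p' = \<zero>\<^bsub>fibre I y\<^esub>" "q \<oplus>\<^bsub>fibre I y\<^esub> q' = \<zero>\<^bsub>fibre I y\<^esub>"
      "p \<in> carrier (fibre I y)" "p' \<in> carrier (fibre I y)" "q \<in> carrier (fibre I y)" "q' \<in> carrier (fibre I y)"
    for p p' q q'
  proof -
    have "(p \<oplus>\<^bsub>fibre I y\<^esub> q) \<oplus>\<^bsub>fibre I y\<^esub> (p' \<oplus>\<^bsub>fibre I y\<^esub> q') =
      (p \<oplus>\<^bsub>fibre I y\<^esub> p') \<oplus>\<^bsub>fibre I y\<^esub> (q \<oplus>\<^bsub>fibre I y\<^esub> q')"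
      using that(3-6) by (simp add: fib.a_ac)
    then show ?thesis
      using that(1,2) by simp
  qed
  show ?thesis
    unfolding flat_at_def
  proof (intro conjI allI)
    show "u \<oplus>\<^bsub>fibre I y\<^esub> v = lincomb (fibre I y) (k1 + k2) (\<lambda>j. f j y) (\<lambda>j. cls I y (A j))"
      using app[of "\<lambda>A. A" "\<lambda>f. f y"] assms(3,4) by (simp add: flat_at_def cls_in_carrier)
    fix b
    have 1: "lincomb (fibre I y) (k1 + k2) (\<lambda>j. y $ None * y $ Some b * partial_at (Some b) (f j) y) (\<lambda>j. cls I y (A j)) =
      lincomb (fibre I y) k1 (\<lambda>j. y $ None * y $ Some b * partial_at (Some b) (f1 j) y) (\<lambda>j. cls I y (A1 j)) \<oplus>\<^bsub>fibre I y\<^esub>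
      lincomb (fibre I y) k2 (\<lambda>j. y $ None * y $ Some b * partial_at (Some b) (f2 j) y) (\<lambda>j. cls I y (A2 j))"
      by (rule app[of "\<lambda>A. A"]) (rule cls_carriers)
    have 2: "lincomb (fibre I y) (k1 + k2) (\<lambda>j. f j y) (\<lambda>j. cls I y (euler b \<circ> A j)) =
      lincomb (fibre I y) k1 (\<lambda>j. f1 j y) (\<lambda>j. cls I y (euler b \<circ> A1 j)) \<oplus>\<^bsub>fibre I y\<^esub>
      lincomb (fibre I y) k2 (\<lambda>j. f2 j y) (\<lambda>j. cls I y (euler b \<circ> A2 j))"
      by (rule app[of "\<lambda>A. euler b \<circ> A"]) (rule cls_carriers)
    show "lincomb (fibre I y) (k1 + k2) (\<lambda>j. y $ None * y $ Some b * partial_at (Some b) (f j) y) (\<lambda>j. cls I y (A j))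
            \<oplus>\<^bsub>fibre I y\<^esub>
          lincomb (fibre I y) (k1 + k2) (\<lambda>j. f j y) (\<lambda>j. cls I y (euler b \<circ> A j)) = \<zero>\<^bsub>fibre I y\<^esub>"
      unfolding 1 2 by (rule four[OF _ _ cl(1) cl(3) cl(2) cl(4)]) (use assms(3,4) in \<open>simp_all only: flat_at_def\<close>)
  next
    have 1: "lincomb (fibre I y) (k1 + k2) (\<lambda>j. (y $ None)\<^sup>2 * partial_at None (f j) y) (\<lambda>j. cls I y (A j)) =
      lincomb (fibre I y) k1 (\<lambda>j. (y $ None)\<^sup>2 * partial_at None (f1 j) y) (\<lambda>j. cls I y (A1 j)) \<oplus>\<^bsub>fibre I y\<^esub>
      lincomb (fibre I y) k2 (\<lambda>j. (y $ None)\<^sup>2 * partial_at None (f2 j) y) (\<lambda>j. cls I y (A2 j))"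
      by (rule app[of "\<lambda>A. A"]) (rule cls_carriers)
    have 2: "lincomb (fibre I y) (k1 + k2) (\<lambda>j. f j y) (\<lambda>j. cls I y (z2dz \<circ> A j)) =
      lincomb (fibre I y) k1 (\<lambda>j. f1 j y) (\<lambda>j. cls I y (z2dz \<circ> A1 j)) \<oplus>\<^bsub>fibre I y\<^esub>
      lincomb (fibre I y) k2 (\<lambda>j. f2 j y) (\<lambda>j. cls I y (z2dz \<circ> A2 j))"
      by (rule app[of "\<lambda>A. z2dz \<circ> A"]) (rule cls_carriers)
    show "lincomb (fibre I y) (k1 + k2) (\<lambda>j. (y $ None)\<^sup>2 * partial_at None (f j) y) (\<lambda>j. cls I y (A j))
            \<oplus>\<^bsub>fibre I y\<^esub>
          lincomb (fibre I y) (k1 + k2) (\<lambda>j. f j y) (\<lambda>j. cls I y (z2dz \<circ> A j)) = \<zero>\<^bsub>fibre I y\<^esub>"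
      unfolding 1 2 by (rule four[OF _ _ cl(1) cl(5) cl(2) cl(6)]) (use assms(3,4) in \<open>simp_all only: flat_at_def\<close>)
  qed
qed

lemma flat_at_smult:
  assumes "flat_at I k f A y v" and A: "\<And>j. j < k \<Longrightarrow> A j \<in> Rop" and f: "\<And>j. j < k \<Longrightarrow> cdiff_at (f j) y"
  shows "flat_at I k (\<lambda>j y. c * f j y) A y (c \<odot>\<^bsub>fibre I y\<^esub> v)"
proof -
  have car: "\<And>j. j < k \<Longrightarrow> cls I y (A j) \<in> carrier (fibre I y)"
    "\<And>j. j < k \<Longrightarrow> cls I y (euler b \<circ> A j) \<in> carrier (fibre I y)"
    "\<And>j. j < k \<Longrightarrow> cls I y (z2dz \<circ> A j) \<in> carrier (fibre I y)" for b
    by (intro cls_carriers A; assumption)+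
  have d: "lincomb (fibre I y) k (\<lambda>j. a * partial_at i (\<lambda>y. c * f j y) y) (\<lambda>j. cls I y (A j)) =
      c \<odot>\<^bsub>fibre I y\<^esub> lincomb (fibre I y) k (\<lambda>j. a * partial_at i (f j) y) (\<lambda>j. cls I y (A j))" for a i
  proof -
    have "lincomb (fibre I y) k (\<lambda>j. a * partial_at i (\<lambda>y. c * f j y) y) (\<lambda>j. cls I y (A j)) =
      lincomb (fibre I y) k (\<lambda>j. c * (a * partial_at i (f j) y)) (\<lambda>j. cls I y (A j))"
      by (rule fib.lincomb_cong) (simp_all add: partial_at_cmult f car)
    then show ?thesis
      by (simp add: fib.lincomb_smult car)
  qed
  have z: "c \<odot>\<^bsub>fibre I y\<^esub> p \<oplus>\<^bsub>fibre I y\<^esub> c \<odot>\<^bsub>fibre I y\<^esub> q = \<zero>\<^bsub>fibre I y\<^esub>"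
    if "p \<oplus>\<^bsub>fibre I y\<^esub> q = \<zero>\<^bsub>fibre I y\<^esub>" "p \<in> carrier (fibre I y)" "q \<in> carrier (fibre I y)" for p q
    using that by (metis fib.smult_add_right fib.smult_zero_right)
  have l1: "lincomb (fibre I y) k (\<lambda>j. c * f j y) (\<lambda>j. cls I y (A j)) =
      c \<odot>\<^bsub>fibre I y\<^esub> lincomb (fibre I y) k (\<lambda>j. f j y) (\<lambda>j. cls I y (A j))"
    by (rule fib.lincomb_smult) (rule car)
  have l2: "lincomb (fibre I y) k (\<lambda>j. c * f j y) (\<lambda>j. cls I y (euler b \<circ> A j)) =
      c \<odot>\<^bsub>fibre I y\<^esub> lincomb (fibre I y) k (\<lambda>j. f j y) (\<lambda>j. cls I y (euler b \<circ> A j))" for b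
    by (rule fib.lincomb_smult) (rule car)
  have l3: "lincomb (fibre I y) k (\<lambda>j. c * f j y) (\<lambda>j. cls I y (z2dz \<circ> A j)) =
      c \<odot>\<^bsub>fibre I y\<^esub> lincomb (fibre I y) k (\<lambda>j. f j y) (\<lambda>j. cls I y (z2dz \<circ> A j))"
    by (rule fib.lincomb_smult) (rule car)
  show ?thesis
    unfolding flat_at_def d l1 l2 l3
    by (intro conjI allI z fib.lincomb_closed car; use assms(1) in \<open>simp only: flat_at_def\<close>)
qed

lemma flat_section_add:
  assumes s: "flat_section I S W s" and t: "flat_section I S W t"
  shows "flat_section I S W (\<lambda>y. s y \<oplus>\<^bsub>fibre I y\<^esub> t y)"
proof (rule flat_sectionI)
  fix x assume x: "x \<in> W"
  obtain D1 k1 f1 A1 where 1: "open D1" "x \<in> D1" "D1 \<subseteq> W"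
    "\<forall>j<k1. mv_holomorphic_on (f1 j) D1 \<and> A1 j \<in> Rop" "\<forall>y\<in>D1. flat_at I k1 f1 A1 y (s y)"
    using flat_section_charts[OF s x] by blast
  obtain D2 k2 f2 A2 where 2: "open D2" "x \<in> D2" "D2 \<subseteq> W"
    "\<forall>j<k2. mv_holomorphic_on (f2 j) D2 \<and> A2 j \<in> Rop" "\<forall>y\<in>D2. flat_at I k2 f2 A2 y (t y)"
    using flat_section_charts[OF t x] by blast
  let ?D = "D1 \<inter> D2"
  have "mv_holomorphic_on (if j < k1 then f1 j else f2 (j - k1)) ?D \<and>
      (if j < k1 then A1 j else A2 (j - k1)) \<in> Rop" if "j < k1 + k2" for j
  proof (cases "j < k1")
    case True
    then show ?thesis
      using 1 2(1) by (auto intro!: mv_holomorphic_on_subset[of "f1 j" D1 ?D])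
  next
    case False
    then have "j - k1 < k2" using that by simp
    then show ?thesis
      using 1(1) 2 False by (auto intro!: mv_holomorphic_on_subset[of "f2 (j - k1)" D2 ?D])
  qed
  moreover have "flat_at I (k1 + k2) (\<lambda>j. if j < k1 then f1 j else f2 (j - k1))
      (\<lambda>j. if j < k1 then A1 j else A2 (j - k1)) y (s y \<oplus>\<^bsub>fibre I y\<^esub> t y)" if "y \<in> ?D" for y
    using that 1(4,5) 2(4,5) by (intro flat_at_add) auto
  ultimately show "\<exists>D k f A. open D \<and> x \<in> D \<and> D \<subseteq> W \<and>
      (\<forall>j<k. mv_holomorphic_on (f j) D \<and> A j \<in> Rop) \<and>
      (\<forall>y\<in>D. flat_at I k f A y (s y \<oplus>\<^bsub>fibre I y\<^esub> t y))"
    using 1(1-3) 2(1,2)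
    by (intro exI[of _ ?D] exI[of _ "k1 + k2"] exI[of _ "\<lambda>j. if j < k1 then f1 j else f2 (j - k1)"]
        exI[of _ "\<lambda>j. if j < k1 then A1 j else A2 (j - k1)"]) auto
qed (use s in \<open>auto simp: flat_section_iff\<close>)

lemma flat_section_smult:
  assumes s: "flat_section I S W s"
  shows "flat_section I S W (\<lambda>y. c \<odot>\<^bsub>fibre I y\<^esub> s y)"
proof (rule flat_sectionI)
  fix x assume x: "x \<in> W"
  obtain D k f A where 1: "open D" "x \<in> D" "D \<subseteq> W"
    "\<forall>j<k. mv_holomorphic_on (f j) D \<and> A j \<in> Rop" "\<forall>y\<in>D. flat_at I k f A y (s y)"
    using flat_section_charts[OF s x] by blast
  have "mv_holomorphic_on (\<lambda>y. c * f j y) D" if "j < k" for j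
    using 1(4) that by (auto simp: mv_holomorphic_on_iff)
  moreover have "flat_at I k (\<lambda>j y. c * f j y) A y (c \<odot>\<^bsub>fibre I y\<^esub> s y)" if "y \<in> D" for y
    using 1(4,5) that by (intro flat_at_smult) (auto simp: mv_holomorphic_on_iff)
  ultimately show "\<exists>D k f A. open D \<and> x \<in> D \<and> D \<subseteq> W \<and>
      (\<forall>j<k. mv_holomorphic_on (f j) D \<and> A j \<in> Rop) \<and>
      (\<forall>y\<in>D. flat_at I k f A y (c \<odot>\<^bsub>fibre I y\<^esub> s y))"
    using 1(1-4)
    by (intro exI[of _ D] exI[of _ k] exI[of _ "\<lambda>j y. c * f j y"] exI[of _ A]) auto
qed (use s in \<open>auto simp: flat_section_iff\<close>)

lemma flat_section_zero:
  assumes "open W" "W \<subseteq> Cstar_times S"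
  shows "flat_section I S W (\<lambda>y. \<zero>\<^bsub>fibre I y\<^esub>)"
proof (rule flat_sectionI)
  fix x assume "x \<in> W"
  then show "\<exists>D k f A. open D \<and> x \<in> D \<and> D \<subseteq> W \<and>
      (\<forall>j<k. mv_holomorphic_on (f j) D \<and> A j \<in> Rop) \<and>
      (\<forall>y\<in>D. flat_at I k f A y \<zero>\<^bsub>fibre I y\<^esub>)"
    using assms by (intro exI[of _ W] exI[of _ "0::nat"]) (auto simp: flat_at_def)
qed (use assms in auto)

lemma flat_section_lincomb:
  assumes "open W" "W \<subseteq> Cstar_times S" "\<And>j. j < k \<Longrightarrow> flat_section I S W (s j)"
  shows "flat_section I S W (\<lambda>y. lincomb (fibre I y) k c (\<lambda>j. s j y))"
  using assms(3)
proof (induction k)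
  case 0
  then show ?case using flat_section_zero[OF assms(1,2)] by simp
next
  case (Suc k)
  have "flat_section I S W (\<lambda>y. lincomb (fibre I y) k c (\<lambda>j. s j y) \<oplus>\<^bsub>fibre I y\<^esub> c k \<odot>\<^bsub>fibre I y\<^esub> s k y)"
    using Suc by (intro flat_section_add flat_section_smult) auto
  then show ?case
    by (rule flat_section_restrict[OF _ assms(1) order_refl])
      (use Suc.prems in \<open>auto intro!: fib.lincomb_Suc flat_section_carrier\<close>)
qed

end

definition cantilinear_map :: "(complex, 'v) module \<Rightarrow> (complex, 'w) module \<Rightarrow> ('v \<Rightarrow> 'w) \<Rightarrow> bool" where
  "cantilinear_map V W T \<longleftrightarrow> (\<forall>v\<in>carrier V. T v \<in> carrier W) \<and>
     (\<forall>v\<in>carrier V. \<forall>w\<in>carrier V. T (v \<oplus>\<^bsub>V\<^esub> w) = T v \<oplus>\<^bsub>W\<^esub> T w) \<and>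
     (\<forall>c. \<forall>v\<in>carrier V. T (c \<odot>\<^bsub>V\<^esub> v) = cnj c \<odot>\<^bsub>W\<^esub> T v)"

text \<open>The data behind parallel transport and gluing: the local system yields flat frames and
  conjugation, the flat non-degenerate pairing the uniqueness of flat sections.\<close>

locale nc_variation = op_ideal I for I :: "'r::finite oper set" +
  fixes S :: "(complex ^ 'r) set" and w :: nat
    and L :: "complex ^ 'r option \<Rightarrow> 'r oper set set"
    and P :: "complex ^ 'r option \<Rightarrow> 'r oper set \<Rightarrow> 'r oper set \<Rightarrow> complex"
  assumes local_system: "real_local_system I S L"
    and pairing: "flat_pairing I S w L P"
    and nondeg: "nondegenerate_extension I S w P"
begin

sublocale fib: cspace "fibre I x" for x
  by (rule cspace_fibre)

lemma local_frame:
  assumes "x \<in> Cstar_times S"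
  shows "\<exists>W k s. x \<in> W \<and> (\<forall>j<k. flat_section I S W (s j)) \<and>
        open W \<and> W \<subseteq> Cstar_times S \<and>
        (\<forall>y\<in>W. is_basis (fibre I y) k (\<lambda>j. s j y) \<and>
           L y = {lincomb (fibre I y) k (\<lambda>j. complex_of_real (c j)) (\<lambda>j. s j y) |c. True})"
  using local_system assms unfolding real_local_system_def by (rule bspec)

text \<open>The class of A - A' pairs to 0 with everything. Since z is nonzero at x, the factor
  \<open>z ^ w\<close> can be cancelled, and non-degeneracy of the remaining function F puts A - A'
  into \<open>fibre_null\<close>.\<close>

lemma pairing_separates:
  assumes x: "x \<in> Cstar_times S" and u: "u \<in> carrier (fibre I x)" and u': "u' \<in> carrier (fibre I x)"
    and eq: "\<And>v. v \<in> carrier (fibre I (iota x)) \<Longrightarrow> P x u v = P x u' v"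
  shows "u = u'"
proof -
  obtain A A' where A: "A \<in> Rop" "u = cls I x A" "A' \<in> Rop" "u' = cls I x A'"
    using u u' by (auto simp: carrier_fibre)
  obtain F where F: "\<And>A B. A \<in> Rop \<Longrightarrow> B \<in> Rop \<Longrightarrow>
      P x (cls I x A) (cls I (iota x) B) = (x $ None) ^ w * F A B x"
    and F0: "\<And>A z q. A \<in> Rop \<Longrightarrow> q \<in> S \<Longrightarrow> (\<forall>B\<in>Rop. F A B (pt z q) = 0) \<Longrightarrow> A \<in> fibre_null I (pt z q)"
  proof -
    obtain F where F: "\<forall>A\<in>Rop.
        (\<forall>B\<in>Rop. mv_holomorphic_on (F A B) {pt z q |z q. q \<in> S} \<and>
           (\<forall>x\<in>Cstar_times S. P x (cls I x A) (cls I (iota x) B) = (x $ None) ^ w * F A B x)) \<and>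
        (\<forall>z. \<forall>q\<in>S.
           ((\<forall>B\<in>Rop. F A B (pt z q) = 0) \<longrightarrow> A \<in> fibre_null I (pt z q)) \<and>
           ((\<forall>B\<in>Rop. F B A (pt z q) = 0) \<longrightarrow> A \<in> fibre_null I (pt (- z) q)))"
      using nondeg unfolding nondegenerate_extension_def by (elim exE)
    show thesis
    proof (rule that[of F])
      fix A B :: "'r oper" assume "A \<in> Rop" "B \<in> Rop"
      then show "P x (cls I x A) (cls I (iota x) B) = (x $ None) ^ w * F A B x"
        using F x by blast
    next
      fix A :: "'r oper" and z q assume "A \<in> Rop" "q \<in> S" "\<forall>B\<in>Rop. F A B (pt z q) = 0"
      then show "A \<in> fibre_null I (pt z q)"
        using F by blast
    qed
  qed
  obtain z q where zq: "x = pt z q" "z \<noteq> 0" "q \<in> S"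
    using x by (auto simp: Cstar_times_def)
  have d: "A - A' \<in> Rop"
    using A by (intro Rop_diff)
  have lin: "linear_form (fibre I x) (\<lambda>u. P x u v)" if "v \<in> carrier (fibre I (iota x))" for v
    using pairing x that unfolding flat_pairing_def by blast
  have "F (A - A') B x = 0" if B: "B \<in> Rop" for B
  proof -
    let ?v = "cls I (iota x) B"
    have v: "?v \<in> carrier (fibre I (iota x))"
      using B by (rule cls_in_carrier)
    have "cls I x (A - A') \<oplus>\<^bsub>fibre I x\<^esub> u' = u"
      unfolding A(2,4) using d A(3) by (simp only: add_cls diff_add_cancel)
    then have "P x u ?v = P x (cls I x (A - A')) ?v + P x u' ?v"
      using lin[OF v] u' cls_in_carrier[OF d, of x] unfolding linear_form_def by metis
    then have "P x (cls I x (A - A')) ?v = 0"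
      using eq[OF v] by simp
    then show ?thesis
      using F[OF d B] zq by simp
  qed
  then have "A - A' \<in> fibre_null I x"
    using F0[OF d zq(3), of z] zq(1) by simp
  then show ?thesis
    using A by (simp add: cls_eq_iff)
qed

text \<open>Take a flat frame near \<open>iota x\<close>. Its pairings with s and with t are
  constant on a ball, so agreement at one point gives equal pairings at all points, and the frame
  spans the opposite fibre.\<close>

lemma flat_section_unique_local:
  assumes s: "flat_section I S W s" and t: "flat_section I S W t" and x: "x \<in> W"
  shows "\<exists>T. open T \<and> x \<in> T \<and> (\<forall>y\<in>T. \<forall>y'\<in>T. s y = t y \<longrightarrow> s y' = t y')"
proof -
  have xC: "x \<in> Cstar_times S"
    using flat_section_subset_base[OF s] x by blast
  obtain W0 k f where W0: "iota x \<in> W0" "\<forall>j<k. flat_section I S W0 (f j)" "open W0"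
    "\<forall>y\<in>W0. is_basis (fibre I y) k (\<lambda>j. f j y)"
    using local_frame[OF iota_Cstar_times[OF xC]] by (elim exE conjE) blast
  have "open (W \<inter> iota ` W0)" "x \<in> W \<inter> iota ` W0"
    using flat_section_open[OF s] open_iota_image[OF W0(3)] x W0(1) by (auto simp: iota_image)
  then obtain e where e: "e > 0" "ball x e \<subseteq> W \<inter> iota ` W0"
    by (rule openE)
  let ?B = "ball x e"
  have B0: "iota y \<in> W0" if "y \<in> ?B" for y
    using e(2) that by (auto simp: iota_image)
  have const: "P y (u y) (f j (iota y)) = P y' (u y') (f j (iota y'))"
    if "flat_section I S W u" "j < k" "y \<in> ?B" "y' \<in> ?B" for u j y y'
  proof -
    have "flat_section I S ?B u"
      by (rule flat_section_restrict[OF that(1)]) (use e in auto)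
    moreover have "flat_section I S (iota ` ?B) (f j)"
      by (rule flat_section_restrict[OF W0(2)[rule_format, OF that(2)]]) (use B0 open_iota_image in auto)
    moreover have "\<forall>W s t. connected W \<and> flat_section I S W s \<and> flat_section I S (iota ` W) t \<longrightarrow>
        (\<lambda>y. P y (s y) (t (iota y))) constant_on W"
      using pairing unfolding flat_pairing_def by (rule conjunct2)
    ultimately have "(\<lambda>y. P y (u y) (f j (iota y))) constant_on ?B"
      using connected_ball by blast
    then show ?thesis
      using that(3,4) unfolding constant_on_def by metis
  qed
  show ?thesis
  proof (intro exI[of _ ?B] conjI ballI impI)
    fix y y' assume y: "y \<in> ?B" and y': "y' \<in> ?B" and eq: "s y = t y"
    have y'W: "y' \<in> W" "y' \<in> Cstar_times S"
      using e(2) y' flat_section_subset_base[OF s] by auto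
    show "s y' = t y'"
    proof (rule pairing_separates[OF y'W(2)])
      show c: "s y' \<in> carrier (fibre I y')" "t y' \<in> carrier (fibre I y')"
        using flat_section_carrier s t y'W(1) by blast+
      fix v assume v: "v \<in> carrier (fibre I (iota y'))"
      have basis: "is_basis (fibre I (iota y')) k (\<lambda>j. f j (iota y'))"
        by (rule bspec[OF W0(4) B0[OF y']])
      obtain c where c': "v = lincomb (fibre I (iota y')) k c (\<lambda>j. f j (iota y'))"
        using fib.is_basis_span[OF basis v] .
      have "linear_form (fibre I (iota y')) (P y' u)" if "u \<in> carrier (fibre I y')" for u
        using pairing y'W(2) that unfolding flat_pairing_def by blast
      then have "P y' u v = (\<Sum>j<k. c j * P y' u (f j (iota y')))" if "u \<in> carrier (fibre I y')" for u
        unfolding c' using that basis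
        by (intro linear_form_lincomb[OF cspace_fibre]) (auto intro: fib.is_basis_carrier)
      moreover have "P y' (s y') (f j (iota y')) = P y' (t y') (f j (iota y'))" if "j < k" for j
        using const[OF s that y y'] const[OF t that y y'] eq by simp
      ultimately show "P y' (s y') v = P y' (t y') v"
        using c by simp
    qed
  qed (use e in auto)
qed

text \<open>The local statement transports agreement between any two nearby points in either
  direction, so the set of agreement is open and closed in K. The set K need not be open; it will be
  a segment or an intersection of convex sets.\<close>

lemma flat_section_unique:
  assumes s: "flat_section I S W s" and t: "flat_section I S W' t"
    and K: "connected K" "K \<subseteq> W" "K \<subseteq> W'" and x: "x \<in> K" "s x = t x" and y: "y \<in> K"
  shows "s y = t y"
proof -
  have o: "open (W \<inter> W')"
    using flat_section_open[OF s] flat_section_open[OF t] by (rule open_Int)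
  have s': "flat_section I S (W \<inter> W') s" and t': "flat_section I S (W \<inter> W') t"
    by (rule flat_section_restrict[OF s o] flat_section_restrict[OF t o]; simp)+
  show ?thesis
  proof (rule connected_induction_simple[OF K(1) x(1) y, where P = "\<lambda>y. s y = t y"])
    fix a assume a: "a \<in> K"
    then have "a \<in> W \<inter> W'" using K by blast
    obtain T where T: "open T" "a \<in> T" "\<forall>y\<in>T. \<forall>y'\<in>T. s y = t y \<longrightarrow> s y' = t y'"
      using flat_section_unique_local[OF s' t' \<open>a \<in> W \<inter> W'\<close>] by blast
    then show "\<exists>T. openin (top_of_set K) T \<and> a \<in> T \<and> (\<forall>x\<in>T. \<forall>y\<in>T. s x = t x \<longrightarrow> s y = t y)"
      using a by (intro exI[of _ "K \<inter> T"]) auto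
  qed (rule x(2))
qed

text \<open>Constant combinations of a local flat frame. The initial value may be prescribed at any
  point of the ball, not only at its centre, which is what continuation from a neighbouring point
  requires.\<close>

lemma flat_section_exists_local:
  assumes x: "x \<in> Cstar_times S"
  shows "\<exists>e>0. \<forall>y\<in>ball x e. \<forall>v\<in>carrier (fibre I y). \<exists>s. flat_section I S (ball x e) s \<and> s y = v"
proof -
  obtain W k f where W: "x \<in> W" "\<forall>j<k. flat_section I S W (f j)" "open W" "W \<subseteq> Cstar_times S"
    "\<forall>y\<in>W. is_basis (fibre I y) k (\<lambda>j. f j y)"
    using local_frame[OF x] by (elim exE conjE) blast
  obtain e where e: "e > 0" "ball x e \<subseteq> W"
    by (rule openE[OF W(3,1)])
  show ?thesis
  proof (intro exI[of _ e] conjI ballI e(1))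
    fix y v assume y: "y \<in> ball x e" and v: "v \<in> carrier (fibre I y)"
    have "is_basis (fibre I y) k (\<lambda>j. f j y)"
      using W(5) e(2) y by blast
    from fib.is_basis_span[OF this v] obtain c where c: "v = lincomb (fibre I y) k c (\<lambda>j. f j y)" .
    have "flat_section I S W (\<lambda>y. lincomb (fibre I y) k c (\<lambda>j. f j y))"
      by (rule flat_section_lincomb[OF W(3,4)]) (use W(2) in blast)
    then have "flat_section I S (ball x e) (\<lambda>y. lincomb (fibre I y) k c (\<lambda>j. f j y))"
      by (rule flat_section_restrict) (use e in auto)
    with c show "\<exists>s. flat_section I S (ball x e) s \<and> s y = v"
      by blast
  qed
qed

text \<open>A flat section near a segment extends along it: a convex tube around the part already
  covered meets the next ball in a convex, hence connected, set, on which the two sections agree.\<close>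

lemma flat_section_exists_segment:
  assumes seg: "closed_segment a b \<subseteq> Cstar_times S" and v: "v \<in> carrier (fibre I a)"
  shows "\<exists>W s. flat_section I S W s \<and> closed_segment a b \<subseteq> W \<and> s a = v"
proof -
  define \<gamma> where "\<gamma> = linepath a b"
  \<comment> \<open>Only existence is recorded, so neighbourhood and section may change with t. The
    conclusion Q 1 follows by induction along the connected interval.\<close>
  define Q where "Q t \<longleftrightarrow> (\<exists>W s. flat_section I S W s \<and> closed_segment a (\<gamma> t) \<subseteq> W \<and> s a = v)" for t
  have \<gamma>_in: "\<gamma> t \<in> closed_segment a b" if "t \<in> {0..1}" for t
    using that unfolding \<gamma>_def by (metis imageI linepath_image_01)
  have \<gamma>_seg: "\<gamma> t \<in> closed_segment a (\<gamma> t')" if "0 \<le> t" "t \<le> t'" for t t'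
  proof (cases "t' = 0")
    case True
    then show ?thesis using that by (simp add: \<gamma>_def)
  next
    case False
    have "\<gamma> t = (1 - t / t') *\<^sub>R a + (t / t') *\<^sub>R \<gamma> t'"
      using False by (simp add: \<gamma>_def linepath_def algebra_simps)
    then show ?thesis
      using that False unfolding closed_segment_def by auto
  qed
  have "Q 1"
  proof (rule connected_induction_simple[of "{0..1::real}" 0 1 Q])
    show "Q 0"
    proof -
      have "a \<in> Cstar_times S" using seg by auto
      then obtain e s where "e > 0" "flat_section I S (ball a e) s" "s a = v"
        using flat_section_exists_local[of a] v by (meson centre_in_ball)
      then show ?thesis
        unfolding Q_def by (intro exI[of _ "ball a e"] exI[of _ s]) (simp add: \<gamma>_def linepath_0')
    qed
    fix t0 :: real assume t0: "t0 \<in> {0..1}"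
    have "\<gamma> t0 \<in> Cstar_times S"
      using \<gamma>_in[OF t0] seg by blast
    from flat_section_exists_local[OF this] obtain e where e: "e > 0"
      "\<forall>y\<in>ball (\<gamma> t0) e. \<forall>v\<in>carrier (fibre I y). \<exists>s. flat_section I S (ball (\<gamma> t0) e) s \<and> s y = v"
      by (elim exE conjE)
    let ?B = "ball (\<gamma> t0) e"
    let ?T = "{0..1} \<inter> \<gamma> -` ?B"
    have "openin (top_of_set {0..1}) ?T"
      by (rule continuous_openin_preimage_gen)
        (auto simp: \<gamma>_def intro: continuous_on_linepath)
    moreover have "t0 \<in> ?T"
      using t0 e(1) by auto
    \<comment> \<open>Induction along a connected set asks for propagation in both directions near
      t0: backwards the covered segment only shrinks, forwards it is extended by the ball around
      \<gamma> t0.\<close>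
    moreover have "Q t'" if t: "t \<in> ?T" and t': "t' \<in> ?T" and Qt: "Q t" for t t'
    proof (cases "t' \<le> t")
      case True
      have "closed_segment a (\<gamma> t') \<subseteq> closed_segment a (\<gamma> t)"
        using \<gamma>_seg[OF _ True] t' by (simp add: subset_closed_segment)
      with Qt show ?thesis
        unfolding Q_def by blast
    next
      case False
      obtain W s where W: "flat_section I S W s" "closed_segment a (\<gamma> t) \<subseteq> W" "s a = v"
        using Qt unfolding Q_def by blast
      obtain \<epsilon> where \<epsilon>: "\<epsilon> > 0" "(\<Union>x\<in>closed_segment a (\<gamma> t). ball x \<epsilon>) \<subseteq> W"
        using compact_subset_open_imp_ball_epsilon_subset[OF compact_segment flat_section_open[OF W(1)] W(2)] .
      define N where "N = (\<Union>x\<in>closed_segment a (\<gamma> t). ball x \<epsilon>)"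
      have N: "open N" "N \<subseteq> W" "closed_segment a (\<gamma> t) \<subseteq> N"
        using \<epsilon> by (auto simp: N_def)
      \<comment> \<open>Written as the Minkowski sum of a segment and a ball, the tube is seen to be
        convex.\<close>
      have "N = {x + y |x y. x \<in> closed_segment a (\<gamma> t) \<and> y \<in> ball 0 \<epsilon>}"
      proof (intro equalityI subsetI)
        fix y assume "y \<in> N"
        then obtain x where "x \<in> closed_segment a (\<gamma> t)" "dist x y < \<epsilon>" by (auto simp: N_def)
        then show "y \<in> {x + y |x y. x \<in> closed_segment a (\<gamma> t) \<and> y \<in> ball 0 \<epsilon>}"
          by (intro CollectI exI[of _ x] exI[of _ "y - x"]) (auto simp: dist_norm norm_minus_commute)
      next
        fix y assume "y \<in> {x + y |x y. x \<in> closed_segment a (\<gamma> t) \<and> y \<in> ball 0 \<epsilon>}"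
        then obtain x u where "x \<in> closed_segment a (\<gamma> t)" "norm u < \<epsilon>" "y = x + u" by auto
        then show "y \<in> N"
          unfolding N_def by (intro UN_I[of x]) (auto simp: dist_norm)
      qed
      also have "\<dots> = (\<Union>x\<in>closed_segment a (\<gamma> t). \<Union>y\<in>ball 0 \<epsilon>. {x + y})"
        by blast
      finally have "convex N"
        using convex_sums[OF convex_closed_segment convex_ball] by (simp only:)
      then have conn: "connected (N \<inter> ?B)"
        by (intro convex_connected convex_Int convex_ball)
      have \<gamma>t: "\<gamma> t \<in> N \<inter> ?B"
        using N(3) t by auto
      obtain s' where s': "flat_section I S ?B s'" "s' (\<gamma> t) = s (\<gamma> t)"
        using e(2) \<gamma>t N(2) flat_section_carrier[OF W(1), of "\<gamma> t"] by blast
      have agree: "s y = s' y" if "y \<in> N" "y \<in> ?B" for y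
        by (rule flat_section_unique[OF W(1) s'(1) conn _ _ \<gamma>t]) (use N s'(2) that in auto)
      \<comment> \<open>On the overlap both definitions agree, so s'' is flat on N and on the ball,
        two open sets, and hence on their union.\<close>
      define s'' where "s'' y = (if y \<in> N then s y else s' y)" for y
      have "flat_section I S N s''"
        by (rule flat_section_restrict[OF W(1) N(1,2)]) (simp add: s''_def)
      moreover have "flat_section I S ?B s''"
        by (rule flat_section_restrict[OF s'(1)]) (simp_all add: s''_def agree)
      ultimately have "flat_section I S (N \<union> ?B) s''"
        by (rule flat_section_union)
      moreover have "closed_segment a (\<gamma> t') \<subseteq> N \<union> ?B"
      proof -
        have "closed_segment a (\<gamma> t') = closed_segment a (\<gamma> t) \<union> closed_segment (\<gamma> t) (\<gamma> t')"
          using \<gamma>_seg[of t t'] False t by (intro Un_closed_segment[symmetric]) auto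
        moreover have "closed_segment (\<gamma> t) (\<gamma> t') \<subseteq> ?B"
          using t t' by (intro closed_segment_subset convex_ball) auto
        ultimately show ?thesis
          using N(3) by blast
      qed
      moreover have "s'' a = v"
        using N(3) W(3) by (auto simp: s''_def)
      ultimately show ?thesis
        unfolding Q_def by blast
    qed
    ultimately show "\<exists>T. openin (top_of_set {0..1}) T \<and> t0 \<in> T \<and> (\<forall>x\<in>T. \<forall>y\<in>T. Q x \<longrightarrow> Q y)"
      by blast
  qed auto
  then show ?thesis
    by (simp add: Q_def \<gamma>_def linepath_1')
qed

section \<open>Transport, conjugation and gluing as linear and antilinear maps\<close>

lemma inversion_segment:
  assumes "z \<noteq> 0" "q \<in> S"
  shows "closed_segment (pt z q) (pt (1 / cnj z) q) \<subseteq> Cstar_times S"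
  unfolding pt_segment[symmetric] Cstar_times_def
  using closed_segment_inversion_nonzero[OF assms(1)] assms(2) by blast

text \<open>Evaluates the definite description: two flat sections near the segment with the same
  initial value agree along it, because the segment is connected.\<close>

lemma transport_eq:
  assumes "flat_section I S W s" "closed_segment (pt z q) (pt z' q) \<subseteq> W"
  shows "transport I S q z z' (s (pt z q)) = s (pt z' q)"
  unfolding transport_def pt_segment
proof (rule the_equality)
  show "\<exists>W s'. flat_section I S W s' \<and> closed_segment (pt z q) (pt z' q) \<subseteq> W \<and>
      s' (pt z q) = s (pt z q) \<and> s' (pt z' q) = s (pt z' q)"
    using assms by blast
next
  fix v' assume "\<exists>W s'. flat_section I S W s' \<and> closed_segment (pt z q) (pt z' q) \<subseteq> W \<and>
      s' (pt z q) = s (pt z q) \<and> s' (pt z' q) = v'"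
  then obtain W' s' where *: "flat_section I S W' s'" "closed_segment (pt z q) (pt z' q) \<subseteq> W'"
      "s' (pt z q) = s (pt z q)" "s' (pt z' q) = v'" by blast
  have "s' (pt z' q) = s (pt z' q)"
    by (rule flat_section_unique[OF *(1) assms(1) _ *(2) assms(2) _ *(3)]) auto
  with * show "v' = s (pt z' q)" by simp
qed

lemma transport_linear:
  assumes z: "z \<noteq> 0" and q: "q \<in> S"
  shows "clinear_map (fibre I (pt z q)) (fibre I (pt (1 / cnj z) q)) (transport I S q z (1 / cnj z))"
proof -
  let ?V = "fibre I (pt z q)" and ?V' = "fibre I (pt (1 / cnj z) q)"
  let ?T = "transport I S q z (1 / cnj z)"
  let ?K = "closed_segment (pt z q) (pt (1 / cnj z) q)"
  have ex: "\<exists>W s. flat_section I S W s \<and> ?K \<subseteq> W \<and> s (pt z q) = v" if "v \<in> carrier ?V" for v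
    by (rule flat_section_exists_segment[OF inversion_segment[OF z q] that])
  show ?thesis
    unfolding clinear_map_def
  proof (intro conjI ballI allI)
    fix u assume u: "u \<in> carrier ?V"
    obtain W s where s: "flat_section I S W s" "?K \<subseteq> W" "s (pt z q) = u"
      using ex[OF u] by blast
    have Tu: "?T u = s (pt (1 / cnj z) q)"
      using transport_eq[OF s(1,2)] s(3) by simp
    show "?T u \<in> carrier ?V'"
      unfolding Tu by (rule flat_section_carrier[OF s(1)]) (use s(2) in auto)
    show "?T (c \<odot>\<^bsub>?V\<^esub> u) = c \<odot>\<^bsub>?V'\<^esub> ?T u" for c
      using transport_eq[OF flat_section_smult[OF s(1), of c] s(2)] s(3) Tu by simp
    fix v assume v: "v \<in> carrier ?V"
    obtain W' t where t: "flat_section I S W' t" "?K \<subseteq> W'" "t (pt z q) = v"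
      using ex[OF v] by blast
    have Tv: "?T v = t (pt (1 / cnj z) q)"
      using transport_eq[OF t(1,2)] t(3) by simp
    have o: "open (W \<inter> W')"
      using flat_section_open[OF s(1)] flat_section_open[OF t(1)] by (rule open_Int)
    have "flat_section I S (W \<inter> W') s" "flat_section I S (W \<inter> W') t"
      by (rule flat_section_restrict[OF s(1) o] flat_section_restrict[OF t(1) o]; simp)+
    from transport_eq[OF flat_section_add[OF this], of z q "1 / cnj z"]
    show "?T (u \<oplus>\<^bsub>?V\<^esub> v) = ?T u \<oplus>\<^bsub>?V'\<^esub> ?T v"
      using s t Tu Tv by simp
  qed
qed

text \<open>\<open>L x\<close> is the real span of a complex basis. The decomposition v = a + ib
  with a, b real is therefore unique, and conjugation is complex conjugation of the
  coordinates.\<close>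

lemma conjugation_antilinear:
  assumes x: "x \<in> Cstar_times S"
  shows "cantilinear_map (fibre I x) (fibre I x) (conjugation I L x)"
proof -
  let ?V = "fibre I x"
  obtain k e where b: "is_basis ?V k e"
    and L: "L x = {lincomb ?V k (\<lambda>j. complex_of_real (c j)) e |c. True}"
    using local_frame[OF x] by (elim exE conjE) blast
  have e: "\<And>j. j < k \<Longrightarrow> e j \<in> carrier ?V"
    using b by (rule fib.is_basis_carrier)
  have comb: "lincomb ?V k c e \<oplus>\<^bsub>?V\<^esub> a \<odot>\<^bsub>?V\<^esub> lincomb ?V k d e = lincomb ?V k (\<lambda>j. c j + a * d j) e" for c d a
    by (simp add: fib.lincomb_add fib.lincomb_smult e)
  have conj: "conjugation I L x (lincomb ?V k c e) = lincomb ?V k (\<lambda>j. cnj (c j)) e" for c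
    unfolding conjugation_def Let_def
  proof (rule the_equality)
    let ?a = "lincomb ?V k (\<lambda>j. complex_of_real (Re (c j))) e"
    let ?b = "lincomb ?V k (\<lambda>j. complex_of_real (Im (c j))) e"
    have "lincomb ?V k c e = ?a \<oplus>\<^bsub>?V\<^esub> \<i> \<odot>\<^bsub>?V\<^esub> ?b"
      unfolding comb by (rule fib.lincomb_cong) (auto simp: e complex_eq[symmetric])
    moreover have "lincomb ?V k (\<lambda>j. cnj (c j)) e = ?a \<oplus>\<^bsub>?V\<^esub> (- \<i>) \<odot>\<^bsub>?V\<^esub> ?b"
      unfolding comb by (rule fib.lincomb_cong) (auto simp: e complex_eq_iff)
    moreover have "?a \<in> L x"
      unfolding L by (intro CollectI exI[of _ "\<lambda>j. Re (c j)"]) simp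
    moreover have "?b \<in> L x"
      unfolding L by (intro CollectI exI[of _ "\<lambda>j. Im (c j)"]) simp
    ultimately show "\<exists>a\<in>L x. \<exists>b\<in>L x. lincomb ?V k c e = a \<oplus>\<^bsub>?V\<^esub> \<i> \<odot>\<^bsub>?V\<^esub> b \<and>
        lincomb ?V k (\<lambda>j. cnj (c j)) e = a \<oplus>\<^bsub>?V\<^esub> (- \<i>) \<odot>\<^bsub>?V\<^esub> b"
      by blast
  next
    fix v' assume "\<exists>a\<in>L x. \<exists>b\<in>L x. lincomb ?V k c e = a \<oplus>\<^bsub>?V\<^esub> \<i> \<odot>\<^bsub>?V\<^esub> b \<and> v' = a \<oplus>\<^bsub>?V\<^esub> (- \<i>) \<odot>\<^bsub>?V\<^esub> b"
    then obtain g h :: "nat \<Rightarrow> real" where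
      1: "lincomb ?V k c e = lincomb ?V k (\<lambda>j. complex_of_real (g j) + \<i> * complex_of_real (h j)) e"
      and 2: "v' = lincomb ?V k (\<lambda>j. complex_of_real (g j) + (- \<i>) * complex_of_real (h j)) e"
      unfolding L using comb by auto
    show "v' = lincomb ?V k (\<lambda>j. cnj (c j)) e"
      unfolding 2 by (rule fib.lincomb_cong) (auto simp: fib.is_basis_eqD[OF b 1] e)
  qed
  show ?thesis
    unfolding cantilinear_map_def
  proof (intro conjI ballI allI)
    fix u assume "u \<in> carrier ?V"
    then obtain c where u: "u = lincomb ?V k c e"
      using fib.is_basis_span[OF b] by blast
    show "conjugation I L x u \<in> carrier ?V"
      unfolding u conj by (intro fib.lincomb_closed e)
    show "conjugation I L x (a \<odot>\<^bsub>?V\<^esub> u) = cnj a \<odot>\<^bsub>?V\<^esub> conjugation I L x u" for a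
      using conj[of "\<lambda>j. a * c j"] conj[of c] by (simp add: u fib.lincomb_smult e)
    fix v assume "v \<in> carrier ?V"
    then obtain d where v: "v = lincomb ?V k d e"
      using fib.is_basis_span[OF b] by blast
    show "conjugation I L x (u \<oplus>\<^bsub>?V\<^esub> v) = conjugation I L x u \<oplus>\<^bsub>?V\<^esub> conjugation I L x v"
      using conj[of "\<lambda>j. c j + d j"] conj[of c] conj[of d] by (simp add: u v fib.lincomb_add e)
  qed
qed

text \<open>Scaling by \<open>1 / z ^ w\<close> and transport are linear, and only the conjugation
  between them is antilinear.\<close>

lemma glue_antilinear:
  assumes z: "z \<noteq> 0" and q: "q \<in> S"
  shows "cantilinear_map (fibre I (pt z q)) (fibre I (pt (1 / cnj z) q)) (glue I S w L q z)"
proof -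
  have "pt z q \<in> Cstar_times S"
    using z q by (auto simp: Cstar_times_def)
  from conjugation_antilinear[OF this] transport_linear[OF z q] show ?thesis
    unfolding cantilinear_map_def clinear_map_def glue_def
    by (simp add: fib.smult_closed fib.smult_add_right fib.smult_smult)
qed

end

section \<open>Global sections, fibre bases and tameness\<close>

context op_ideal
begin

interpretation fib: cspace "fibre I x" for x
  by (rule cspace_fibre)

lemma slice_section_charts:
  assumes "slice_section I q s"
  shows "\<exists>D k f A. open D \<and> z0 \<in> D \<and> (\<forall>j<k. f j holomorphic_on D \<and> A j \<in> Rop) \<and>
        (\<forall>z\<in>D. s z = lincomb (fibre I (pt z q)) k (\<lambda>j. f j z) (\<lambda>j. cls I (pt z q) (A j)))"
  using assms unfolding slice_section_def by (rule spec)

lemma slice_section_carrier: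
  assumes "slice_section I q s"
  shows "s z \<in> carrier (fibre I (pt z q))"
proof -
  obtain D k f A where D: "z \<in> D" "\<forall>j<k. f j holomorphic_on D \<and> A j \<in> Rop"
    "\<forall>z\<in>D. s z = lincomb (fibre I (pt z q)) k (\<lambda>j. f j z) (\<lambda>j. cls I (pt z q) (A j))"
    using slice_section_charts[OF assms, of z] by (elim exE conjE)
  then have "s z = lincomb (fibre I (pt z q)) k (\<lambda>j. f j z) (\<lambda>j. cls I (pt z q) (A j))"
    by blast
  also have "\<dots> \<in> carrier (fibre I (pt z q))"
    using D(2) by (intro fib.lincomb_closed cls_in_carrier) blast
  finally show ?thesis .
qed

lemma slice_section_zero: "slice_section I q (\<lambda>z. \<zero>\<^bsub>fibre I (pt z q)\<^esub>)"
  unfolding slice_section_def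
  by (intro allI exI[of _ UNIV] exI[of _ "0::nat"]) simp

lemma slice_section_smult:
  assumes "slice_section I q s"
  shows "slice_section I q (\<lambda>z. c \<odot>\<^bsub>fibre I (pt z q)\<^esub> s z)"
  unfolding slice_section_def
proof
  fix z0
  obtain D k f A where D: "open D" "z0 \<in> D" "\<forall>j<k. f j holomorphic_on D \<and> A j \<in> Rop"
    "\<forall>z\<in>D. s z = lincomb (fibre I (pt z q)) k (\<lambda>j. f j z) (\<lambda>j. cls I (pt z q) (A j))"
    using slice_section_charts[OF assms, of z0] by (elim exE conjE)
  have "lincomb (fibre I (pt z q)) k (\<lambda>j. c * f j z) (\<lambda>j. cls I (pt z q) (A j)) =
      c \<odot>\<^bsub>fibre I (pt z q)\<^esub> lincomb (fibre I (pt z q)) k (\<lambda>j. f j z) (\<lambda>j. cls I (pt z q) (A j))" for z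
    using D(3) by (intro fib.lincomb_smult cls_in_carrier) blast
  then show "\<exists>D k f A. open D \<and> z0 \<in> D \<and> (\<forall>j<k. f j holomorphic_on D \<and> A j \<in> Rop) \<and>
      (\<forall>z\<in>D. c \<odot>\<^bsub>fibre I (pt z q)\<^esub> s z =
         lincomb (fibre I (pt z q)) k (\<lambda>j. f j z) (\<lambda>j. cls I (pt z q) (A j)))"
    using D
    by (intro exI[of _ D] exI[of _ k] exI[of _ "\<lambda>j z. c * f j z"] exI[of _ A])
      (auto intro!: holomorphic_intros)
qed

lemma slice_section_add:
  assumes "slice_section I q s" "slice_section I q t"
  shows "slice_section I q (\<lambda>z. s z \<oplus>\<^bsub>fibre I (pt z q)\<^esub> t z)"
  unfolding slice_section_def
proof
  fix z0
  obtain D1 k1 f1 A1 where 1: "open D1" "z0 \<in> D1" "\<forall>j<k1. f1 j holomorphic_on D1 \<and> A1 j \<in> Rop"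
    "\<forall>z\<in>D1. s z = lincomb (fibre I (pt z q)) k1 (\<lambda>j. f1 j z) (\<lambda>j. cls I (pt z q) (A1 j))"
    using slice_section_charts[OF assms(1), of z0] by (elim exE conjE)
  obtain D2 k2 f2 A2 where 2: "open D2" "z0 \<in> D2" "\<forall>j<k2. f2 j holomorphic_on D2 \<and> A2 j \<in> Rop"
    "\<forall>z\<in>D2. t z = lincomb (fibre I (pt z q)) k2 (\<lambda>j. f2 j z) (\<lambda>j. cls I (pt z q) (A2 j))"
    using slice_section_charts[OF assms(2), of z0] by (elim exE conjE)
  define f where "f j = (if j < k1 then f1 j else f2 (j - k1))" for j
  define A where "A j = (if j < k1 then A1 j else A2 (j - k1))" for j
  have app: "lincomb (fibre I (pt z q)) (k1 + k2) (\<lambda>j. f j z) (\<lambda>j. cls I (pt z q) (A j)) =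
    lincomb (fibre I (pt z q)) k1 (\<lambda>j. f1 j z) (\<lambda>j. cls I (pt z q) (A1 j)) \<oplus>\<^bsub>fibre I (pt z q)\<^esub>
    lincomb (fibre I (pt z q)) k2 (\<lambda>j. f2 j z) (\<lambda>j. cls I (pt z q) (A2 j))" for z
    by (rule fib.lincomb_append) (use 1(3) 2(3) in \<open>auto simp: f_def A_def intro: cls_in_carrier\<close>)
  have "f j holomorphic_on (D1 \<inter> D2) \<and> A j \<in> Rop" if "j < k1 + k2" for j
  proof (cases "j < k1")
    case True
    then show ?thesis
      using 1(3) by (auto simp: f_def A_def intro: holomorphic_on_subset)
  next
    case False
    then have "j - k1 < k2" using that by simp
    then show ?thesis
      using 2(3) False by (auto simp: f_def A_def intro: holomorphic_on_subset)
  qed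
  then show "\<exists>D k f A. open D \<and> z0 \<in> D \<and> (\<forall>j<k. f j holomorphic_on D \<and> A j \<in> Rop) \<and>
      (\<forall>z\<in>D. s z \<oplus>\<^bsub>fibre I (pt z q)\<^esub> t z =
         lincomb (fibre I (pt z q)) k (\<lambda>j. f j z) (\<lambda>j. cls I (pt z q) (A j)))"
    using 1(1,2,4) 2(1,2,4) app
    by (intro exI[of _ "D1 \<inter> D2"] exI[of _ "k1 + k2"] exI[of _ f] exI[of _ A]) auto
qed

lemma fibre_action_linear:
  assumes x: "x $ None = 0"
  shows "clinear_map (fibre I x) (fibre I x) (fibre_action I x (euler b))"
  unfolding clinear_map_def
proof (intro conjI ballI allI)
  fix u assume "u \<in> carrier (fibre I x)"
  then obtain A where A: "A \<in> Rop" "u = cls I x A" by (auto simp: carrier_fibre)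
  have eA: "euler b \<circ> A \<in> Rop"
    by (rule Rop.intros(5)[OF Rop.intros(2) A(1)])
  show "fibre_action I x (euler b) u \<in> carrier (fibre I x)"
    unfolding A(2) fibre_action_cls[OF A(1) x] by (rule cls_in_carrier[OF eA])
  show "fibre_action I x (euler b) (c \<odot>\<^bsub>fibre I x\<^esub> u) = c \<odot>\<^bsub>fibre I x\<^esub> fibre_action I x (euler b) u" for c
  proof -
    have "ppartial (Some b) (pconst c) = 0"
      by (simp add: pconst_def ppartial_single)
    then have "euler b \<circ> smul (pconst c) A = smul (pconst c) (euler b \<circ> A)"
      using euler_smul[of b "pconst c" A] by simp
    then show ?thesis
      unfolding A(2) using A(1) eA by (simp only: smult_cls fibre_action_cls x Rop_smul)
  qed
  fix v assume "v \<in> carrier (fibre I x)"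
  then obtain B where B: "B \<in> Rop" "v = cls I x B" by (auto simp: carrier_fibre)
  have eB: "euler b \<circ> B \<in> Rop"
    by (rule Rop.intros(5)[OF Rop.intros(2) B(1)])
  have AB: "A + B \<in> Rop"
    by (rule Rop.intros(4)[OF A(1) B(1)])
  show "fibre_action I x (euler b) (u \<oplus>\<^bsub>fibre I x\<^esub> v) =
      fibre_action I x (euler b) u \<oplus>\<^bsub>fibre I x\<^esub> fibre_action I x (euler b) v"
    unfolding A(2) B(2) using A(1) B(1) eA eB AB
    by (simp only: add_cls fibre_action_cls x euler_add)
qed

text \<open>The relation expresses \<open>f ^ N\<close> A by the generators modulo I. In the fibre
  at x all functions become their values, and the nonzero value of \<open>f ^ N\<close> can be
  divided out.\<close>

lemma cls_eq_lincomb_generators: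
  assumes e: "\<And>j. j < k \<Longrightarrow> e j \<in> Rop" and A: "A \<in> Rop" and f: "peval f x \<noteq> 0"
    and mem: "smul (f ^ N) A - (\<Sum>j<k. smul (g j) (e j)) \<in> I"
  shows "cls I x A = lincomb (fibre I x) k (\<lambda>j. peval (g j) x / peval f x ^ N) (\<lambda>j. cls I x (e j))"
proof -
  define a where "a = peval f x ^ N"
  have a: "a \<noteq> 0" using f by (simp add: a_def)
  let ?c = "\<lambda>j. peval (g j) x / a"
  let ?B = "\<Sum>j<k. smul (pconst (?c j)) (e j)"
  have "smul (pconst a) (smul (pconst (?c j)) (e j)) = smul (pconst (peval (g j) x)) (e j)" for j
    unfolding smul_smul pconst_mult[symmetric] using a by simp
  then have aB: "smul (pconst a) ?B = (\<Sum>j<k. smul (pconst (peval (g j) x)) (e j))"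
    by (simp only: smul_sum_right)
  have B: "?B \<in> Rop"
    by (rule Rop_sum, rule Rop_smul, rule e) simp
  let ?n1 = "smul (f ^ N) A - smul (pconst a) A"
  let ?n2 = "smul (f ^ N) A - (\<Sum>j<k. smul (g j) (e j))"
  let ?n3 = "\<Sum>j<k. smul (g j) (e j) - smul (pconst (peval (g j) x)) (e j)"
  have n1: "?n1 \<in> fibre_null I x"
    using smul_eval_null[OF A, of "f ^ N" x] by (simp only: peval_power a_def)
  have n2: "?n2 \<in> fibre_null I x"
    by (rule fibre_null.intros(1)[OF mem])
  have n3: "?n3 \<in> fibre_null I x"
    by (rule null_sum, rule smul_eval_null, rule e) simp
  \<comment> \<open>The terms \<open>f ^ N\<close> A and \<Sum> g e cancel, which leaves a A minus
    the combination with coefficients g(x), and the latter is a times the sum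
    \<open>?B\<close>.\<close>
  have "smul (pconst a) (A - ?B) = (?n2 - ?n1) + ?n3"
    unfolding smul_diff_right aB sum_subtractf by (simp only: algebra_simps)
  also have "\<dots> \<in> fibre_null I x"
    by (intro fibre_null.intros(3) null_diff n1 n2 n3)
  finally have "smul (pconst (1 / a)) (smul (pconst a) (A - ?B)) \<in> fibre_null I x"
    by (rule null_smul)
  moreover have "smul (pconst (1 / a)) (smul (pconst a) (A - ?B)) = A - ?B"
    unfolding smul_smul pconst_mult[symmetric] using a by (simp only: nonzero_eq_divide_eq times_divide_eq_left
        mult_1 divide_self pconst_one smul_one not_False_eq_True)
  ultimately have "A - ?B \<in> fibre_null I x"
    by (simp only:)
  then have "cls I x A = cls I x ?B"
    using A B by (simp only: cls_eq_iff)
  also have "\<dots> = lincomb (fibre I x) k ?c (\<lambda>j. cls I x (e j))"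
    by (rule lincomb_cls[symmetric], rule e)
  finally show ?thesis
    by (simp only: a_def)
qed

text \<open>Turns vanishing in the fibre into a relation with small coefficients: elements of I need
  none, a factor h with h(x) = 0 moves into the coefficients, and sums are brought to the common
  power \<open>N + N'\<close> of f.\<close>

lemma null_generators:
  assumes gen: "generates_at I f k e" and B: "B \<in> fibre_null I x"
  shows "\<exists>N g. smul (f ^ N) B - (\<Sum>j<k. smul (g j) (e j)) \<in> I \<and> (\<forall>j. peval (g j) x = 0)"
  using B
proof (induction rule: fibre_null.induct)
  case (1 A)
  show ?case
  proof (intro exI[of _ "0::nat"] exI[of _ "\<lambda>j. 0"] conjI)
    show "smul (f ^ 0) A - (\<Sum>j<k. smul 0 (e j)) \<in> I"
      using 1 by (simp only: power_0 smul_one smul_zero_left sum.neutral_const diff_zero)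
  qed simp
next
  case (2 h A)
  obtain N g where g: "smul (f ^ N) A - (\<Sum>j<k. smul (g j) (e j)) \<in> I"
    using gen 2(2) unfolding generates_at_def by blast
  have "smul (f ^ N) (smul h A) - (\<Sum>j<k. smul (h * g j) (e j)) =
      smul h (smul (f ^ N) A - (\<Sum>j<k. smul (g j) (e j)))"
    unfolding smul_diff_right smul_sum_right smul_smul by (simp only: mult.commute)
  then have "smul (f ^ N) (smul h A) - (\<Sum>j<k. smul (h * g j) (e j)) \<in> I"
    using smul_mem[OF g, of h] by (simp only:)
  then show ?case
    using 2(1) by (intro exI[of _ N] exI[of _ "\<lambda>j. h * g j"] conjI) (simp_all only: peval_mult mult_zero_left simp_thms)
next
  case (3 A B)
  obtain N g where 1: "smul (f ^ N) A - (\<Sum>j<k. smul (g j) (e j)) \<in> I" "\<forall>j. peval (g j) x = 0"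
    using 3 by blast
  obtain N' g' where 2: "smul (f ^ N') B - (\<Sum>j<k. smul (g' j) (e j)) \<in> I" "\<forall>j. peval (g' j) x = 0"
    using 3 by blast
  have "smul (f ^ (N + N')) (A + B) - (\<Sum>j<k. smul (f ^ N' * g j + f ^ N * g' j) (e j)) =
      smul (f ^ N') (smul (f ^ N) A - (\<Sum>j<k. smul (g j) (e j))) +
      smul (f ^ N) (smul (f ^ N') B - (\<Sum>j<k. smul (g' j) (e j)))"
    unfolding smul_diff_right smul_sum_right smul_smul smul_add_left smul_add_right sum.distrib
      power_add[symmetric] add.commute[of N' N]
    by (simp only: algebra_simps)
  then have "smul (f ^ (N + N')) (A + B) - (\<Sum>j<k. smul (f ^ N' * g j + f ^ N * g' j) (e j)) \<in> I"
    using add_mem[OF smul_mem[OF 1(1)] smul_mem[OF 2(1)]] by (simp only:)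
  then show ?case
    using 1(2) 2(2)
    by (intro exI[of _ "N + N'"] exI[of _ "\<lambda>j. f ^ N' * g j + f ^ N * g' j"] conjI)
      (simp_all only: peval_mult peval_add mult_zero_right add_0_right simp_thms)
qed

text \<open>For independence, a relation with constants c in the fibre lifts to one in I with
  coefficients \<open>f ^ N\<close> c - g, where g vanishes at x. Freeness makes these coefficients
  zero as polynomials, and evaluation at x leaves c multiplied by a nonzero number.\<close>

lemma fibre_basis:
  assumes gen: "generates_at I f k e" and f: "peval f x \<noteq> 0"
    and free: "\<forall>g. (\<Sum>j<k. smul (g j) (e j)) \<in> I \<longrightarrow> (\<forall>j<k. g j = 0)"
  shows "is_basis (fibre I x) k (\<lambda>j. cls I x (e j))"
proof (rule fib.is_basisI)
  have e: "\<And>j. j < k \<Longrightarrow> e j \<in> Rop"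
    using gen unfolding generates_at_def by blast
  then show "cls I x (e j) \<in> carrier (fibre I x)" if "j < k" for j
    using that by (intro cls_in_carrier)
  fix v assume "v \<in> carrier (fibre I x)"
  then obtain A where A: "A \<in> Rop" "v = cls I x A" by (auto simp: carrier_fibre)
  then obtain N g where g: "smul (f ^ N) A - (\<Sum>j<k. smul (g j) (e j)) \<in> I"
    using gen unfolding generates_at_def by blast
  show "\<exists>c. v = lincomb (fibre I x) k c (\<lambda>j. cls I x (e j))"
    unfolding A(2) by (rule exI, rule cls_eq_lincomb_generators[OF _ A(1) f g], rule e)
next
  fix c j assume c: "lincomb (fibre I x) k c (\<lambda>j. cls I x (e j)) = \<zero>\<^bsub>fibre I x\<^esub>" and j: "j < k"
  have e: "\<And>j. j < k \<Longrightarrow> e j \<in> Rop"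
    using gen unfolding generates_at_def by blast
  let ?B = "\<Sum>j<k. smul (pconst (c j)) (e j)"
  have "?B \<in> Rop"
    by (rule Rop_sum, rule Rop_smul, rule e) simp
  moreover have "cls I x ?B = cls I x 0"
    using c lincomb_cls[of k e x c, OF e] by (simp only: zero_fibre)
  ultimately have "?B - 0 \<in> fibre_null I x"
    using cls_eq_iff[OF _ Rop_zero, of ?B x] by blast
  then have "?B \<in> fibre_null I x"
    by (simp only: diff_zero)
  then obtain N g where g: "smul (f ^ N) ?B - (\<Sum>j<k. smul (g j) (e j)) \<in> I" "\<forall>j. peval (g j) x = 0"
    using null_generators[OF gen] by blast
  have "smul (f ^ N) ?B - (\<Sum>j<k. smul (g j) (e j)) = (\<Sum>j<k. smul (f ^ N * pconst (c j) - g j) (e j))"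
    by (simp only: smul_sum_right smul_smul smul_diff_left sum_subtractf)
  then have "(\<Sum>j<k. smul (f ^ N * pconst (c j) - g j) (e j)) \<in> I"
    using g(1) by (simp only:)
  then have "f ^ N * pconst (c j) - g j = 0"
    using spec[OF free, of "\<lambda>j. f ^ N * pconst (c j) - g j"] j by blast
  then have "f ^ N * pconst (c j) = g j"
    by simp
  then have "peval f x ^ N * c j = peval (g j) x"
    using peval_mult[of "f ^ N" "pconst (c j)" x] by (simp add: peval_power)
  then show "c j = 0"
    using g(2) f by simp
qed

text \<open>The exponents and polynomials are chosen once, independently of x. The matrix entries
  are thus rational functions with powers of f as denominators, which yields both holomorphic
  dependence and local bounds.\<close>

lemma euler_matrix_exists:
  assumes gen: "generates_at I f k e"
  shows "\<exists>N G. \<forall>x j. x $ None = 0 \<longrightarrow> peval f x \<noteq> 0 \<longrightarrow> j < k \<longrightarrow>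
    fibre_action I x (euler b) (cls I x (e j)) =
      lincomb (fibre I x) k (\<lambda>i. peval (G i j) x / peval f x ^ N j) (\<lambda>i. cls I x (e i))"
proof -
  have e: "\<And>j. j < k \<Longrightarrow> e j \<in> Rop"
    using gen unfolding generates_at_def by blast
  have ee: "euler b \<circ> e j \<in> Rop" if "j < k" for j
    by (rule Rop.intros(5)[OF Rop.intros(2) e[OF that]])
  have "\<exists>N g. smul (f ^ N) (euler b \<circ> e j) - (\<Sum>i<k. smul (g i) (e i)) \<in> I" if "j < k" for j
    using gen ee[OF that] unfolding generates_at_def by blast
  then have "\<forall>j. \<exists>N g. j < k \<longrightarrow> smul (f ^ N) (euler b \<circ> e j) - (\<Sum>i<k. smul (g i) (e i)) \<in> I"
    by blast
  then obtain N g where g: "\<forall>j. j < k \<longrightarrow> smul (f ^ N j) (euler b \<circ> e j) - (\<Sum>i<k. smul (g j i) (e i)) \<in> I"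
    unfolding choice_iff by (elim exE)
  have "fibre_action I x (euler b) (cls I x (e j)) =
      lincomb (fibre I x) k (\<lambda>i. peval (g j i) x / peval f x ^ N j) (\<lambda>i. cls I x (e i))"
    if "x $ None = 0" "peval f x \<noteq> 0" "j < k" for x j
    unfolding fibre_action_cls[OF e[OF that(3)] that(1)]
    by (rule cls_eq_lincomb_generators[OF _ ee[OF that(3)] that(2) g[rule_format, OF that(3)]], rule e)
  then show ?thesis
    by (intro exI[of _ N] exI[of _ "\<lambda>i j. g j i"]) blast
qed

end

section \<open>The fibres of the harmonic bundle\<close>

context nc_variation
begin

lemma glues_to_add:
  assumes q: "q \<in> S" and s: "slice_section I q s" "glues_to I S w L q s u"
    and t: "slice_section I q t" "glues_to I S w L q t v"
  shows "glues_to I S w L q (\<lambda>z. s z \<oplus>\<^bsub>fibre I (pt z q)\<^esub> t z) (\<lambda>z. u z \<oplus>\<^bsub>fibre I (pt z q)\<^esub> v z)"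
  using glue_antilinear[OF _ q] s t slice_section_carrier
  by (simp add: glues_to_def slice_section_add cantilinear_map_def)

text \<open>The second component u belongs to the conjugate bundle, hence the scalar
  \<open>cnj c\<close>.\<close>

lemma glues_to_smult:
  assumes q: "q \<in> S" and s: "slice_section I q s" "glues_to I S w L q s u"
  shows "glues_to I S w L q (\<lambda>z. c \<odot>\<^bsub>fibre I (pt z q)\<^esub> s z) (\<lambda>z. cnj c \<odot>\<^bsub>fibre I (pt z q)\<^esub> u z)"
  using glue_antilinear[OF _ q] s slice_section_carrier
  by (simp add: glues_to_def slice_section_smult cantilinear_map_def)

lemma glues_to_zero:
  assumes q: "q \<in> S"
  shows "glues_to I S w L q (\<lambda>z. \<zero>\<^bsub>fibre I (pt z q)\<^esub>) (\<lambda>z. \<zero>\<^bsub>fibre I (pt z q)\<^esub>)"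
  unfolding glues_to_def
proof (intro conjI allI impI slice_section_zero)
  fix z :: complex assume z: "z \<noteq> 0"
  let ?V = "fibre I (pt z q)"
  have "glue I S w L q z (0 \<odot>\<^bsub>?V\<^esub> \<zero>\<^bsub>?V\<^esub>) = cnj 0 \<odot>\<^bsub>fibre I (pt (1 / cnj z) q)\<^esub> glue I S w L q z \<zero>\<^bsub>?V\<^esub>"
    and "glue I S w L q z \<zero>\<^bsub>?V\<^esub> \<in> carrier (fibre I (pt (1 / cnj z) q))"
    using glue_antilinear[OF z q] fib.zero_closed unfolding cantilinear_map_def by blast+
  then show "\<zero>\<^bsub>fibre I (pt (1 / cnj z) q)\<^esub> = glue I S w L q z \<zero>\<^bsub>?V\<^esub>"
    by (simp add: fib.smult_zero_left)
qed

lemma global_sections_simps: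
  "carrier (global_sections I S w L q) = {s. slice_section I q s \<and> (\<exists>u. glues_to I S w L q s u)}"
  "\<zero>\<^bsub>global_sections I S w L q\<^esub> = (\<lambda>z. \<zero>\<^bsub>fibre I (pt z q)\<^esub>)"
  "s \<oplus>\<^bsub>global_sections I S w L q\<^esub> t = (\<lambda>z. s z \<oplus>\<^bsub>fibre I (pt z q)\<^esub> t z)"
  "c \<odot>\<^bsub>global_sections I S w L q\<^esub> s = (\<lambda>z. c \<odot>\<^bsub>fibre I (pt z q)\<^esub> s z)"
  by (simp_all add: global_sections_def)

lemma global_section_carrier: "s \<in> carrier (global_sections I S w L q) \<Longrightarrow> s z \<in> carrier (fibre I (pt z q))"
  by (auto simp: global_sections_simps intro: slice_section_carrier)

text \<open>All operations are pointwise, so the axioms are those of the fibres. The content is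
  closure: sums and multiples of sections extending over infinity extend as well, by antilinearity
  of \<open>glue\<close>.\<close>

lemma cspace_global_sections:
  assumes q: "q \<in> S"
  shows "cspace (global_sections I S w L q)"
proof -
  let ?E = "global_sections I S w L q"
  have add: "s \<oplus>\<^bsub>?E\<^esub> t \<in> carrier ?E" if st: "s \<in> carrier ?E" "t \<in> carrier ?E" for s t
  proof -
    obtain u v where "glues_to I S w L q s u" "glues_to I S w L q t v" "slice_section I q s" "slice_section I q t"
      using st by (auto simp: global_sections_simps(1))
    then show ?thesis
      unfolding global_sections_simps(1,3) mem_Collect_eq
      by (intro conjI slice_section_add exI[of _ "\<lambda>z. u z \<oplus>\<^bsub>fibre I (pt z q)\<^esub> v z"] glues_to_add[OF q])
  qed
  have smult: "c \<odot>\<^bsub>?E\<^esub> s \<in> carrier ?E" if s: "s \<in> carrier ?E" for c s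
  proof -
    obtain u where "glues_to I S w L q s u" "slice_section I q s"
      using s by (auto simp: global_sections_simps(1))
    then show ?thesis
      unfolding global_sections_simps(1,4) mem_Collect_eq
      by (intro conjI slice_section_smult exI[of _ "\<lambda>z. cnj c \<odot>\<^bsub>fibre I (pt z q)\<^esub> u z"] glues_to_smult[OF q])
  qed
  have zero: "\<zero>\<^bsub>?E\<^esub> \<in> carrier ?E"
    unfolding global_sections_simps(1,2) mem_Collect_eq
    by (intro conjI slice_section_zero exI[of _ "\<lambda>z. \<zero>\<^bsub>fibre I (pt z q)\<^esub>"] glues_to_zero[OF q])
  note c = global_section_carrier
  interpret abelian_group ?E
  proof (rule abelian_groupI)
    fix s assume s: "s \<in> carrier ?E"
    have "(- 1) \<odot>\<^bsub>?E\<^esub> s \<oplus>\<^bsub>?E\<^esub> s = \<zero>\<^bsub>?E\<^esub>"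
      unfolding global_sections_simps using c[OF s] by (simp add: fib.smult_minus_one fib.l_neg)
    then show "\<exists>t\<in>carrier ?E. t \<oplus>\<^bsub>?E\<^esub> s = \<zero>\<^bsub>?E\<^esub>"
      using smult[OF s] by blast
    show "\<zero>\<^bsub>?E\<^esub> \<oplus>\<^bsub>?E\<^esub> s = s"
      unfolding global_sections_simps using c[OF s] by simp
    fix t assume t: "t \<in> carrier ?E"
    show "s \<oplus>\<^bsub>?E\<^esub> t = t \<oplus>\<^bsub>?E\<^esub> s"
      unfolding global_sections_simps using c[OF s] c[OF t] by (simp add: fib.a_comm)
    fix r assume r: "r \<in> carrier ?E"
    show "s \<oplus>\<^bsub>?E\<^esub> t \<oplus>\<^bsub>?E\<^esub> r = s \<oplus>\<^bsub>?E\<^esub> (t \<oplus>\<^bsub>?E\<^esub> r)"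
      unfolding global_sections_simps using c[OF s] c[OF t] c[OF r] by (simp add: fib.a_assoc)
  qed (use add zero in auto)
  show ?thesis
  proof
    fix a d s assume s: "s \<in> carrier ?E"
    show "a \<odot>\<^bsub>?E\<^esub> s \<in> carrier ?E"
      by (rule smult[OF s])
    show "(a + d) \<odot>\<^bsub>?E\<^esub> s = a \<odot>\<^bsub>?E\<^esub> s \<oplus>\<^bsub>?E\<^esub> d \<odot>\<^bsub>?E\<^esub> s"
      unfolding global_sections_simps using c[OF s] by (simp add: fib.smult_add_left)
    show "a \<odot>\<^bsub>?E\<^esub> (d \<odot>\<^bsub>?E\<^esub> s) = (a * d) \<odot>\<^bsub>?E\<^esub> s"
      unfolding global_sections_simps using c[OF s] by (simp add: fib.smult_smult)
    show "1 \<odot>\<^bsub>?E\<^esub> s = s"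
      unfolding global_sections_simps using c[OF s] by (simp add: fib.smult_one)
    fix t assume t: "t \<in> carrier ?E"
    show "a \<odot>\<^bsub>?E\<^esub> (s \<oplus>\<^bsub>?E\<^esub> t) = a \<odot>\<^bsub>?E\<^esub> s \<oplus>\<^bsub>?E\<^esub> a \<odot>\<^bsub>?E\<^esub> t"
      unfolding global_sections_simps using c[OF s] c[OF t] by (simp add: fib.smult_add_right)
  qed
qed

text \<open>Evaluation at z = 0 is bijective, so the description defining \<open>higgs\<close> has
  exactly one solution, and it makes the Higgs field conjugate to the action on the fibre at z =
  0.\<close>

lemma higgs_char_poly:
  assumes q: "q \<in> S"
    and bij: "bij_betw (\<lambda>s. s 0) (carrier (global_sections I S w L q)) (carrier (fibre I (pt 0 q)))"
    and M: "matrix_wrt (fibre I (pt 0 q)) (fibre_action I (pt 0 q) (euler b)) k e M"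
  shows "endo_char_poly (global_sections I S w L q) (higgs (associated_harmonic_bundle I S w L P) b q) = char_poly M"
proof -
  let ?E = "global_sections I S w L q" and ?V = "fibre I (pt 0 q)"
  let ?T = "fibre_action I (pt 0 q) (euler b)" and ?T' = "higgs (associated_harmonic_bundle I S w L P) b q"
  have ev: "clinear_map ?E ?V (\<lambda>s. s 0)"
    unfolding clinear_map_def by (simp add: global_section_carrier global_sections_simps(3,4))
  have T: "clinear_map ?V ?V ?T"
    by (rule fibre_action_linear) simp
  have T': "?T' s \<in> carrier ?E \<and> ?T' s 0 = ?T (s 0)" if s: "s \<in> carrier ?E" for s
  proof -
    have "?T (s 0) \<in> carrier ?V"
      using T global_section_carrier[OF s, of 0] unfolding clinear_map_def by blast
    then have "?T (s 0) \<in> (\<lambda>s. s 0) ` carrier ?E"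
      by (simp only: bij_betw_imp_surj_on[OF bij])
    then obtain t where t: "t \<in> carrier ?E" "t 0 = ?T (s 0)"
      by (elim imageE) simp
    have "?T' s = (THE t. t \<in> carrier ?E \<and> t 0 = ?T (s 0))"
      by (simp add: associated_harmonic_bundle_def)
    also have "\<dots> = t"
    proof (rule the_equality)
      fix t' assume "t' \<in> carrier ?E \<and> t' 0 = ?T (s 0)"
      then show "t' = t"
        using t inj_onD[OF bij_betw_imp_inj_on[OF bij], of t' t] by simp
    qed (use t in simp)
    finally show ?thesis
      using t by simp
  qed
  show ?thesis
    using matrix_wrt_transfer[where E = ?E and \<phi> = "\<lambda>s. s 0" and T' = ?T',
        OF cspace_global_sections[OF q] cspace_fibre ev bij T T' M]
    by (intro endo_char_poly_eq[OF cspace_global_sections[OF q]])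
qed

end

section \<open>Holomorphic dependence of characteristic polynomials, and the domain\<close>

lemma cdiff_at_coeff_mult:
  assumes "\<And>n. cdiff_at (\<lambda>x. coeff (p x) n) x" "\<And>n. cdiff_at (\<lambda>x. coeff (r x) n) x"
  shows "cdiff_at (\<lambda>x. coeff (p x * r x) n) x"
  unfolding coeff_mult by (intro cdiff_at_sum cdiff_at_mult assms)

lemma cdiff_at_coeff_prod:
  assumes "\<And>j n. j \<in> J \<Longrightarrow> cdiff_at (\<lambda>x. coeff (p j x) n) x"
  shows "cdiff_at (\<lambda>x. coeff (\<Prod>j\<in>J. p j x) n) x"
  using assms
proof (induction J arbitrary: n rule: infinite_finite_induct)
  case (insert j J)
  then show ?case
    by (simp add: cdiff_at_coeff_mult)
qed auto

text \<open>By the Leibniz expansion of the determinant the coefficients are polynomials in the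
  matrix entries; \<open>?p\<close> is an entry of the characteristic matrix written out.\<close>

lemma cdiff_at_coeff_char_poly:
  assumes "\<And>i j. i < k \<Longrightarrow> j < k \<Longrightarrow> cdiff_at (\<lambda>x. m x i j) x"
  shows "cdiff_at (\<lambda>x. coeff (char_poly (Matrix.mat k k (\<lambda>(i, j). m x i j))) n) x"
proof -
  let ?p = "\<lambda>\<pi> i x. (if i = \<pi> i then [:0, 1:] else 0) + [:- m x i (\<pi> i):]"
  have eq: "char_poly (Matrix.mat k k (\<lambda>(i, j). m x i j)) =
      (\<Sum>\<pi>\<in>{\<pi>. \<pi> permutes {0..<k}}. signof \<pi> * (\<Prod>i = 0..<k. ?p \<pi> i x))" for x
  proof -
    have "(\<Prod>i = 0..<k. char_poly_matrix (Matrix.mat k k (\<lambda>(i, j). m x i j)) $$ (i, \<pi> i)) = (\<Prod>i = 0..<k. ?p \<pi> i x)"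
      if "\<pi> permutes {0..<k}" for \<pi>
    proof (rule prod.cong)
      fix i assume "i \<in> {0..<k}"
      then have "i < k" "\<pi> i < k"
        using permutes_in_image[OF that, of i] by auto
      then show "char_poly_matrix (Matrix.mat k k (\<lambda>(i, j). m x i j)) $$ (i, \<pi> i) = ?p \<pi> i x"
        by (simp add: char_poly_matrix_def)
    qed simp
    then show ?thesis
      unfolding char_poly_def Determinant.det_def
      by (auto simp: char_poly_matrix_def intro!: sum.cong)
  qed
  \<comment> \<open>The sign is a constant polynomial 1 or -1, so it can be taken out of the
    coefficient.\<close>
  have s: "coeff (signof \<pi> * r :: complex poly) n = signof \<pi> * coeff r n" for \<pi> r
    by (simp add: sign_def)
  have "cdiff_at (\<lambda>x. coeff (?p \<pi> i x) n) x" if "\<pi> permutes {0..<k}" "i \<in> {0..<k}" for \<pi> i n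
  proof -
    have "i < k" "\<pi> i < k"
      using that permutes_in_image[OF that(1), of i] by auto
    then have "cdiff_at (\<lambda>x. (- 1) * m x i (\<pi> i)) x"
      by (intro cdiff_at_mult cdiff_at_const assms)
    then show ?thesis
      unfolding coeff_add by (intro cdiff_at_add cdiff_at_const) (cases n; simp add: cdiff_at_const)
  qed
  then show ?thesis
    unfolding eq coeff_sum s
    by (intro cdiff_at_sum cdiff_at_mult cdiff_at_const cdiff_at_coeff_prod) auto
qed

lemma cdiff_at_peval_pt: "cdiff_at (\<lambda>q. peval f (pt z q)) q"
  unfolding peval_def
proof (intro cdiff_at_sum cdiff_at_mult cdiff_at_const cdiff_at_prod cdiff_at_power)
  fix i show "cdiff_at (\<lambda>q. pt z q $ i) q"
    by (cases i) (simp_all add: cdiff_at_const cdiff_at_nth)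
qed

lemma zariski_open_imp_open:
  assumes "zariski_open U"
  shows "open U"
proof -
  obtain T where T: "- U = {x. \<forall>f\<in>T. peval f x = 0}"
    using assms by (auto simp: zariski_open_def zariski_closed_def)
  have "closed {x. peval f x = 0}" for f :: "'a cpoly"
    unfolding peval_def by (intro closed_Collect_eq continuous_intros)
  then have "closed (\<Inter>f\<in>T. {x. peval f x = 0})"
    by blast
  moreover have "(\<Inter>f\<in>T. {x. peval f x = 0}) = - U"
    unfolding T by blast
  ultimately show ?thesis
    by (simp add: closed_def)
qed

text \<open>Off the divisor a point lies in the torus, and it avoids the Zariski closure of the
  torus points outside \<open>S20\<close>, a fortiori those points themselves.\<close>

lemma S20_bar_minus_boundary: "S20_bar a g - boundary_divisor \<subseteq> S20 a g"
proof
  fix q assume q: "q \<in> S20_bar a g - boundary_divisor"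
  then have "q \<in> torus"
    by (auto simp: boundary_divisor_def torus_def)
  moreover have "q \<notin> torus - S20 a g"
    using q by (auto simp: S20_bar_def zariski_closure_def)
  ultimately show "q \<in> S20 a g"
    by blast
qed

theorem theorem5p5:
  fixes \<Sigma> :: "(real ^ 'n::finite) set set"
    and a :: "'m::finite \<Rightarrow> int ^ 'n"
    and p :: "'r::finite \<Rightarrow> int ^ 'm \<Rightarrow> int"
    and pd :: "'r \<Rightarrow> int ^ 'm"
    and g :: "'m \<Rightarrow> 'r \<Rightarrow> nat"
    and L :: "complex ^ 'r option \<Rightarrow> 'r oper set set"
    and P :: "complex ^ 'r option \<Rightarrow> 'r oper set \<Rightarrow> 'r oper set \<Rightarrow> complex"
    and U :: "(complex ^ 'r) set"
  assumes "fan \<Sigma>" and "smooth_fan \<Sigma>" and "projective_fan \<Sigma>"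
    and "ray_generators \<Sigma> a" and "weak_Fano \<Sigma> a"
    and "nef_basis \<Sigma> a p" and "dual_basis a p pd" and "effective_lift a p g"
    and "pure_polarized_ncHodge_variation (QM_ideal a p pd) (S20 a g) CARD('n) L P"
    and "zariski_open U" and "0 \<in> U" and "U \<subseteq> S20_bar a g"
    and "coherent_on (QM_ideal a p pd) U"
  shows "tame_along
           (restrict_bundle
              (associated_harmonic_bundle (QM_ideal a p pd) (S20 a g) CARD('n) L P)
              (U - boundary_divisor))
           U boundary_divisor"
proof -
  define I where "I = QM_ideal a p pd"
  define S where "S = S20 a g"
  define w where "w = CARD('n)"
  note hyp = assms(9)[folded I_def S_def w_def]
  interpret op_ideal I
    unfolding I_def QM_ideal_def by (rule op_ideal_left_ideal)
  interpret nc_variation I S w L P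
    by unfold_locales (use hyp in \<open>auto simp: pure_polarized_ncHodge_variation_def\<close>)
  have lf: "locally_free_on I S"
    using hyp by (simp add: pure_polarized_ncHodge_variation_def)
  have bij: "bij_betw (\<lambda>s. s 0) (carrier (global_sections I S w L q)) (carrier (fibre I (pt 0 q)))"
    if "q \<in> S" for q
    using hyp that unfolding pure_polarized_ncHodge_variation_def Let_def by blast
  let ?Z = "boundary_divisor :: (complex ^ 'r) set"
  let ?H = "associated_harmonic_bundle I S w L P"
  have US: "U - ?Z \<subseteq> S"
    using assms(12) S20_bar_minus_boundary[of a g] unfolding S_def by blast
  have U: "open U"
    by (rule zariski_open_imp_open[OF assms(10)])
  have Z: "U - ?Z = U - (\<Union>b\<in>UNIV. {x. x $ b = 0})"
    by (simp add: boundary_divisor_def)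
  have UZ: "open (U - ?Z)"
    unfolding Z using U by (intro open_Diff closed_UN ballI closed_hyperplane_coord finite)
  define cp where "cp b n q = coeff (endo_char_poly (global_sections I S w L q) (higgs ?H b q)) n" for b n q
  \<comment> \<open>Near a point off the divisor, local freeness at z = 0 provides generators that
    form a basis of every fibre with f nonzero, so here the matrix of the action does represent the
    Higgs field.\<close>
  have chart: "\<exists>N k m. open N \<and> q0 \<in> N \<and> N \<subseteq> U - ?Z \<and>
      (\<forall>q\<in>N. \<forall>i j. cdiff_at (\<lambda>q. m q i j) q) \<and>
      (\<forall>q\<in>N. \<exists>e. matrix_wrt (fibre I (pt 0 q)) (fibre_action I (pt 0 q) (euler b)) k e
         (Matrix.mat k k (\<lambda>(i, j). m q i j)))"
    if q0: "q0 \<in> U - ?Z" for q0 and b :: 'r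
  proof -
    have "q0 \<in> S" using q0 US by blast
    from bspec[OF spec[OF lf[unfolded locally_free_on_def], of 0] this] obtain f k e where f: "peval f (pt 0 q0) \<noteq> 0" "generates_at I f k e"
      "\<forall>g. (\<Sum>j<k. smul (g j) (e j)) \<in> I \<longrightarrow> (\<forall>j<k. g j = 0)"
      by (elim exE conjE)
    from euler_matrix_exists[OF f(2), of b]
    obtain Nn G where G: "\<forall>x j. x $ None = 0 \<longrightarrow> peval f x \<noteq> 0 \<longrightarrow> j < k \<longrightarrow>
      fibre_action I x (euler b) (cls I x (e j)) =
        lincomb (fibre I x) k (\<lambda>i. peval (G i j) x / peval f x ^ Nn j) (\<lambda>i. cls I x (e i))"
      by (elim exE)
    let ?N = "{q. peval f (pt 0 q) \<noteq> 0} \<inter> (U - ?Z)"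
    let ?m = "\<lambda>q i j. peval (G i j) (pt 0 q) / peval f (pt 0 q) ^ Nn j"
    have "open {q. peval f (pt 0 q) \<noteq> 0}"
      by (intro open_Collect_neq continuous_at_imp_continuous_on ballI cdiff_at_imp_continuous
          cdiff_at_peval_pt continuous_on_const)
    then have "open ?N"
      using UZ by (rule open_Int)
    moreover have "cdiff_at (\<lambda>q. ?m q i j) q" if "q \<in> ?N" for q i j
      by (intro cdiff_at_divide cdiff_at_power cdiff_at_peval_pt) (use that in simp)
    moreover have "matrix_wrt (fibre I (pt 0 q)) (fibre_action I (pt 0 q) (euler b)) k
        (\<lambda>j. cls I (pt 0 q) (e j)) (Matrix.mat k k (\<lambda>(i, j). ?m q i j))" if "q \<in> ?N" for q
      unfolding matrix_wrt_def
    proof (intro conjI allI impI)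
      show basis: "is_basis (fibre I (pt 0 q)) k (\<lambda>j. cls I (pt 0 q) (e j))"
        by (rule fibre_basis[OF f(2) _ f(3)]) (use that in simp)
      fix j assume j: "j < k"
      have "fibre_action I (pt 0 q) (euler b) (cls I (pt 0 q) (e j)) =
        lincomb (fibre I (pt 0 q)) k (\<lambda>i. ?m q i j) (\<lambda>i. cls I (pt 0 q) (e i))"
        by (rule G[rule_format]) (use that j in simp_all)
      also have "\<dots> = lincomb (fibre I (pt 0 q)) k
          (\<lambda>i. Matrix.mat k k (\<lambda>(i, j). ?m q i j) $$ (i, j)) (\<lambda>i. cls I (pt 0 q) (e i))"
        by (rule fib.lincomb_cong) (use j fib.is_basis_carrier[OF basis] in simp_all)
      finally show "fibre_action I (pt 0 q) (euler b) (cls I (pt 0 q) (e j)) =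
        lincomb (fibre I (pt 0 q)) k
          (\<lambda>i. Matrix.mat k k (\<lambda>(i, j). ?m q i j) $$ (i, j)) (\<lambda>i. cls I (pt 0 q) (e i))" .
    qed simp
    ultimately show ?thesis
      using q0 f(1)
      by (intro exI[of _ ?N] exI[of _ k] exI[of _ ?m]) blast
  qed
  have hol: "mv_holomorphic_on (cp b n) (U - ?Z)" for b n
    unfolding mv_holomorphic_on_iff
  proof (intro conjI ballI UZ)
    fix q0 assume q0: "q0 \<in> U - ?Z"
    obtain N k m where N: "open N" "q0 \<in> N" "N \<subseteq> U - ?Z"
      "\<forall>q\<in>N. \<forall>i j. cdiff_at (\<lambda>q. m q i j) q"
      "\<forall>q\<in>N. \<exists>e. matrix_wrt (fibre I (pt 0 q)) (fibre_action I (pt 0 q) (euler b)) k e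
         (Matrix.mat k k (\<lambda>(i, j). m q i j))"
      using chart[OF q0, of b] by (elim exE conjE)
    have eq: "cp b n q = coeff (char_poly (Matrix.mat k k (\<lambda>(i, j). m q i j))) n" if "q \<in> N" for q
    proof -
      obtain e where e: "matrix_wrt (fibre I (pt 0 q)) (fibre_action I (pt 0 q) (euler b)) k e
         (Matrix.mat k k (\<lambda>(i, j). m q i j))"
        using N(5) \<open>q \<in> N\<close> by blast
      have "q \<in> S"
        using N(3) US \<open>q \<in> N\<close> by blast
      then show ?thesis
        unfolding cp_def by (simp only: higgs_char_poly[OF _ bij e])
    qed
    have "cdiff_at (\<lambda>q. coeff (char_poly (Matrix.mat k k (\<lambda>(i, j). m q i j))) n) q0"
      by (rule cdiff_at_coeff_char_poly) (use N(2,4) in blast)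
    then show "cdiff_at (cp b n) q0"
      by (rule cdiff_at_transform[OF _ N(1,2) eq])
  qed
  have bounded: "\<exists>r>0. \<exists>K. \<forall>q\<in>ball q0 r. q \<in> U - ?Z \<longrightarrow> norm (cp b n q) \<le> K"
    if q0: "q0 \<in> U" for q0 b n
  proof -
    \<comment> \<open>Now q0 may lie on the divisor, and coherence provides k generators, possibly
      with relations.\<close>
    from bspec[OF spec[OF assms(13)[folded I_def, unfolded coherent_on_def], of 0] q0]
    obtain f k e where f: "peval f (pt 0 q0) \<noteq> 0" "generates_at I f k e"
      by (elim exE conjE)
    from euler_matrix_exists[OF f(2), of b]
    obtain Nn G where G: "\<forall>x j. x $ None = 0 \<longrightarrow> peval f x \<noteq> 0 \<longrightarrow> j < k \<longrightarrow>
      fibre_action I x (euler b) (cls I x (e j)) =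
        lincomb (fibre I x) k (\<lambda>i. peval (G i j) x / peval f x ^ Nn j) (\<lambda>i. cls I x (e i))"
      by (elim exE)
    let ?m = "\<lambda>q i j. peval (G i j) (pt 0 q) / peval f (pt 0 q) ^ Nn j"
    \<comment> \<open>The sum of all column sums is continuous at q0 and dominates each of them, so
      K = \<mu> q0 + 1 bounds every column sum in a neighbourhood.\<close>
    define \<mu> where "\<mu> q = (\<Sum>j<k. \<Sum>i<k. norm (?m q i j))" for q
    define K where "K = \<mu> q0 + 1"
    have "isCont \<mu> q0"
      unfolding \<mu>_def
      by (intro continuous_sum continuous_norm cdiff_at_imp_continuous cdiff_at_divide cdiff_at_power cdiff_at_peval_pt)
        (use f(1) in simp)
    then have "eventually (\<lambda>q. \<mu> q < K) (nhds q0)"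
      unfolding isCont_def tendsto_at_iff_tendsto_nhds by (rule order_tendstoD) (simp add: K_def)
    moreover have "isCont (\<lambda>q. peval f (pt 0 q)) q0"
      by (intro cdiff_at_imp_continuous cdiff_at_peval_pt)
    then have "eventually (\<lambda>q. peval f (pt 0 q) \<noteq> 0) (nhds q0)"
      unfolding isCont_def tendsto_at_iff_tendsto_nhds[of "\<lambda>q. peval f (pt 0 q)"]
      using f(1) by (rule tendsto_imp_eventually_ne)
    ultimately have "eventually (\<lambda>q. \<mu> q < K \<and> peval f (pt 0 q) \<noteq> 0) (nhds q0)"
      by (rule eventually_conj)
    then obtain r where r: "r > 0" "\<forall>q. dist q q0 < r \<longrightarrow> \<mu> q < K \<and> peval f (pt 0 q) \<noteq> 0"
      unfolding eventually_nhds_metric by blast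
    have "norm (cp b n q) \<le> (1 + K) ^ k" if q: "q \<in> ball q0 r" "q \<in> U - ?Z" for q
    proof -
      let ?V = "fibre I (pt 0 q)" and ?T = "fibre_action I (pt 0 q) (euler b)"
      have \<mu>: "\<mu> q < K" and f0: "peval f (pt 0 q) \<noteq> 0"
        using r(2) q(1) by (simp_all add: dist_commute)
      have "q \<in> S"
        using q(2) US by blast
      \<comment> \<open>Two families meet in the fibre at q: a basis of size d from local freeness,
        in which the Higgs field has matrix M, and the k generators from coherence at q0. The second
        bounds d by k and the eigenvalues of M by K, uniformly in q.\<close>
      obtain d c M where M: "matrix_wrt ?V ?T d c M"
        using chart[OF q(2), of b] q(2) by (elim exE conjE) blast
      have gen: "\<And>j. j < k \<Longrightarrow> e j \<in> Rop"
        "\<And>A. A \<in> Rop \<Longrightarrow> \<exists>N g. smul (f ^ N) A - (\<Sum>j<k. smul (g j) (e j)) \<in> I"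
        using f(2) unfolding generates_at_def by blast+
      have T: "clinear_map ?V ?V ?T"
        by (rule fibre_action_linear) simp
      have car: "cls I (pt 0 q) (e j) \<in> carrier ?V" if "j < k" for j
        by (rule cls_in_carrier[OF gen(1)[OF that]])
      have span: "\<exists>c. v = lincomb ?V k c (\<lambda>j. cls I (pt 0 q) (e j))" if "v \<in> carrier ?V" for v
      proof -
        obtain A where A: "A \<in> Rop" "v = cls I (pt 0 q) A"
          using \<open>v \<in> carrier ?V\<close> by (auto simp: carrier_fibre)
        obtain N g where g: "smul (f ^ N) A - (\<Sum>j<k. smul (g j) (e j)) \<in> I"
          using gen(2)[OF A(1)] by blast
        show ?thesis
          unfolding A(2) by (rule exI, rule cls_eq_lincomb_generators[OF _ A(1) f0 g], rule gen(1))
      qed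
      have act: "?T (cls I (pt 0 q) (e j)) = lincomb ?V k (\<lambda>i. ?m q i j) (\<lambda>i. cls I (pt 0 q) (e i))"
        if "j < k" for j
        by (rule G[rule_format]) (use that f0 in simp_all)
      have col: "(\<Sum>i<k. norm (?m q i j)) \<le> K" if "j < k" for j
      proof -
        have "(\<Sum>i<k. norm (?m q i j)) \<le> \<mu> q"
          unfolding \<mu>_def using that by (intro member_le_sum[where f = "\<lambda>j. \<Sum>i<k. norm (?m q i j)"]) (auto intro: sum_nonneg)
        with \<mu> show ?thesis by simp
      qed
      have "0 \<le> \<mu> q0"
        unfolding \<mu>_def by (intro sum_nonneg norm_ge_zero)
      then have "K \<ge> 0"
        by (simp add: K_def)
      moreover have "M \<in> carrier_mat d d"
        using M by (simp add: matrix_wrt_def)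
      ultimately have "norm (coeff (char_poly M) n) \<le> (1 + K) ^ k"
        using eigenvalue_bound_spanning[OF cspace_fibre T M car span act col]
        by (intro char_poly_coeff_bound[of M d k K n]) blast+
      then show ?thesis
        unfolding cp_def by (simp only: higgs_char_poly[OF \<open>q \<in> S\<close> bij[OF \<open>q \<in> S\<close>] M])
    qed
    with r(1) show ?thesis
      by blast
  qed
  have "\<exists>F. mv_holomorphic_on F U \<and> (\<forall>q\<in>U - ?Z. F q = cp b n q)" for b n
    unfolding Z
    by (rule riemann_extension_hyperplanes[OF finite U hol[unfolded Z] bounded[unfolded Z]])
  then show ?thesis
    using US unfolding tame_along_def restrict_bundle_def I_def[symmetric] S_def[symmetric] w_def[symmetric] cp_def
    by (auto simp: associated_harmonic_bundle_def)
qed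

end
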